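(* Let $n\ge1$, $a\in\mathbb{R}^n$, fix $\beta\in(0,1)$ and put $q=1+\frac1{n+\beta}$. Let $\varepsilon>0$ be as in the following existence result: for each $w_0\in\mathcal{B}_1^{-\beta,\infty}$ with $\|w_0\|_{\mathcal{B}_1^{-\beta,\infty}}<\varepsilon$ there exists a solution $w\in\mathcal{X}$, for all $t\ge0$, of $$w_t-\Delta w+a\cdot\nabla(w|w|^{q-1})=0,\qquad w(\cdot,0)=w_0,$$ and it is the unique solution satisfying $\sup_{t>0}t^{(n/2)(1-1/q)+\beta/2}\|w(t)\|_q\le2\varepsilon$. Assume that $u$ and $v$ are two such solutions corresponding to the initial data $u_0,v_0\in\mathcal{B}_1^{-\beta,\infty}$ (with norms less than $\varepsilon$), respectively. Suppose that $$\lim_{t\to\infty}t^{\beta/2}\|e^{t\Delta}(u_0-v_0)\|_1=0.$$ Then, choosing $\varepsilon>0$ in the existence result sufficiently small, we have $$\lim_{t\to\infty}t^{(n/2)(1-1/p)+\beta/2}\|u(\cdot,t)-v(\cdot,t)\|_p=0$$ for every $p\in[1,\infty]$.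
   Context: $\|\cdot\|_p$ is the norm of $L^p(\mathbb{R}^n)$; $e^{t\Delta}v=G(\cdot,t)*v$ with $G(x,t)=(4\pi t)^{-n/2}\exp(-|x|^2/(4t))$, for tempered distributions $v$. The homogeneous Besov space is $\mathcal{B}_1^{-\beta,\infty}=\{v\in\mathcal{S}'(\mathbb{R}^n):\|v\|_{\mathcal{B}_1^{-\beta,\infty}}<\infty\}$ with norm $\|v\|_{\mathcal{B}_1^{-\beta,\infty}}=\sup_{s>0}s^{\beta/2}\|e^{s\Delta}v\|_1$. $\mathcal{X}=\mathcal{C}([0,\infty):\mathcal{B}_1^{-\beta,\infty})\cap\{u:(0,\infty)\to L^q(\mathbb{R}^n):\sup_{t>0}t^{(n/2)(1-1/q)+\beta/2}\|u(t)\|_q<\infty\}$, where $\mathcal{C}([0,\infty):\mathcal{B}_1^{-\beta,\infty})$ is the space of continuous functions on $[0,\infty)$ with values in $\mathcal{B}_1^{-\beta,\infty}$. A solution with initial datum $u_0$ is understood as a solution of the integral equation $u(t)=e^{t\Delta}u_0-\int_0^t a\cdot\nabla e^{(t-\tau)\Delta}(u|u|^{q-1})(\tau)\,d\tau$. *)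

theory Defs
  imports "HOL-Analysis.Analysis" "HOL-Probability.Essential_Supremum"
begin

section \<open>\<open>L\<^sup>p\<close> norms on \<open>\<real>\<^sup>n\<close>\<close>

text \<open>Elements of \<open>L\<^sup>p\<close> are represented by Borel functions; \<open>p\<close> ranges over
  \<open>[1, \<infinity>]\<close>, and the norm takes the value \<open>\<infinity>\<close> outside \<open>L\<^sup>p\<close>. The \<open>1/p\<close>-th power
  is written out because \<open>powr\<close> is not available on the extended nonnegative reals.\<close>

definition Lp_norm :: "ennreal \<Rightarrow> (real ^ 'n \<Rightarrow> real) \<Rightarrow> ennreal" where
  "Lp_norm p f =
    (if p = \<infinity> then esssup lborel (\<lambda>x. ennreal \<bar>f x\<bar>)
     else let I = (\<integral>\<^sup>+ x. ennreal (\<bar>f x\<bar> powr enn2real p) \<partial>lborel)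
          in if I = \<infinity> then \<infinity> else ennreal (enn2real I powr (1 / enn2real p)))"

definition Lp_space :: "ennreal \<Rightarrow> (real ^ 'n \<Rightarrow> real) set" where
  "Lp_space p = {f \<in> borel_measurable lborel. Lp_norm p f < \<infinity>}"


section \<open>Schwartz functions and tempered distributions\<close>

definition partial :: "'n \<Rightarrow> (real ^ 'n \<Rightarrow> real) \<Rightarrow> real ^ 'n \<Rightarrow> real" where
  "partial i f x = frechet_derivative f (at x) (axis i 1)"

definition grad :: "(real ^ 'n \<Rightarrow> real) \<Rightarrow> real ^ 'n \<Rightarrow> real ^ 'n" where
  "grad f x = (\<chi> i. partial i f x)"

primrec iter_partial :: "'n list \<Rightarrow> (real ^ 'n \<Rightarrow> real) \<Rightarrow> real ^ 'n \<Rightarrow> real" where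
  "iter_partial [] f = f"
| "iter_partial (i # is) f = partial i (iter_partial is f)"

definition schwartz :: "(real ^ 'n \<Rightarrow> real) set" where
  "schwartz = {\<phi>. \<forall>is. (\<forall>x. iter_partial is \<phi> differentiable (at x)) \<and>
     (\<forall>k::nat. bounded (range (\<lambda>x. (1 + norm x) ^ k * iter_partial is \<phi> x)))}"

definition schwartz_seminorm :: "nat \<Rightarrow> nat \<Rightarrow> (real ^ 'n \<Rightarrow> real) \<Rightarrow> real" where
  "schwartz_seminorm k m \<phi> =
    (\<Sum>is | length is \<le> m. SUP x. (1 + norm x) ^ k * \<bar>iter_partial is \<phi> x\<bar>)"

text \<open>A tempered distribution is represented by a functional on all functions, of which only the
  restriction to \<open>schwartz\<close> matters; in particular distributions are never compared by \<open>(=)\<close>.\<close>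

definition tempered :: "((real ^ 'n \<Rightarrow> real) \<Rightarrow> real) set" where
  "tempered = {T.
     (\<forall>\<phi>\<in>schwartz. \<forall>\<psi>\<in>schwartz. T (\<lambda>x. \<phi> x + \<psi> x) = T \<phi> + T \<psi>) \<and>
     (\<forall>c. \<forall>\<phi>\<in>schwartz. T (\<lambda>x. c * \<phi> x) = c * T \<phi>) \<and>
     (\<exists>C k m. \<forall>\<phi>\<in>schwartz. \<bar>T \<phi>\<bar> \<le> C * schwartz_seminorm k m \<phi>)}"

definition distribution_of :: "(real ^ 'n \<Rightarrow> real) \<Rightarrow> (real ^ 'n \<Rightarrow> real) \<Rightarrow> real" where
  "distribution_of f \<phi> = (\<integral>x. f x * \<phi> x \<partial>lborel)"


section \<open>Heat semigroup and Besov space\<close>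

definition heat_kernel :: "real ^ 'n \<Rightarrow> real \<Rightarrow> real" where
  "heat_kernel x t =
     (4 * pi * t) powr (- real CARD('n) / 2) * exp (- (norm x)\<^sup>2 / (4 * t))"

text \<open>For \<open>t > 0\<close> the distribution \<open>G(\<cdot>,t) * v\<close> is the smooth function
  \<open>x \<mapsto> v(G(x - \<cdot>,t))\<close>. The case \<open>t = 0\<close>, where the semigroup is the identity, is not covered.\<close>

definition heat :: "real \<Rightarrow> ((real ^ 'n \<Rightarrow> real) \<Rightarrow> real) \<Rightarrow> real ^ 'n \<Rightarrow> real" where
  "heat t v x = v (\<lambda>y. heat_kernel (x - y) t)"

definition besov_norm :: "real \<Rightarrow> ((real ^ 'n \<Rightarrow> real) \<Rightarrow> real) \<Rightarrow> ennreal" where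
  "besov_norm \<beta> v = (SUP s\<in>{0<..}. ennreal (s powr (\<beta> / 2)) * Lp_norm 1 (heat s v))"

definition besov :: "real \<Rightarrow> ((real ^ 'n \<Rightarrow> real) \<Rightarrow> real) set" where
  "besov \<beta> = {v \<in> tempered. besov_norm \<beta> v < \<infinity>}"


section \<open>Solutions of the convection-diffusion equation\<close>

text \<open>A curve with values in the Besov space whose values at positive times are functions is
  encoded by its value \<open>u0\<close> at time \<open>0\<close>, a distribution, and a family of functions \<open>u t\<close>, of
  which only those with \<open>t > 0\<close> matter.\<close>

definition trajectory ::
  "((real ^ 'n \<Rightarrow> real) \<Rightarrow> real) \<Rightarrow> (real \<Rightarrow> real ^ 'n \<Rightarrow> real) \<Rightarrow> real \<Rightarrow> (real ^ 'n \<Rightarrow> real) \<Rightarrow> real"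
  where "trajectory u0 u t = (if t = 0 then u0 else distribution_of (u t))"

definition weighted_sup_norm :: "real \<Rightarrow> real \<Rightarrow> (real \<Rightarrow> real ^ 'n \<Rightarrow> real) \<Rightarrow> ennreal" where
  "weighted_sup_norm \<beta> q u =
     (SUP t\<in>{0<..}. ennreal (t powr (real CARD('n) / 2 * (1 - 1 / q) + \<beta> / 2)) *
        Lp_norm (ennreal q) (u t))"

definition in_X ::
  "real \<Rightarrow> real \<Rightarrow> ((real ^ 'n \<Rightarrow> real) \<Rightarrow> real) \<Rightarrow> (real \<Rightarrow> real ^ 'n \<Rightarrow> real) \<Rightarrow> bool"
  where "in_X \<beta> q u0 u \<longleftrightarrow>
     (\<forall>t\<ge>0. trajectory u0 u t \<in> besov \<beta>) \<and>
     (\<forall>t\<ge>0. ((\<lambda>s. besov_norm \<beta> (trajectory u0 u s - trajectory u0 u t)) \<longlongrightarrow> 0) (at t within {0..})) \<and>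
     (\<forall>t>0. u t \<in> Lp_space (ennreal q)) \<and>
     weighted_sup_norm \<beta> q u < \<infinity>"

text \<open>The integrand \<open>a \<cdot> \<nabla> e\<^bsup>(t-\<tau>)\<Delta>\<^esup> (u |u|\<^bsup>q-1\<^esup>)(\<tau>)\<close> of the Duhamel term, evaluated at \<open>x\<close>.\<close>

definition duhamel_integrand ::
  "real ^ 'n \<Rightarrow> real \<Rightarrow> (real \<Rightarrow> real ^ 'n \<Rightarrow> real) \<Rightarrow> real \<Rightarrow> real \<Rightarrow> real ^ 'n \<Rightarrow> real" where
  "duhamel_integrand a q u t \<tau> x =
     a \<bullet> grad (heat (t - \<tau>) (distribution_of (\<lambda>y. u \<tau> y * \<bar>u \<tau> y\<bar> powr (q - 1)))) x"

text \<open>The integral equation, as an identity between functions of \<open>x\<close> for \<open>t > 0\<close>. At \<open>t = 0\<close> it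
  says that the curve starts at \<open>u0\<close>, which \<open>trajectory\<close> builds in.\<close>

definition mild_solution ::
  "real ^ 'n \<Rightarrow> real \<Rightarrow> ((real ^ 'n \<Rightarrow> real) \<Rightarrow> real) \<Rightarrow> (real \<Rightarrow> real ^ 'n \<Rightarrow> real) \<Rightarrow> bool"
  where "mild_solution a q u0 u \<longleftrightarrow>
     (\<forall>t>0. AE x in lborel.
        set_integrable lborel {0<..<t} (\<lambda>\<tau>. duhamel_integrand a q u t \<tau> x) \<and>
        u t x = heat t u0 x - (LINT \<tau>:{0<..<t}|lborel. duhamel_integrand a q u t \<tau> x))"

text \<open>The solutions singled out by the existence result with parameter \<open>\<epsilon>\<close>.\<close>

definition small_solution ::
  "real ^ 'n \<Rightarrow> real \<Rightarrow> real \<Rightarrow> real \<Rightarrow> ((real ^ 'n \<Rightarrow> real) \<Rightarrow> real) \<Rightarrow> (real \<Rightarrow> real ^ 'n \<Rightarrow> real) \<Rightarrow> bool"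
  where "small_solution a \<beta> q \<epsilon> u0 u \<longleftrightarrow>
     u0 \<in> besov \<beta> \<and> besov_norm \<beta> u0 < ennreal \<epsilon> \<and>
     in_X \<beta> q u0 u \<and> mild_solution a q u0 u \<and>
     weighted_sup_norm \<beta> q u \<le> ennreal (2 * \<epsilon>)"

end

theory Submission
  imports Defs "HOL-Probability.Distributions"
begin

text \<open>Write \<open>N(t) = t\<^sup>\<gamma> \<parallel>u(t) - v(t)\<parallel>\<^sub>q\<close> with \<open>\<gamma> = (n/2)(1-1/q) + \<beta>/2\<close>. The integral equation, the bound
  \<open>\<bar>a \<bullet> \<nabla>G(z,s)\<bar> \<le> C s\<^bsup>-1/2\<^esup> G(z,2s)\<close> and Young's and Hoelder's inequalities control \<open>N\<close> at time \<open>2\<sigma>\<close> by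
  \<open>\<sigma>\<^bsup>\<beta>/2\<^esup> \<parallel>e\<^bsup>\<sigma>\<Delta>\<^esup>(u\<^sub>0 - v\<^sub>0)\<parallel>\<^sub>1\<close>, a term in which the values of \<open>N\<close> before a fixed time enter with a
  factor vanishing as \<open>\<sigma> \<rightarrow> \<infinity>\<close>, and \<open>C \<epsilon>\<^bsup>q-1\<^esup>\<close> times the later supremum of \<open>N\<close>; the powers of \<open>t\<close> cancel
  because \<open>q (n + \<beta>) = n + \<beta> + 1\<close>. For small \<open>\<epsilon>\<close> an eventual bound on \<open>N\<close> is therefore eventually
  halved, so \<open>N \<rightarrow> 0\<close>. The same estimate with the late part of the Duhamel integral taken in
  \<open>L\<^bsup>r/q\<^esup>\<close> transfers decay from \<open>L\<^sup>r\<close> to \<open>L\<^sup>p\<close> with \<open>1/p\<close> smaller than \<open>1/r\<close> by a fixed amount, and a finite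
  iteration reaches every \<open>p\<close>.\<close>

section \<open>Inequalities for \<open>L\<^sup>p\<close> norms\<close>

text \<open>The smallness of \<epsilon> is spent only once, at the exponent q, where the same norm
  stands on both sides. Every other exponent is reached from norms already known to vanish, with
  factors of any size, so one threshold serves all p. Two features of the setting shape the rest.
  The datum is a tempered distribution, so neither the measurability of e^(t\<Delta>)u0 nor the law
  e^((t+s)\<Delta>)u0 = e^(t\<Delta>)e^(s\<Delta>)u0 is immediate; both are recovered almost
  everywhere, from the integral equation and the continuity of the solution at time 0. And a
  solution is measurable in x at each single time, while Fubini arguments on the Duhamel term
  require joint measurability; this comes from the continuity in x of the heat gradient. Time is
  halved throughout: at time 2\<sigma> the datum has been smoothed for a time \<sigma> after its L^1
  norm was measured, and the Duhamel kernel is singular only at the end of the second half.\<close>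

lemma Lp_norm_le_iff:
  fixes f :: "real ^ 'n \<Rightarrow> real"
  assumes "0 < r" "0 \<le> B"
  shows "Lp_norm (ennreal r) f \<le> ennreal B \<longleftrightarrow>
    (\<integral>\<^sup>+ x. ennreal (\<bar>f x\<bar> powr r) \<partial>lborel) \<le> ennreal (B powr r)"
proof (cases "(\<integral>\<^sup>+ x. ennreal (\<bar>f x\<bar> powr r) \<partial>lborel)")
  case (real i)
  have "i powr (1 / r) \<le> B \<longleftrightarrow> i \<le> B powr r"
  proof
    assume "i powr (1 / r) \<le> B"
    then have "(i powr (1 / r)) powr r \<le> B powr r"
      using assms by (intro powr_mono2) auto
    then show "i \<le> B powr r" using assms real by (simp add: powr_powr)
  next
    assume "i \<le> B powr r"
    then have "i powr (1 / r) \<le> (B powr r) powr (1 / r)"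
      using assms real by (intro powr_mono2) auto
    then show "i powr (1 / r) \<le> B" using assms real by (simp add: powr_powr)
  qed
  then show ?thesis
    using assms real by (simp add: Lp_norm_def Let_def)
next
  case top
  then show ?thesis using assms by (simp add: Lp_norm_def Let_def top_unique)
qed

lemma Lp_norm_top_le_iff:
  fixes f :: "real ^ 'n \<Rightarrow> real"
  assumes [measurable]: "f \<in> borel_measurable lborel" and "0 \<le> B"
  shows "Lp_norm \<infinity> f \<le> ennreal B \<longleftrightarrow> (AE x in lborel. \<bar>f x\<bar> \<le> B)"
proof
  assume *: "Lp_norm \<infinity> f \<le> ennreal B"
  have "AE x in lborel. ennreal \<bar>f x\<bar> \<le> esssup lborel (\<lambda>x. ennreal \<bar>f x\<bar>)"
    by (rule esssup_AE)
  then show "AE x in lborel. \<bar>f x\<bar> \<le> B"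
  proof eventually_elim
    case (elim x)
    then have "ennreal \<bar>f x\<bar> \<le> ennreal B"
      using * by (simp add: Lp_norm_def)
    then show ?case using assms by (simp add: ennreal_le_iff)
  qed
next
  assume "AE x in lborel. \<bar>f x\<bar> \<le> B"
  then show "Lp_norm \<infinity> f \<le> ennreal B"
    unfolding Lp_norm_def
    by (auto intro!: esssup_I elim!: eventually_mono simp: ennreal_leI)
qed

lemma Lp_norm_1_eq: "Lp_norm 1 f = (\<integral>\<^sup>+ x. ennreal \<bar>f x\<bar> \<partial>lborel)"
  by (simp add: Lp_norm_def Let_def ennreal_enn2real_if top_unique)

text \<open>Exponents enter the decay rates through \<open>enn2real (1 / p)\<close>, which is 0 at
  \<infinity>. Rates can thus be written once for finite and infinite p, and only norm computations
  split into cases.\<close>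

lemma enn2real_exponent_cases:
  fixes p :: ennreal
  assumes "1 \<le> p"
  obtains "p = \<infinity>" "enn2real (1 / p) = 0"
  | r where "p = ennreal r" "1 \<le> r" "enn2real (1 / p) = 1 / r"
proof (cases p)
  case (real r)
  then have "1 \<le> r" using assms by simp
  then have "enn2real (1 / p) = 1 / r"
    using real by (simp add: divide_ennreal flip: ennreal_1)
  then show ?thesis using that(2) real \<open>1 \<le> r\<close> by blast
next
  case top
  then show ?thesis using that(1) by simp
qed

section \<open>Convexity of powers; triangle, Jensen and Minkowski inequalities\<close>

text \<open>The graph of y^p lies above its tangent line at c. Young's inequality for y and c^(p-1)
  with conjugate exponents p and p/(p-1) gives this without differentiation and includes c = 0. It
  yields Jensen's inequality and also a mean value estimate for powers.\<close>

lemma powr_le_tangent: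
  fixes y c p :: real
  assumes "1 \<le> p" "0 \<le> y" "0 \<le> c"
  shows "p * c powr (p - 1) * y \<le> y powr p + (p - 1) * c powr p"
proof (cases "p = 1")
  case True
  then show ?thesis using assms by (auto simp: powr_def)
next
  case False
  then have p: "1 < p" using assms by simp
  then have "y * c powr (p - 1) \<le> y powr p / p + (c powr (p - 1)) powr (p / (p - 1)) / (p / (p - 1))"
    using assms by (intro Youngs_inequality) (auto simp: field_simps)
  also have "(c powr (p - 1)) powr (p / (p - 1)) = c powr p"
    using p by (simp add: powr_powr)
  finally show ?thesis using p by (simp add: field_simps)
qed

lemma powr_add_le:
  fixes a b p :: real
  assumes "1 \<le> p" "0 \<le> a" "0 \<le> b"
  shows "a powr p + b powr p \<le> (a + b) powr p"
proof -
  have *: "x powr p = x powr (p - 1) * x" if "0 \<le> x" for x :: real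
    using that powr_mult_base[of x "p - 1"] by (simp add: mult.commute)
  have "a powr (p - 1) * a \<le> (a + b) powr (p - 1) * a" "b powr (p - 1) * b \<le> (a + b) powr (p - 1) * b"
    using assms by (auto intro!: mult_right_mono powr_mono2)
  then show ?thesis using assms by (simp add: * algebra_simps)
qed

text \<open>The constant is not optimal; nothing below depends on its value.\<close>

lemma Lp_norm_add_le:
  fixes f g :: "real ^ 'n \<Rightarrow> real"
  assumes [measurable]: "f \<in> borel_measurable lborel" "g \<in> borel_measurable lborel"
    and p: "1 \<le> p" and f: "Lp_norm p f \<le> ennreal A" and g: "Lp_norm p g \<le> ennreal B"
    and h: "\<And>x. \<bar>h x\<bar> \<le> \<bar>f x\<bar> + \<bar>g x\<bar>" and [measurable]: "h \<in> borel_measurable lborel"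
    and nn: "0 \<le> A" "0 \<le> B"
  shows "Lp_norm p h \<le> ennreal (2 * (A + B))"
  using p
proof (cases rule: enn2real_exponent_cases)
  case 1
  then have "AE x in lborel. \<bar>f x\<bar> \<le> A" "AE x in lborel. \<bar>g x\<bar> \<le> B"
    using f g nn Lp_norm_top_le_iff[of f A] Lp_norm_top_le_iff[of g B] by auto
  then have "AE x in lborel. \<bar>h x\<bar> \<le> 2 * (A + B)"
  proof eventually_elim
    case (elim x)
    then show ?case using h[of x] nn by simp
  qed
  then show ?thesis using 1 nn Lp_norm_top_le_iff[of h "2 * (A + B)"] by simp
next
  case (2 r)
  have *: "\<bar>h x\<bar> powr r \<le> 2 powr r * (\<bar>f x\<bar> powr r + \<bar>g x\<bar> powr r)" for x
  proof -
    have "\<bar>h x\<bar> powr r \<le> (2 * max \<bar>f x\<bar> \<bar>g x\<bar>) powr r"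
      using h[of x] 2 by (intro powr_mono2) auto
    also have "\<dots> = 2 powr r * max \<bar>f x\<bar> \<bar>g x\<bar> powr r"
      by (simp add: powr_mult)
    also have "\<dots> \<le> 2 powr r * (\<bar>f x\<bar> powr r + \<bar>g x\<bar> powr r)"
      by (intro mult_left_mono) (auto simp: max_def)
    finally show ?thesis .
  qed
  have "(\<integral>\<^sup>+ x. ennreal (\<bar>h x\<bar> powr r) \<partial>lborel)
      \<le> (\<integral>\<^sup>+ x. ennreal (2 powr r) * (ennreal (\<bar>f x\<bar> powr r) + ennreal (\<bar>g x\<bar> powr r)) \<partial>lborel)"
    using * by (intro nn_integral_mono) (simp flip: ennreal_plus ennreal_mult)
  also have "\<dots> = ennreal (2 powr r) * ((\<integral>\<^sup>+ x. ennreal (\<bar>f x\<bar> powr r) \<partial>lborel) + (\<integral>\<^sup>+ x. ennreal (\<bar>g x\<bar> powr r) \<partial>lborel))"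
    by (simp add: nn_integral_cmult nn_integral_add)
  also have "\<dots> \<le> ennreal (2 powr r) * (ennreal (A powr r) + ennreal (B powr r))"
    using f g 2 nn Lp_norm_le_iff[of r A f] Lp_norm_le_iff[of r B g]
    by (intro mult_left_mono add_mono) auto
  also have "\<dots> \<le> ennreal ((2 * (A + B)) powr r)"
    using powr_add_le[of r A B] 2 nn
    by (subst powr_mult) (simp_all add: mult_left_mono flip: ennreal_plus ennreal_mult)
  finally show ?thesis
    using 2 nn Lp_norm_le_iff[of r "2 * (A + B)" h] by simp
qed

text \<open>Jensen's inequality for a weight of mass at most W, by integrating the tangent
  inequality against w.\<close>

lemma weighted_jensen_powr:
  fixes w g :: "'a \<Rightarrow> real"
  assumes [measurable]: "w \<in> borel_measurable M" "g \<in> borel_measurable M"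
    and w: "\<And>x. 0 \<le> w x" and g: "\<And>x. 0 \<le> g x" and p: "1 \<le> p"
    and W: "(\<integral>\<^sup>+ x. ennreal (w x) \<partial>M) \<le> ennreal W" "0 \<le> W"
  shows "ennreal ((\<integral>x. w x * g x \<partial>M) powr p)
    \<le> ennreal (W powr (p - 1)) * (\<integral>\<^sup>+ x. ennreal (w x * g x powr p) \<partial>M)"
proof -
  define I where "I = (\<integral>x. w x * g x \<partial>M)"
  define J where "J = (\<integral>\<^sup>+ x. ennreal (w x * g x powr p) \<partial>M)"
  have I0: "0 \<le> I" unfolding I_def using w g by (intro integral_nonneg_AE) auto
  have wi: "integrable M w"
    using W w by (intro integrableI_nonneg) (auto simp: le_less_trans)
  have wle: "(\<integral>x. w x \<partial>M) \<le> W"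
    using W w by (simp add: nn_integral_eq_integral[OF wi])
  \<comment> \<open>A non-integrable product has Bochner integral 0, so this case is as trivial as I
    = 0.\<close>
  show ?thesis
  proof (cases "I = 0 \<or> \<not> integrable M (\<lambda>x. w x * g x)")
    case True
    then have "I = 0" by (auto simp: I_def not_integrable_integral_eq)
    then show ?thesis using p by (simp add: I_def)
  next
    case False
    then have Ipos: "0 < I" and wg: "integrable M (\<lambda>x. w x * g x)" using I0 by auto
    have "W \<noteq> 0"
    proof
      assume "W = 0"
      then have "(\<integral>\<^sup>+ x. ennreal (w x) \<partial>M) = 0" using W by simp
      then have "AE x in M. ennreal (w x) = 0" by (subst (asm) nn_integral_0_iff_AE) auto
      then have "AE x in M. w x * g x = 0" by eventually_elim (use w in \<open>auto simp: ennreal_eq_0_iff intro: antisym\<close>)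
      then have "I = 0" unfolding I_def by (rule integral_eq_zero_AE)
      then show False using Ipos by simp
    qed
    then have Wpos: "0 < W" using W by simp
    show ?thesis
    proof (cases J)
      case top
      then show ?thesis using Wpos by (simp add: J_def ennreal_mult_top)
    next
      case (real j)
      have wgp: "integrable M (\<lambda>x. w x * g x powr p)"
        using real w by (intro integrableI_nonneg) (auto simp: J_def)
      have j: "j = (\<integral>x. w x * g x powr p \<partial>M)"
        using real w by (simp add: J_def nn_integral_eq_integral[OF wgp])
      \<comment> \<open>The tangent point is the weighted mean; there the tangent inequality
        integrates to c^(p-1) I \<le> j, which is the claim divided by W^(p-1).\<close>
      define c where "c = I / W"
      have cpos: "0 < c" using Ipos Wpos by (simp add: c_def)
      have "(\<integral>x. p * c powr (p - 1) * (w x * g x) \<partial>M) \<le> (\<integral>x. w x * g x powr p + (p - 1) * c powr p * w x \<partial>M)"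
      proof (intro integral_mono)
        fix x
        have "w x * (p * c powr (p - 1) * g x) \<le> w x * (g x powr p + (p - 1) * c powr p)"
          using powr_le_tangent[OF p g, of c x] cpos w by (intro mult_left_mono) auto
        then show "p * c powr (p - 1) * (w x * g x) \<le> w x * g x powr p + (p - 1) * c powr p * w x"
          by (simp add: algebra_simps)
      qed (use wg wgp wi in auto)
      then have "p * c powr (p - 1) * I \<le> j + (p - 1) * c powr p * (\<integral>x. w x \<partial>M)"
        using wg wgp wi by (simp add: I_def j)
      also have "\<dots> \<le> j + (p - 1) * c powr p * W"
        using wle p by (intro add_left_mono mult_left_mono) auto
      also have "c powr p * W = c powr (p - 1) * I"
        using cpos Wpos powr_mult_base[of c "p - 1"] by (simp add: c_def field_simps)
      then have "(p - 1) * c powr p * W = (p - 1) * (c powr (p - 1) * I)" by simp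
      finally have "c powr (p - 1) * I \<le> j" by (simp add: algebra_simps)
      moreover have "I powr p = W powr (p - 1) * (c powr (p - 1) * I)"
        using Ipos Wpos powr_mult_base[of I "p - 1"] by (simp add: c_def powr_divide mult.commute)
      ultimately have "I powr p \<le> W powr (p - 1) * j"
        using Wpos by (simp add: mult_left_mono)
      then show ?thesis using real
        by (simp add: I_def[symmetric] J_def[symmetric] flip: ennreal_mult)
    qed
  qed
qed

text \<open>Minkowski's integral inequality, stated with a scalar majorant m of the norms. For
  finite p, Jensen's inequality with weight m is applied to |F|/m and Fubini's theorem finishes.
  That F vanishes pointwise where m does makes m * (|F|/m) = |F| hold everywhere, in spite of
  division by zero.\<close>

lemma Lp_norm_integral_le:
  fixes F :: "real \<Rightarrow> real ^ 'n \<Rightarrow> real" and m :: "real \<Rightarrow> real"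
  assumes F[measurable]: "case_prod F \<in> borel_measurable (lborel \<Otimes>\<^sub>M lborel)"
    and m[measurable]: "m \<in> borel_measurable lborel" and m0: "\<And>\<tau>. 0 \<le> m \<tau>"
    and Fm: "\<And>\<tau>. Lp_norm p (F \<tau>) \<le> ennreal (m \<tau>)"
    and Fz: "\<And>\<tau> x. m \<tau> = 0 \<Longrightarrow> F \<tau> x = 0"
    and p: "1 \<le> p" and B: "(\<integral>\<^sup>+ \<tau>. ennreal (m \<tau>) \<partial>lborel) \<le> ennreal B" "0 \<le> B"
  shows "Lp_norm p (\<lambda>x. \<integral>\<tau>. F \<tau> x \<partial>lborel) \<le> ennreal B"
proof -
  have F': "(\<lambda>(x, \<tau>). F \<tau> x) \<in> borel_measurable (lborel \<Otimes>\<^sub>M lborel)"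
    using measurable_pair_swap[OF F] by (simp add: case_prod_beta)
  have [measurable]: "F \<tau> \<in> borel_measurable lborel" for \<tau>
    by (rule measurable_compose[OF _ F, of "\<lambda>x. (\<tau>, x)", simplified])
      simp
  have [measurable]: "(\<lambda>\<tau>. F \<tau> x) \<in> borel_measurable lborel" for x
    by (rule measurable_compose[OF _ F, of "\<lambda>\<tau>. (\<tau>, x)", simplified]) simp
  have I[measurable]: "(\<lambda>x. \<integral>\<tau>. F \<tau> x \<partial>lborel) \<in> borel_measurable lborel"
    by (rule lborel.borel_measurable_lebesgue_integral) (use F' in simp)
  from p show ?thesis
  proof (cases rule: enn2real_exponent_cases)
    case 1
    have "AE \<tau> in lborel. AE x in lborel. \<bar>F \<tau> x\<bar> \<le> m \<tau>"
      using Fm m0 1 Lp_norm_top_le_iff[of "F _" "m _"] by auto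
    \<comment> \<open>The exceptional set of x depends on \<tau>; measurability of F on the product
      allows the two quantifiers to be exchanged.\<close>
    then have "AE x in lborel. AE \<tau> in lborel. \<bar>F \<tau> x\<bar> \<le> m \<tau>"
    proof (subst lborel_pair.AE_commute[symmetric])
      have "Measurable.pred (lborel \<Otimes>\<^sub>M lborel) (\<lambda>z. \<bar>case_prod F z\<bar> \<le> m (fst z))"
        by measurable
      then show "{z \<in> space (lborel \<Otimes>\<^sub>M lborel). \<bar>F (fst z) (snd z)\<bar> \<le> m (fst z)} \<in> sets (lborel \<Otimes>\<^sub>M lborel)"
        by (simp add: pred_def case_prod_beta)
    qed
    then have "AE x in lborel. \<bar>\<integral>\<tau>. F \<tau> x \<partial>lborel\<bar> \<le> B"
    proof eventually_elim
      case (elim x)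
      have "ennreal (norm (\<integral>\<tau>. F \<tau> x \<partial>lborel)) \<le> (\<integral>\<^sup>+ \<tau>. ennreal (norm (F \<tau> x)) \<partial>lborel)"
      proof (cases "integrable lborel (\<lambda>\<tau>. F \<tau> x)")
        case True
        then show ?thesis by (rule integral_norm_bound_ennreal)
      qed (simp add: not_integrable_integral_eq)
      also have "\<dots> \<le> (\<integral>\<^sup>+ \<tau>. ennreal (m \<tau>) \<partial>lborel)"
        using elim by (intro nn_integral_mono_AE) (auto elim!: eventually_mono simp: ennreal_leI)
      also have "\<dots> \<le> ennreal B" by fact
      finally show ?case using B by simp
    qed
    then show ?thesis using 1 B Lp_norm_top_le_iff[OF I, of B] by simp
  next
    case (2 r)
    have pt: "ennreal (\<bar>\<integral>\<tau>. F \<tau> x \<partial>lborel\<bar> powr r)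
      \<le> ennreal (B powr (r - 1)) * (\<integral>\<^sup>+ \<tau>. ennreal (m \<tau> * (\<bar>F \<tau> x\<bar> / m \<tau>) powr r) \<partial>lborel)" for x
    proof -
      have eq: "m \<tau> * (\<bar>F \<tau> x\<bar> / m \<tau>) = \<bar>F \<tau> x\<bar>" for \<tau>
        using Fz[of \<tau> x] by (cases "m \<tau> = 0") auto
      have "\<bar>\<integral>\<tau>. F \<tau> x \<partial>lborel\<bar> \<le> (\<integral>\<tau>. m \<tau> * (\<bar>F \<tau> x\<bar> / m \<tau>) \<partial>lborel)"
        unfolding eq by (rule integral_abs_bound)
      then have "ennreal (\<bar>\<integral>\<tau>. F \<tau> x \<partial>lborel\<bar> powr r) \<le> ennreal ((\<integral>\<tau>. m \<tau> * (\<bar>F \<tau> x\<bar> / m \<tau>) \<partial>lborel) powr r)"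
        using 2 by (intro ennreal_leI powr_mono2) auto
      also have "\<dots> \<le> ennreal (B powr (r - 1)) * (\<integral>\<^sup>+ \<tau>. ennreal (m \<tau> * (\<bar>F \<tau> x\<bar> / m \<tau>) powr r) \<partial>lborel)"
        using 2 m0 B by (intro weighted_jensen_powr) auto
      finally show ?thesis .
    qed
    have meas: "(\<lambda>(\<tau>, x). ennreal (m \<tau> * (\<bar>F \<tau> x\<bar> / m \<tau>) powr r)) \<in> borel_measurable (lborel \<Otimes>\<^sub>M lborel)"
      using F m by (auto simp: case_prod_beta)
    have meas': "(\<lambda>(x, \<tau>). ennreal (m \<tau> * (\<bar>F \<tau> x\<bar> / m \<tau>) powr r)) \<in> borel_measurable (lborel \<Otimes>\<^sub>M lborel)"
      using F' m by (auto simp: case_prod_beta)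
    have inner: "(\<integral>\<^sup>+ x. ennreal (m \<tau> * (\<bar>F \<tau> x\<bar> / m \<tau>) powr r) \<partial>lborel) \<le> ennreal (m \<tau>)" for \<tau>
    proof (cases "m \<tau> = 0")
      case False
      then have mp: "0 < m \<tau>" using m0[of \<tau>] by simp
      have "(\<integral>\<^sup>+ x. ennreal (m \<tau> * (\<bar>F \<tau> x\<bar> / m \<tau>) powr r) \<partial>lborel)
         = (\<integral>\<^sup>+ x. ennreal (m \<tau> / m \<tau> powr r) * ennreal (\<bar>F \<tau> x\<bar> powr r) \<partial>lborel)"
        using mp by (intro nn_integral_cong) (simp add: powr_divide flip: ennreal_mult)
      also have "\<dots> = ennreal (m \<tau> / m \<tau> powr r) * (\<integral>\<^sup>+ x. ennreal (\<bar>F \<tau> x\<bar> powr r) \<partial>lborel)"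
        by (rule nn_integral_cmult) simp
      also have "\<dots> \<le> ennreal (m \<tau> / m \<tau> powr r) * ennreal (m \<tau> powr r)"
        using Fm[of \<tau>] 2 mp Lp_norm_le_iff[of r "m \<tau>" "F \<tau>"] by (intro mult_left_mono) auto
      also have "\<dots> = ennreal (m \<tau>)"
        using mp by (simp flip: ennreal_mult)
      finally show ?thesis .
    qed auto
    have "(\<integral>\<^sup>+ x. ennreal (\<bar>\<integral>\<tau>. F \<tau> x \<partial>lborel\<bar> powr r) \<partial>lborel)
      \<le> (\<integral>\<^sup>+ x. ennreal (B powr (r - 1)) * (\<integral>\<^sup>+ \<tau>. ennreal (m \<tau> * (\<bar>F \<tau> x\<bar> / m \<tau>) powr r) \<partial>lborel) \<partial>lborel)"
      by (intro nn_integral_mono pt)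
    also have "\<dots> = ennreal (B powr (r - 1)) * (\<integral>\<^sup>+ x. (\<integral>\<^sup>+ \<tau>. ennreal (m \<tau> * (\<bar>F \<tau> x\<bar> / m \<tau>) powr r) \<partial>lborel) \<partial>lborel)"
      by (intro nn_integral_cmult lborel.borel_measurable_nn_integral meas')
    also have "(\<integral>\<^sup>+ x. (\<integral>\<^sup>+ \<tau>. ennreal (m \<tau> * (\<bar>F \<tau> x\<bar> / m \<tau>) powr r) \<partial>lborel) \<partial>lborel)
       = (\<integral>\<^sup>+ \<tau>. (\<integral>\<^sup>+ x. ennreal (m \<tau> * (\<bar>F \<tau> x\<bar> / m \<tau>) powr r) \<partial>lborel) \<partial>lborel)"
      by (rule lborel_pair.Fubini'[OF meas])
    also have "\<dots> \<le> (\<integral>\<^sup>+ \<tau>. ennreal (m \<tau>) \<partial>lborel)"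
      by (intro nn_integral_mono inner)
    also have "\<dots> \<le> ennreal B" by fact
    also have "ennreal (B powr (r - 1)) * ennreal B = ennreal (B powr r)"
      using B powr_mult_base[of B "r - 1"] by (simp add: mult.commute flip: ennreal_mult)
    finally show ?thesis
      using 2 B Lp_norm_le_iff[of r B "\<lambda>x. \<integral>\<tau>. F \<tau> x \<partial>lborel"] by (simp add: mult_left_mono)
  qed
qed

section \<open>Lipschitz estimates for the nonlinearity\<close>

text \<open>A mean value bound, since s|s|^k has derivative (k+1)|s|^k. For equal signs it is the
  tangent inequality at the argument of larger modulus; for opposite signs the difference is a sum
  of powers and superadditivity applies.\<close>

lemma abs_signed_powr_diff_le:
  fixes a b k :: real
  assumes "0 \<le> k"
  shows "\<bar>a * \<bar>a\<bar> powr k - b * \<bar>b\<bar> powr k\<bar> \<le> (k + 1) * (\<bar>a\<bar> + \<bar>b\<bar>) powr k * \<bar>a - b\<bar>"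
proof -
  have base: "x * x powr k = x powr (k + 1)" if "0 \<le> x" for x :: real
    using that powr_mult_base[of x k] by (simp add: add.commute)
  have pos: "\<bar>x * x powr k - y * y powr k\<bar> \<le> (k + 1) * (x + y) powr k * \<bar>x - y\<bar>"
    if "0 \<le> y" "y \<le> x" for x y :: real
  proof -
    have "(k + 1) * x powr k * y \<le> y powr (k + 1) + k * x powr (k + 1)"
      using powr_le_tangent[of "k + 1" y x] that assms by simp
    then have "x * x powr k - y * y powr k \<le> (k + 1) * x powr k * (x - y)"
      using that base[of x] base[of y] by (simp add: algebra_simps)
    also have "\<dots> \<le> (k + 1) * (x + y) powr k * (x - y)"
      using that assms by (intro mult_right_mono mult_left_mono powr_mono2) auto
    finally have "x * x powr k - y * y powr k \<le> (k + 1) * (x + y) powr k * \<bar>x - y\<bar>"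
      using that by simp
    moreover have "y * y powr k \<le> x * x powr k"
      using that assms by (intro mult_mono powr_mono2) auto
    ultimately show ?thesis by simp
  qed
  have neg: "x * x powr k + y * y powr k \<le> (k + 1) * (x + y) powr k * (x + y)"
    if "0 \<le> y" "0 \<le> x" for x y :: real
  proof -
    have "x * x powr k + y * y powr k \<le> (x + y) powr (k + 1)"
      using powr_add_le[of "k + 1" x y] that assms by (simp add: base)
    also have "\<dots> = 1 * ((x + y) powr k * (x + y))" using base[of "x + y"] that by (simp add: mult.commute)
    also have "\<dots> \<le> (k + 1) * ((x + y) powr k * (x + y))"
      using that assms by (intro mult_right_mono) auto
    finally show ?thesis by (simp add: mult.assoc)
  qed
  consider "0 \<le> b" "b \<le> a" | "0 \<le> a" "a \<le> b" | "b \<le> a" "a \<le> 0" | "a \<le> b" "b \<le> 0"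
    | "0 \<le> a" "b \<le> 0" | "a \<le> 0" "0 \<le> b" by linarith
  then show ?thesis
  proof cases
    case 1 then show ?thesis using pos[of b a] by simp
  next
    case 2 then show ?thesis using pos[of a b] by (simp add: abs_minus_commute add.commute)
  next
    case 3 then show ?thesis using pos[of "-a" "-b"] by (simp add: abs_minus_commute add.commute)
  next
    case 4 then show ?thesis using pos[of "-b" "-a"] by (simp add: abs_minus_commute add.commute)
  next
    case 5
    have "0 \<le> a * a powr k" "0 \<le> - b * (-b) powr k" using 5 by (simp_all add: mult_nonpos_nonneg)
    then have "\<bar>a * a powr k - b * (-b) powr k\<bar> = a * a powr k + (-b) * (-b) powr k" by simp
    then show ?thesis using neg[of "-b" a] 5 by simp
  next
    case 6
    have "0 \<le> b * b powr k" "0 \<le> - a * (-a) powr k" using 6 by (simp_all add: mult_nonpos_nonneg)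
    then have "\<bar>a * (-a) powr k - b * b powr k\<bar> = (-a) * (-a) powr k + b * b powr k" by simp
    then show ?thesis using neg[of b "-a"] 6 by (simp add: abs_minus_commute)
  qed
qed

text \<open>Hoelder's inequality for W^(q-1) in L^(r/(q-1)) and |u - v| in L^r, where W = |u| + |v|.
  Both factors are normalised by their norm bounds, and Young's inequality with weights 1 - 1/q and
  1/q is applied pointwise; the division explains why A and D are positive.\<close>

lemma Lp_norm_signed_powr_diff_le:
  fixes u v :: "real ^ 'n \<Rightarrow> real"
  assumes [measurable]: "u \<in> borel_measurable lborel" "v \<in> borel_measurable lborel"
    and q: "1 < q" and r: "q \<le> r" and A: "0 < A" and D: "0 < D"
    and u: "Lp_norm (ennreal r) u \<le> ennreal A" and v: "Lp_norm (ennreal r) v \<le> ennreal A"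
    and uv: "Lp_norm (ennreal r) (u - v) \<le> ennreal D"
  shows "Lp_norm (ennreal (r / q)) (\<lambda>x. u x * \<bar>u x\<bar> powr (q - 1) - v x * \<bar>v x\<bar> powr (q - 1))
    \<le> ennreal (q * (4 * A) powr (q - 1) * D)"
proof -
  define W where "W x = \<bar>u x\<bar> + \<bar>v x\<bar>" for x
  \<comment> \<open>The triangle inequality with constant 2 bounds the norm of W by 2 (A +
    A).\<close>
  define B where "B = 4 * A"
  have B: "0 < B" using A by (simp add: B_def)
  have [measurable]: "W \<in> borel_measurable lborel" unfolding W_def by measurable
  have r0: "1 < r" using q r by simp
  have "Lp_norm (ennreal r) W \<le> ennreal (2 * (A + A))"
    using r0 A by (intro Lp_norm_add_le[OF _ _ _ u v]) (auto simp: W_def)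
  then have WI: "(\<integral>\<^sup>+ x. ennreal (W x powr r) \<partial>lborel) \<le> ennreal (B powr r)"
    using r0 A Lp_norm_le_iff[of r B W] by (simp add: B_def W_def)
  have DI: "(\<integral>\<^sup>+ x. ennreal (\<bar>u x - v x\<bar> powr r) \<partial>lborel) \<le> ennreal (D powr r)"
    using r0 D uv Lp_norm_le_iff[of r D "u - v"] by simp
  define s where "s = r / q"
  have s: "1 \<le> s" using q r by (simp add: s_def)
  define K where "K = (q * B powr (q - 1) * D) powr s"
  have pt: "\<bar>u x * \<bar>u x\<bar> powr (q - 1) - v x * \<bar>v x\<bar> powr (q - 1)\<bar> powr s
     \<le> K * (1 / q / D powr r * \<bar>u x - v x\<bar> powr r + (1 - 1 / q) / B powr r * W x powr r)" for x
  proof -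
    have "\<bar>u x * \<bar>u x\<bar> powr (q - 1) - v x * \<bar>v x\<bar> powr (q - 1)\<bar> powr s
       \<le> (q * W x powr (q - 1) * \<bar>u x - v x\<bar>) powr s"
      using abs_signed_powr_diff_le[of "q - 1" "u x" "v x"] q s by (intro powr_mono2) (auto simp: W_def)
    also have "q * W x powr (q - 1) * \<bar>u x - v x\<bar>
        = (q * B powr (q - 1) * D) * ((W x / B) powr (q - 1) * (\<bar>u x - v x\<bar> / D))"
      using B D by (simp add: powr_divide W_def)
    also have "\<dots> powr s = K * ((W x / B) powr (q - 1) * (\<bar>u x - v x\<bar> / D)) powr s"
      unfolding K_def by (rule powr_mult)
    also have "((W x / B) powr (q - 1) * (\<bar>u x - v x\<bar> / D)) powr s
       = ((\<bar>u x - v x\<bar> / D) powr r) powr (1 / q) * ((W x / B) powr r) powr (1 - 1 / q)"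
    proof -
      have "(q - 1) * s = r * (1 - 1 / q)" "s = r * (1 / q)" using q by (simp_all add: s_def field_simps)
      then show ?thesis
        by (simp only: powr_mult powr_powr) (simp only: mult.commute)
    qed
    also have "\<dots> \<le> 1 / q * (\<bar>u x - v x\<bar> / D) powr r + (1 - 1 / q) * (W x / B) powr r"
    proof (cases "\<bar>u x - v x\<bar> / D = 0 \<or> W x / B = 0")
      case True
      have "0 \<le> 1 / q * (\<bar>u x - v x\<bar> / D) powr r + (1 - 1 / q) * (W x / B) powr r"
        using q by (intro add_nonneg_nonneg mult_nonneg_nonneg) auto
      moreover have "((\<bar>u x - v x\<bar> / D) powr r) powr (1 / q) * ((W x / B) powr r) powr (1 - 1 / q) = 0"
        using True by auto
      ultimately show ?thesis by linarith
    next
      case False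
      then show ?thesis using B D q
        by (intro Youngs_inequality_0) (auto simp: W_def field_simps)
    qed
    also have "\<dots> = 1 / q / D powr r * \<bar>u x - v x\<bar> powr r + (1 - 1 / q) / B powr r * W x powr r"
      using B D by (simp add: powr_divide W_def)
    finally show ?thesis by (simp add: K_def mult_left_mono)
  qed
  define c1 c2 where "c1 = 1 / q / D powr r" and "c2 = (1 - 1 / q) / B powr r"
  have K0: "0 \<le> K" and c: "0 \<le> c1" "0 \<le> c2"
    using q by (auto simp: K_def c1_def c2_def)
  have "(\<integral>\<^sup>+ x. ennreal (\<bar>u x * \<bar>u x\<bar> powr (q - 1) - v x * \<bar>v x\<bar> powr (q - 1)\<bar> powr s) \<partial>lborel)
     \<le> (\<integral>\<^sup>+ x. ennreal K * (ennreal c1 * ennreal (\<bar>u x - v x\<bar> powr r) + ennreal c2 * ennreal (W x powr r)) \<partial>lborel)"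
    using pt[folded c1_def c2_def] K0 c by (intro nn_integral_mono)
      (simp add: add_nonneg_nonneg mult_nonneg_nonneg flip: ennreal_plus ennreal_mult)
  also have "\<dots> = ennreal K * (ennreal c1 * (\<integral>\<^sup>+ x. ennreal (\<bar>u x - v x\<bar> powr r) \<partial>lborel)
           + ennreal c2 * (\<integral>\<^sup>+ x. ennreal (W x powr r) \<partial>lborel))"
    by (simp add: nn_integral_cmult nn_integral_add)
  also have "\<dots> \<le> ennreal K * (ennreal c1 * ennreal (D powr r) + ennreal c2 * ennreal (B powr r))"
    by (intro mult_left_mono add_mono WI DI) auto
  also have "\<dots> = ennreal (K * (c1 * D powr r + c2 * B powr r))"
    using K0 c by (simp flip: ennreal_plus ennreal_mult)
  also have "c1 * D powr r + c2 * B powr r = 1"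
    using B D by (simp add: c1_def c2_def)
  finally show ?thesis
    using q B D s Lp_norm_le_iff[of s "q * (4 * A) powr (q - 1) * D"
      "\<lambda>x. u x * \<bar>u x\<bar> powr (q - 1) - v x * \<bar>v x\<bar> powr (q - 1)"]
    by (simp add: K_def s_def B_def)
qed

section \<open>Joint measurability, and comparison of norms\<close>

text \<open>By continuity in x, F is a pointwise limit of functions that evaluate F(\<tau>, .) only
  at points of a countable dense set. That set can be chosen among the x at which F is measurable in
  \<tau>; almost every x is all that the integral equation provides.\<close>

lemma borel_measurable_caratheodory:
  fixes F :: "'b \<Rightarrow> 'a::euclidean_space \<Rightarrow> real"
  assumes cont: "\<And>\<tau>. \<tau> \<in> space M \<Longrightarrow> continuous_on UNIV (F \<tau>)"
    and ae: "AE x in lborel. (\<lambda>\<tau>. F \<tau> x) \<in> borel_measurable M"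
  shows "case_prod F \<in> borel_measurable (M \<Otimes>\<^sub>M lborel)"
proof -
  define S where "S = {x. (\<lambda>\<tau>. F \<tau> x) \<in> borel_measurable M}"
  obtain N where N: "N \<in> null_sets lborel" "- S \<subseteq> N"
    using ae by (auto simp: S_def eventually_ae_filter)
  \<comment> \<open>A null set has empty interior, so its complement is dense.\<close>
  have dense: "closure S = UNIV"
  proof -
    have "interior N = {}"
      using N(1) open_not_negligible[of "interior N"] negligible_subset[OF _ interior_subset, of N]
      by (auto simp: negligible_iff_null_sets null_sets_completionI)
    then have "closure (- N) = UNIV" by (simp add: closure_complement)
    then show ?thesis using N(2) closure_mono[of "-N" S] by auto
  qed
  obtain T where T: "countable T" "T \<subseteq> S" "S \<subseteq> closure T"
    using separable by metis
  have TD: "closure T = UNIV" using T dense closure_minimal[of S "closure T"] by auto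
  then have "T \<noteq> {}" by auto
  define d where "d = from_nat_into T"
  have dT: "range d = T" using T \<open>T \<noteq> {}\<close> by (simp add: d_def range_from_nat_into)
  \<comment> \<open>Taking the least index of a point within 1/(k+1) of x makes the choice of the
    approximating point measurable in x.\<close>
  define J where "J k x = (LEAST j. dist (d j) x < 1 / Suc k)" for k x
  have Jex: "\<exists>j. dist (d j) x < 1 / Suc k" for k x
    using TD closure_approachable[of x T] dT by (metis UNIV_I of_nat_0_less_iff rangeE zero_less_Suc zero_less_divide_1_iff)
  have J: "dist (d (J k x)) x < 1 / Suc k" for k x
    unfolding J_def using LeastI_ex[OF Jex] .
  have [measurable]: "J k \<in> measurable lborel (count_space UNIV)" for k
    unfolding J_def by measurable
  have [measurable]: "(\<lambda>\<tau>. F \<tau> (d j)) \<in> borel_measurable M" for j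
    using dT T(2) by (auto simp: S_def)
  have "(\<lambda>z. F (fst z) (d (J k (snd z)))) \<in> borel_measurable (M \<Otimes>\<^sub>M lborel)" for k
    by (rule measurable_compose_countable[where f = "\<lambda>j z. F (fst z) (d j)" and g = "\<lambda>z. J k (snd z)"])
      measurable
  moreover have "(\<lambda>k. F (fst z) (d (J k (snd z)))) \<longlonglongrightarrow> case_prod F z" if "z \<in> space (M \<Otimes>\<^sub>M lborel)" for z
  proof -
    have "(\<lambda>k. d (J k (snd z))) \<longlonglongrightarrow> snd z"
    proof (rule tendstoI)
      fix e :: real assume "0 < e"
      have "(\<lambda>k. 1 / real (Suc k)) \<longlonglongrightarrow> 0" by (rule LIMSEQ_Suc[OF lim_1_over_n])
      then have "\<forall>\<^sub>F k in sequentially. 1 / real (Suc k) < e"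
        using \<open>0 < e\<close> by (rule order_tendstoD)
      then show "\<forall>\<^sub>F k in sequentially. dist (d (J k (snd z))) (snd z) < e"
        by eventually_elim (use J less_trans in blast)
    qed
    moreover have "isCont (F (fst z)) (snd z)"
      using cont[of "fst z"] that by (auto simp: continuous_on_eq_continuous_at space_pair_measure)
    ultimately show ?thesis by (auto simp: case_prod_beta intro: isCont_tendsto_compose)
  qed
  ultimately show ?thesis by (rule borel_measurable_LIMSEQ_real[rotated])
qed

lemma Lp_norm_le_mult:
  fixes g h :: "real ^ 'n \<Rightarrow> real"
  assumes [measurable]: "g \<in> borel_measurable lborel" "h \<in> borel_measurable lborel"
    and p: "1 \<le> p" and c: "0 \<le> c" "0 \<le> B" and gh: "\<And>x. \<bar>g x\<bar> \<le> c * \<bar>h x\<bar>"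
    and h: "Lp_norm p h \<le> ennreal B"
  shows "Lp_norm p g \<le> ennreal (c * B)"
  using p
proof (cases rule: enn2real_exponent_cases)
  case 1
  then have "AE x in lborel. \<bar>h x\<bar> \<le> B"
    using h c Lp_norm_top_le_iff[of h B] by simp
  then have "AE x in lborel. \<bar>g x\<bar> \<le> c * B"
    by eventually_elim (meson gh c mult_left_mono order_trans)
  then show ?thesis using 1 c Lp_norm_top_le_iff[of g "c * B"] by simp
next
  case (2 r)
  have "(\<integral>\<^sup>+ x. ennreal (\<bar>g x\<bar> powr r) \<partial>lborel) \<le> (\<integral>\<^sup>+ x. ennreal (c powr r) * ennreal (\<bar>h x\<bar> powr r) \<partial>lborel)"
  proof (intro nn_integral_mono)
    fix x
    have "\<bar>g x\<bar> powr r \<le> (c * \<bar>h x\<bar>) powr r"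
      using gh[of x] 2 by (intro powr_mono2) auto
    then show "ennreal (\<bar>g x\<bar> powr r) \<le> ennreal (c powr r) * ennreal (\<bar>h x\<bar> powr r)"
      by (simp add: powr_mult flip: ennreal_mult)
  qed
  also have "\<dots> = ennreal (c powr r) * (\<integral>\<^sup>+ x. ennreal (\<bar>h x\<bar> powr r) \<partial>lborel)"
    by (rule nn_integral_cmult) simp
  also have "\<dots> \<le> ennreal (c powr r) * ennreal (B powr r)"
    using h 2 c Lp_norm_le_iff[of r B h] by (intro mult_left_mono) auto
  also have "\<dots> = ennreal ((c * B) powr r)"
    by (simp add: powr_mult flip: ennreal_mult)
  finally show ?thesis using 2 c Lp_norm_le_iff[of r "c * B" g] by simp
qed

lemma Lp_norm_cong_AE:
  fixes f g :: "real ^ 'n \<Rightarrow> real"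
  assumes "f \<in> borel_measurable lborel" "g \<in> borel_measurable lborel" "AE x in lborel. f x = g x"
  shows "Lp_norm p f = Lp_norm p g"
proof -
  have "esssup lborel (\<lambda>x. ennreal \<bar>f x\<bar>) = esssup lborel (\<lambda>x. ennreal \<bar>g x\<bar>)"
    using assms by (intro esssup_AE_cong) auto
  moreover have "(\<integral>\<^sup>+ x. ennreal (\<bar>f x\<bar> powr r) \<partial>lborel) = (\<integral>\<^sup>+ x. ennreal (\<bar>g x\<bar> powr r) \<partial>lborel)" for r
    using assms by (intro nn_integral_cong_AE) auto
  ultimately show ?thesis by (simp add: Lp_norm_def)
qed

text \<open>The functions are arbitrary, so this applies to e^(s\<Delta>)u0, of which one only knows
  that it agrees almost everywhere with a measurable function.\<close>

lemma Lp_norm_1_cong_AE: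
  assumes "AE x in lborel. f x = g x"
  shows "Lp_norm 1 f = Lp_norm 1 g"
  unfolding Lp_norm_1_eq using assms by (intro nn_integral_cong_AE) auto

section \<open>The heat kernel\<close>

lemma heat_kernel_nonneg [simp]: "0 \<le> heat_kernel x t"
  by (simp add: heat_kernel_def)

lemma heat_kernel_minus_commute: "heat_kernel (x - y) t = heat_kernel (y - x) t"
  by (simp add: heat_kernel_def norm_minus_commute)

lemma heat_kernel_le:
  fixes x :: "real ^ 'n"
  assumes "0 < t"
  shows "heat_kernel x t \<le> (4 * pi * t) powr (- real CARD('n) / 2)"
  unfolding heat_kernel_def by (rule mult_left_le) (use assms in auto)

lemma continuous_on_heat_kernel [continuous_intros]:
  "continuous_on S f \<Longrightarrow> continuous_on S (\<lambda>x. heat_kernel (f x) t)"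
  unfolding heat_kernel_def divide_inverse
  by (intro continuous_on_mult continuous_on_const continuous_on_exp continuous_on_minus
      continuous_on_power continuous_on_norm)

lemma borel_measurable_heat_kernel [measurable (raw)]:
  "f \<in> borel_measurable M \<Longrightarrow> (\<lambda>x. heat_kernel (f x) t) \<in> borel_measurable M"
  by (rule measurable_compose[OF _ borel_measurable_continuous_onI])
    (auto intro!: continuous_on_heat_kernel continuous_on_id)

text \<open>The Gaussian splits into normal densities of variance 2t, so its mass and convolutions
  reduce to one-dimensional facts about the normal distribution.\<close>

lemma heat_kernel_eq_prod:
  fixes x :: "real ^ 'n"
  assumes "0 < t"
  shows "heat_kernel x t = (\<Prod>b\<in>Basis. normal_density 0 (sqrt (2 * t)) (x \<bullet> b))"
proof -
  have "(norm x)\<^sup>2 = (\<Sum>b\<in>Basis. (x \<bullet> b)\<^sup>2)"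
    unfolding power2_norm_eq_inner by (subst euclidean_inner) (simp add: power2_eq_square)
  then have e: "exp (- (norm x)\<^sup>2 / (4 * t)) = (\<Prod>b\<in>Basis. exp (- (x \<bullet> b)\<^sup>2 / (4 * t)))"
    by (simp add: exp_sum[symmetric] sum_negf sum_divide_distrib)
  have "(1 / sqrt (4 * pi * t)) ^ CARD('n) = (4 * pi * t) powr (- real CARD('n) / 2)"
  proof -
    have "1 / sqrt (4 * pi * t) = (4 * pi * t) powr (- 1 / 2)"
      using assms powr_minus_divide[of "4 * pi * t" "1 / 2"] by (simp add: powr_half_sqrt)
    then have "(1 / sqrt (4 * pi * t)) ^ CARD('n) = ((4 * pi * t) powr (- 1 / 2)) powr real CARD('n)"
      using assms by (simp add: powr_realpow)
    then show ?thesis by (simp add: powr_powr)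
  qed
  then have c: "(4 * pi * t) powr (- real CARD('n) / 2)
      = (\<Prod>b\<in>(Basis::(real ^ 'n) set). 1 / sqrt (4 * pi * t))"
    by simp
  have "normal_density 0 (sqrt (2 * t)) (x \<bullet> b) = 1 / sqrt (4 * pi * t) * exp (- (x \<bullet> b)\<^sup>2 / (4 * t))" for b
  proof -
    have "2 * pi * (sqrt (2 * t))\<^sup>2 = 4 * pi * t" "2 * (sqrt (2 * t))\<^sup>2 = 4 * t" using assms by simp_all
    then show ?thesis by (simp only: normal_density_def diff_0_right)
  qed
  then show ?thesis
    unfolding heat_kernel_def e c by (simp only: prod.distrib)
qed

lemma nn_integral_lborel_translate:
  fixes f :: "'a::euclidean_space \<Rightarrow> ennreal"
  assumes [measurable]: "f \<in> borel_measurable borel"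
  shows "(\<integral>\<^sup>+ z. f (z - c) \<partial>lborel) = (\<integral>\<^sup>+ z. f z \<partial>lborel)"
proof -
  have "(\<integral>\<^sup>+ z. f z \<partial>lborel) = (\<integral>\<^sup>+ z. f z \<partial>distr lborel borel ((+) (- c)))"
    by (simp add: lborel_distr_plus)
  also have "\<dots> = (\<integral>\<^sup>+ z. f (z - c) \<partial>lborel)"
    by (subst nn_integral_distr) (simp_all add: algebra_simps)
  finally show ?thesis by simp
qed

lemma nn_integral_heat_kernel:
  fixes x :: "real ^ 'n"
  assumes "0 < t"
  shows "(\<integral>\<^sup>+ y. ennreal (heat_kernel (x - y) t) \<partial>lborel) = 1"
proof -
  have "(\<integral>\<^sup>+ y. ennreal (heat_kernel (x - y) t) \<partial>lborel) = (\<integral>\<^sup>+ y. ennreal (heat_kernel (y - x) t) \<partial>lborel)"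
    by (simp add: heat_kernel_minus_commute)
  also have "\<dots> = (\<integral>\<^sup>+ y. ennreal (heat_kernel (y :: real ^ 'n) t) \<partial>lborel)"
    by (rule nn_integral_lborel_translate[where f = "\<lambda>z. ennreal (heat_kernel z t)"]) simp
  also have "\<dots> = (\<integral>\<^sup>+ y. (\<Prod>b\<in>Basis. ennreal (normal_density 0 (sqrt (2 * t)) ((y :: real ^ 'n) \<bullet> b))) \<partial>lborel)"
    using assms by (simp add: heat_kernel_eq_prod prod_ennreal)
  also have "\<dots> = (\<Prod>b\<in>(Basis :: (real ^ 'n) set). (\<integral>\<^sup>+ y. ennreal (normal_density 0 (sqrt (2 * t)) y) \<partial>lborel))"
    by (rule nn_integral_lborel_prod) auto
  also have "\<dots> = 1"
    using assms by (simp add: nn_integral_eq_integral integrable_normal_density)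
  finally show ?thesis .
qed

text \<open>Coordinate by coordinate this is a convolution of centred normal densities, whose
  variances 2s and 2t add up.\<close>

lemma nn_integral_heat_kernel_conv:
  fixes x y :: "real ^ 'n"
  assumes s: "0 < s" and t: "0 < t"
  shows "(\<integral>\<^sup>+ z. ennreal (heat_kernel (x - z) s * heat_kernel (z - y) t) \<partial>lborel)
    = ennreal (heat_kernel (x - y) (s + t))"
proof -
  have "(\<integral>\<^sup>+ z. ennreal (heat_kernel (x - z) s * heat_kernel (z - y) t) \<partial>lborel)
      = (\<integral>\<^sup>+ z. ennreal (heat_kernel ((x - y) - (z - y)) s * heat_kernel (z - y) t) \<partial>lborel)"
    by (simp only: diff_diff_eq2 diff_add_cancel)
  also have "\<dots> = (\<integral>\<^sup>+ z. ennreal (heat_kernel ((x - y) - z) s * heat_kernel z t) \<partial>lborel)"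
    by (rule nn_integral_lborel_translate[where f = "\<lambda>z. ennreal (heat_kernel ((x - y) - z) s * heat_kernel z t)"]) simp
  also have "\<dots> = (\<integral>\<^sup>+ z. (\<Prod>b\<in>Basis. ennreal (normal_density 0 (sqrt (2 * s)) ((x - y) \<bullet> b - z \<bullet> b)
      * normal_density 0 (sqrt (2 * t)) (z \<bullet> b))) \<partial>lborel)"
    using assms by (simp add: heat_kernel_eq_prod prod_ennreal inner_diff_left flip: prod.distrib)
  also have "\<dots> = (\<Prod>b\<in>Basis. (\<integral>\<^sup>+ z. ennreal (normal_density 0 (sqrt (2 * s)) ((x - y) \<bullet> b - z)
      * normal_density 0 (sqrt (2 * t)) z) \<partial>lborel))"
    by (rule nn_integral_lborel_prod) auto
  also have "\<dots> = (\<Prod>b\<in>Basis. ennreal (normal_density 0 (sqrt (2 * (s + t))) ((x - y) \<bullet> b)))"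
  proof (intro prod.cong refl)
    fix b :: "real ^ 'n"
    have "(sqrt (2 * s))\<^sup>2 + (sqrt (2 * t))\<^sup>2 = 2 * (s + t)" using assms by simp
    then show "(\<integral>\<^sup>+ z. ennreal (normal_density 0 (sqrt (2 * s)) ((x - y) \<bullet> b - z)
        * normal_density 0 (sqrt (2 * t)) z) \<partial>lborel) = ennreal (normal_density 0 (sqrt (2 * (s + t))) ((x - y) \<bullet> b))"
      using assms conv_normal_density_zero_mean[of "sqrt (2 * s)" "sqrt (2 * t)", THEN fun_cong, of "(x - y) \<bullet> b"]
      by simp
  qed
  also have "\<dots> = ennreal (heat_kernel (x - y) (s + t))"
    using assms by (simp add: heat_kernel_eq_prod prod_ennreal)
  finally show ?thesis .
qed

section \<open>Spatial derivative of the kernel\<close>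

text \<open>The derivative of the kernel at z in direction h, in closed form so that it can be
  estimated before differentiability is established.\<close>

definition heat_kernel_deriv :: "real ^ 'n \<Rightarrow> real \<Rightarrow> real ^ 'n \<Rightarrow> real" where
  "heat_kernel_deriv h t z = - (z \<bullet> h) / (2 * t) * heat_kernel z t"

lemma borel_measurable_heat_kernel_deriv [measurable (raw)]:
  "f \<in> borel_measurable M \<Longrightarrow> (\<lambda>x. heat_kernel_deriv h t (f x)) \<in> borel_measurable M"
  unfolding heat_kernel_deriv_def
  by (intro borel_measurable_times borel_measurable_divide borel_measurable_uminus
      borel_measurable_inner borel_measurable_heat_kernel borel_measurable_const)

text \<open>Half of the Gaussian exponent absorbs the factor |z|/t at the price of t^(-1/2); the
  other half is the Gaussian at time 2t. The constant 2^(n/2) is the ratio of the normalisations at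
  t and 2t.\<close>

lemma abs_heat_kernel_deriv_le:
  fixes z h :: "real ^ 'n"
  assumes t: "0 < t"
  shows "\<bar>heat_kernel_deriv h t z\<bar>
    \<le> norm h * 2 powr (real CARD('n) / 2) * t powr (- 1 / 2) * heat_kernel z (2 * t)"
proof -
  define y where "y = norm z / sqrt t"
  have y2: "y\<^sup>2 = (norm z)\<^sup>2 / t" using t by (simp add: y_def power_divide)
  \<comment> \<open>An elementary substitute for maximising y e^(-y^2/8): the square gives y \<le> 1
    + y^2/4, and 1 + X \<le> e^X does the rest.\<close>
  have "0 \<le> (y / 2 - 1)\<^sup>2" by simp
  then have "y \<le> 2 * (1 + y\<^sup>2 / 8)" by (simp add: power2_eq_square algebra_simps)
  also have "\<dots> \<le> 2 * exp (y\<^sup>2 / 8)" by (intro mult_left_mono) auto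
  finally have y: "y * exp (- y\<^sup>2 / 8) \<le> 2"
    by (simp add: exp_minus field_simps)
  have e: "exp (- (norm z)\<^sup>2 / (4 * t)) = exp (- y\<^sup>2 / 8) * exp (- (norm z)\<^sup>2 / (4 * (2 * t)))"
    using t by (simp add: y2 flip: exp_add)
  have p: "(4 * pi * t) powr (- real CARD('n) / 2)
      = 2 powr (real CARD('n) / 2) * (4 * pi * (2 * t)) powr (- real CARD('n) / 2)"
  proof -
    have "(4 * pi * (2 * t)) powr (- real CARD('n) / 2)
        = 2 powr (- (real CARD('n) / 2)) * (4 * pi * t) powr (- real CARD('n) / 2)"
      by (simp flip: powr_mult)
    then show ?thesis by (simp flip: powr_add mult.assoc)
  qed
  have "\<bar>heat_kernel_deriv h t z\<bar> \<le> (norm z * norm h) / (2 * t) * heat_kernel z t"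
    using t Cauchy_Schwarz_ineq2[of z h]
    by (auto simp: heat_kernel_deriv_def abs_mult intro!: mult_right_mono divide_right_mono)
  also have "\<dots> = norm h * (2 powr (real CARD('n) / 2) * ((y * exp (- y\<^sup>2 / 8)) / (2 * sqrt t) * heat_kernel z (2 * t)))"
  proof -
    have "t = sqrt t * sqrt t" using t by simp
    then have "norm z / (2 * t) = y / (2 * sqrt t)" unfolding y_def by (metis divide_divide_eq_left mult.assoc mult.commute)
    then have "norm z * norm h / (2 * t) = norm h * (y / (2 * sqrt t))" by (metis mult.commute times_divide_eq_right)
    then show ?thesis unfolding heat_kernel_def e p by simp
  qed
  also have "\<dots> \<le> norm h * (2 powr (real CARD('n) / 2) * (2 / (2 * sqrt t) * heat_kernel z (2 * t)))"
    using y t by (intro mult_left_mono mult_right_mono divide_right_mono) auto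
  also have "2 / (2 * sqrt t) = t powr (- 1 / 2)"
    using t powr_minus_divide[of t "1 / 2"] by (simp add: powr_half_sqrt)
  finally show ?thesis by (simp add: mult.assoc)
qed

text \<open>The bound is uniform in z, which permits differentiation under the integral for mere L^1
  functions. Along the segment from z to z + h the Gaussian becomes a function \<phi> of \<theta>,
  and Taylor's formula leaves half its second derivative. The constant 3/4 is half of 1 + 1/2, one
  summand for each term of that derivative.\<close>

lemma heat_kernel_taylor:
  fixes z h :: "real ^ 'n"
  assumes t: "0 < t"
  shows "\<bar>heat_kernel (z + h) t - heat_kernel z t - heat_kernel_deriv h t z\<bar>
    \<le> (4 * pi * t) powr (- real CARD('n) / 2) * (3 / (4 * t)) * (norm h)\<^sup>2"
proof -
  define c where "c = (4 * pi * t) powr (- real CARD('n) / 2)"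
  define \<phi> where "\<phi> \<theta> = exp (- ((norm z)\<^sup>2 + 2 * \<theta> * (z \<bullet> h) + \<theta>\<^sup>2 * (norm h)\<^sup>2) / (4 * t))" for \<theta>
  define l where "l \<theta> = - (z \<bullet> h + \<theta> * (norm h)\<^sup>2) / (2 * t)" for \<theta>
  define D :: "nat \<Rightarrow> real \<Rightarrow> real" where "D m \<theta> = (if m = 0 then \<phi> \<theta> else if m = 1 then l \<theta> * \<phi> \<theta>
      else (l \<theta> * l \<theta> - (norm h)\<^sup>2 / (2 * t)) * \<phi> \<theta>)" for m \<theta>
  have nrm: "(norm (z + \<theta> *\<^sub>R h))\<^sup>2 = (norm z)\<^sup>2 + 2 * \<theta> * (z \<bullet> h) + \<theta>\<^sup>2 * (norm h)\<^sup>2" for \<theta>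
    unfolding power2_norm_eq_inner
    by (simp add: inner_simps inner_commute power2_eq_square algebra_simps)
  have \<phi>d: "(\<phi> has_field_derivative l \<theta> * \<phi> \<theta>) (at \<theta>)" for \<theta>
  proof -
    have "((\<lambda>\<theta>. - ((norm z)\<^sup>2 + 2 * \<theta> * (z \<bullet> h) + \<theta>\<^sup>2 * (norm h)\<^sup>2) / (4 * t)) has_field_derivative l \<theta>) (at \<theta>)"
      unfolding l_def using t by (auto intro!: derivative_eq_intros simp: field_simps)
    from DERIV_fun_exp[OF this] show ?thesis
      by (simp add: \<phi>_def[abs_def] mult.commute)
  qed
  have ld: "(l has_field_derivative - (norm h)\<^sup>2 / (2 * t)) (at \<theta>)" for \<theta>
    unfolding l_def using t by (auto intro!: derivative_eq_intros simp: field_simps)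
  have "\<forall>m \<theta>. m < 2 \<and> 0 \<le> \<theta> \<and> \<theta> \<le> 1 \<longrightarrow> (D m has_real_derivative D (Suc m) \<theta>) (at \<theta>)"
  proof (intro allI impI)
    fix m :: nat and \<theta> :: real assume "m < 2 \<and> 0 \<le> \<theta> \<and> \<theta> \<le> 1"
    then consider "m = 0" | "m = 1" by linarith
    then show "(D m has_real_derivative D (Suc m) \<theta>) (at \<theta>)"
    proof cases
      case 1
      then show ?thesis using \<phi>d[of \<theta>] by (simp add: D_def[abs_def])
    next
      case 2
      then show ?thesis using DERIV_mult[OF ld \<phi>d, of \<theta>]
        by (simp add: D_def[abs_def] algebra_simps)
    qed
  qed
  then obtain \<theta> where "\<phi> 1 = (\<Sum>m<2. D m 0 / fact m * 1 ^ m) + D 2 \<theta> / fact 2 * 1 ^ 2"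
    using Maclaurin[of 1 2 D \<phi>] by (auto simp: D_def[abs_def])
  then have tay: "\<phi> 1 - \<phi> 0 - l 0 * \<phi> 0 = D 2 \<theta> / 2"
    by (simp add: D_def numeral_2_eq_2 lessThan_Suc)
  define w where "w = z + \<theta> *\<^sub>R h"
  have \<phi>w: "\<phi> \<theta> = exp (- ((norm w)\<^sup>2 / (4 * t)))"
    unfolding \<phi>_def w_def nrm by (simp only: minus_divide_left)
  have lw: "l \<theta> = - (w \<bullet> h) / (2 * t)"
    by (simp add: l_def w_def inner_simps power2_norm_eq_inner)
  have "l \<theta> * l \<theta> = (w \<bullet> h)\<^sup>2 / (4 * t\<^sup>2)"
    using t by (simp add: lw power2_eq_square)
  also have "(w \<bullet> h)\<^sup>2 \<le> (norm w)\<^sup>2 * (norm h)\<^sup>2"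
    using Cauchy_Schwarz_ineq[of w h] by (simp add: power2_norm_eq_inner)
  then have "(w \<bullet> h)\<^sup>2 / (4 * t\<^sup>2) \<le> (norm w)\<^sup>2 * (norm h)\<^sup>2 / (4 * t\<^sup>2)"
    by (rule divide_right_mono) simp
  also have "\<dots> = (norm h)\<^sup>2 / t * ((norm w)\<^sup>2 / (4 * t))"
    by (simp add: power2_eq_square mult_ac)
  finally have "l \<theta> * l \<theta> * \<phi> \<theta> \<le> (norm h)\<^sup>2 / t * ((norm w)\<^sup>2 / (4 * t)) * \<phi> \<theta>"
    by (rule mult_right_mono) (simp add: \<phi>w)
  also have "\<dots> = (norm h)\<^sup>2 / t * (((norm w)\<^sup>2 / (4 * t)) * exp (- ((norm w)\<^sup>2 / (4 * t))))"
    by (simp add: \<phi>w)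
  \<comment> \<open>The growth of |w|^2 is absorbed by the Gaussian through X e^(-X) \<le> 1; this
    removes the dependence on z and \<theta>.\<close>
  also have "((norm w)\<^sup>2 / (4 * t)) * exp (- ((norm w)\<^sup>2 / (4 * t))) \<le> 1"
  proof -
    have "X * exp (- X) \<le> 1" for X :: real
    proof -
      have "X \<le> exp X" using exp_ge_add_one_self[of X] by linarith
      then have "X * exp (- X) \<le> exp X * exp (- X)" by (rule mult_right_mono) simp
      then show ?thesis by (simp only: exp_minus_inverse)
    qed
    then show ?thesis .
  qed
  then have "(norm h)\<^sup>2 / t * (((norm w)\<^sup>2 / (4 * t)) * exp (- ((norm w)\<^sup>2 / (4 * t)))) \<le> (norm h)\<^sup>2 / t * 1"
    using t by (intro mult_left_mono) auto
  finally have 1: "l \<theta> * l \<theta> * \<phi> \<theta> \<le> (norm h)\<^sup>2 / t" by simp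
  have "\<phi> \<theta> \<le> 1" using t by (simp add: \<phi>w)
  then have 2: "(norm h)\<^sup>2 / (2 * t) * \<phi> \<theta> \<le> (norm h)\<^sup>2 / (2 * t)"
    using t by (intro mult_left_le) auto
  have 3: "0 \<le> l \<theta> * l \<theta> * \<phi> \<theta>" "0 \<le> (norm h)\<^sup>2 / (2 * t) * \<phi> \<theta>"
    using t by (auto simp: \<phi>w)
  have "D 2 \<theta> = l \<theta> * l \<theta> * \<phi> \<theta> - (norm h)\<^sup>2 / (2 * t) * \<phi> \<theta>"
    by (simp add: D_def algebra_simps)
  then have "\<bar>D 2 \<theta>\<bar> \<le> (norm h)\<^sup>2 / t + (norm h)\<^sup>2 / (2 * t)"
    using 1 2 3 by linarith
  also have "\<dots> = 3 / (2 * t) * (norm h)\<^sup>2"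
    using t by (simp add: field_simps)
  finally have "\<bar>\<phi> 1 - \<phi> 0 - l 0 * \<phi> 0\<bar> \<le> 3 / (4 * t) * (norm h)\<^sup>2"
    unfolding tay by simp
  then have "c * \<bar>\<phi> 1 - \<phi> 0 - l 0 * \<phi> 0\<bar> \<le> c * (3 / (4 * t) * (norm h)\<^sup>2)"
    by (rule mult_left_mono) (simp add: c_def)
  moreover have "heat_kernel (z + h) t - heat_kernel z t - heat_kernel_deriv h t z = c * (\<phi> 1 - \<phi> 0 - l 0 * \<phi> 0)"
    using nrm[of 1]
    by (simp add: heat_kernel_def heat_kernel_deriv_def \<phi>_def l_def c_def algebra_simps)
  moreover have "0 \<le> c" by (simp add: c_def)
  ultimately show ?thesis by (simp add: abs_mult c_def mult.assoc)
qed

section \<open>The heat semigroup on functions\<close>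

lemma heat_distribution_of: "heat t (distribution_of f) x = (\<integral>y. f y * heat_kernel (x - y) t \<partial>lborel)"
  by (simp add: heat_def distribution_of_def)

lemma borel_measurable_heat_distribution_of [measurable (raw)]:
  fixes f :: "real ^ 'n \<Rightarrow> real"
  assumes f: "f \<in> borel_measurable lborel"
  shows "heat t (distribution_of f) \<in> borel_measurable lborel"
proof -
  have "(\<lambda>(x, y). f y * heat_kernel (x - y) t) \<in> borel_measurable (lborel \<Otimes>\<^sub>M lborel)"
    using f unfolding case_prod_beta
    by (intro borel_measurable_times borel_measurable_heat_kernel measurable_compose[OF measurable_snd]
        borel_measurable_diff) auto
  then show ?thesis
    unfolding heat_distribution_of[abs_def] by (rule lborel.borel_measurable_lebesgue_integral)
qed

text \<open>From |f| \<le> 1 + |f|^r: the kernel is integrable, which handles the 1, and bounded,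
  which handles |f|^r.\<close>

lemma integrable_mult_heat_kernel:
  fixes f :: "real ^ 'n \<Rightarrow> real"
  assumes f[measurable]: "f \<in> borel_measurable lborel" and r: "1 \<le> r" and t: "0 < t"
    and fin: "Lp_norm (ennreal r) f < \<infinity>"
  shows "integrable lborel (\<lambda>y. f y * heat_kernel (x - y) t)"
proof -
  obtain B where B: "0 \<le> B" "Lp_norm (ennreal r) f = ennreal B"
    using fin by (cases "Lp_norm (ennreal r) f") auto
  then have fI: "(\<integral>\<^sup>+ y. ennreal (\<bar>f y\<bar> powr r) \<partial>lborel) < \<infinity>"
    using r Lp_norm_le_iff[of r B f] by (auto simp: le_less_trans)
  define c where "c = (4 * pi * t) powr (- real CARD('n) / 2)"
  have c0: "0 \<le> c" by (simp add: c_def)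
  have le: "\<bar>f y\<bar> \<le> 1 + \<bar>f y\<bar> powr r" for y
    using powr_le_tangent[of r "\<bar>f y\<bar>" 1] r
    by (smt (verit) ge_one_powr_ge_zero powr_ge_zero powr_mono powr_one)
  have "(\<integral>\<^sup>+ y. ennreal (norm (f y * heat_kernel (x - y) t)) \<partial>lborel)
     \<le> (\<integral>\<^sup>+ y. ennreal (heat_kernel (x - y) t) + ennreal c * ennreal (\<bar>f y\<bar> powr r) \<partial>lborel)"
  proof (intro nn_integral_mono)
    fix y
    have "norm (f y * heat_kernel (x - y) t) = \<bar>f y\<bar> * heat_kernel (x - y) t"
      by (simp add: abs_mult)
    also have "\<dots> \<le> (1 + \<bar>f y\<bar> powr r) * heat_kernel (x - y) t"
      by (intro mult_right_mono le) simp
    also have "\<dots> \<le> heat_kernel (x - y) t + \<bar>f y\<bar> powr r * c"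
      using heat_kernel_le[OF t, of "x - y"] by (simp add: distrib_right c_def mult_left_mono)
    finally show "ennreal (norm (f y * heat_kernel (x - y) t))
        \<le> ennreal (heat_kernel (x - y) t) + ennreal c * ennreal (\<bar>f y\<bar> powr r)"
      using c0 by (simp add: mult.commute flip: ennreal_plus ennreal_mult)
  qed
  also have "\<dots> = (\<integral>\<^sup>+ y. ennreal (heat_kernel (x - y) t) \<partial>lborel)
      + ennreal c * (\<integral>\<^sup>+ y. ennreal (\<bar>f y\<bar> powr r) \<partial>lborel)"
    by (subst nn_integral_add) (auto simp: nn_integral_cmult)
  also have "\<dots> < \<infinity>"
    using fI nn_integral_heat_kernel[OF t, of x] by (simp add: ennreal_mult_less_top)
  finally show ?thesis
    by (intro integrableI_bounded) auto
qed

lemma abs_heat_le_heat_abs: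
  "\<bar>heat t (distribution_of f) x\<bar> \<le> heat t (distribution_of (\<lambda>y. \<bar>f y\<bar>)) x"
proof -
  have "\<bar>heat t (distribution_of f) x\<bar> \<le> (\<integral>y. \<bar>f y * heat_kernel (x - y) t\<bar> \<partial>lborel)"
    unfolding heat_distribution_of by (rule integral_abs_bound)
  then show ?thesis by (simp add: heat_distribution_of abs_mult)
qed

text \<open>Since \<open>G(\<cdot>,t)\<close> is a probability density, Jensen's
  inequality gives \<open>\<bar>G * f\<bar>\<^sup>r \<le> G * \<bar>f\<bar>\<^sup>r\<close>, which settles the exponents \<open>r\<close> and \<open>\<infinity>\<close>; the
  exponents in between follow from \<open>\<bar>h\<bar>\<^sup>p \<le> sup \<bar>h\<bar>\<^bsup>p-r\<^esup> \<bar>h\<bar>\<^sup>r\<close>.\<close>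

lemma Lp_norm_heat_le:
  fixes f :: "real ^ 'n \<Rightarrow> real"
  assumes f[measurable]: "f \<in> borel_measurable lborel" and r: "1 \<le> r" and rp: "ennreal r \<le> p"
    and t: "0 < t" and B: "0 \<le> B" and fB: "Lp_norm (ennreal r) f \<le> ennreal B"
  shows "Lp_norm p (heat t (distribution_of f))
    \<le> ennreal (t powr (- real CARD('n) / 2 * (1 / r - enn2real (1 / p))) * B)"
proof -
  define h where "h = heat t (distribution_of (\<lambda>y. \<bar>f y\<bar>))"
  define e where "e = real CARD('n) / 2"
  define c where "c = t powr (- e)"
  have c0: "0 \<le> c" by (simp add: c_def)
  have hm[measurable]: "h \<in> borel_measurable lborel" unfolding h_def by measurable
  have h0: "0 \<le> h x" for x unfolding h_def heat_distribution_of by (intro integral_nonneg_AE) auto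
  have kle: "heat_kernel z t \<le> c" for z :: "real ^ 'n"
  proof -
    \<comment> \<open>Dropping 4 pi from the normalisation enlarges the kernel bound, as the
      exponent is negative, and leaves smoothing constants equal to 1.\<close>
    have "1 \<le> 4 * pi" using pi_gt3 by simp
    then have "t \<le> 4 * pi * t" using t by simp
    then have "(4 * pi * t) powr (- e) \<le> t powr (- e)"
      using t by (intro powr_mono2') (auto simp: e_def)
    then show ?thesis using heat_kernel_le[OF t, of z] by (simp add: e_def c_def)
  qed
  have fI: "(\<integral>\<^sup>+ y. ennreal (\<bar>f y\<bar> powr r) \<partial>lborel) \<le> ennreal (B powr r)"
    using fB r B Lp_norm_le_iff[of r B f] by simp
  have jensen: "ennreal (h x powr r) \<le> (\<integral>\<^sup>+ y. ennreal (heat_kernel (x - y) t * \<bar>f y\<bar> powr r) \<partial>lborel)" for x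
    using weighted_jensen_powr[of "\<lambda>y. heat_kernel (x - y) t" lborel "\<lambda>y. \<bar>f y\<bar>" r 1] r
      nn_integral_heat_kernel[OF t, of x]
    by (simp add: h_def heat_distribution_of mult.commute)
  have hsup: "h x \<le> c powr (1 / r) * B" for x
  proof -
    have "ennreal (h x powr r) \<le> (\<integral>\<^sup>+ y. ennreal c * ennreal (\<bar>f y\<bar> powr r) \<partial>lborel)"
      using kle c0 by (intro order_trans[OF jensen] nn_integral_mono) (simp add: mult_right_mono flip: ennreal_mult)
    also have "\<dots> = ennreal c * (\<integral>\<^sup>+ y. ennreal (\<bar>f y\<bar> powr r) \<partial>lborel)"
      by (rule nn_integral_cmult) simp
    also have "\<dots> \<le> ennreal c * ennreal (B powr r)"
      by (intro mult_left_mono fI) simp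
    finally have "h x powr r \<le> c * B powr r"
      using c0 by (simp flip: ennreal_mult)
    then have "(h x powr r) powr (1 / r) \<le> (c * B powr r) powr (1 / r)"
      using r by (intro powr_mono2) auto
    then show ?thesis
      using r h0 B by (simp add: powr_powr powr_mult)
  qed
  have hI: "(\<integral>\<^sup>+ x. ennreal (h x powr r) \<partial>lborel) \<le> ennreal (B powr r)"
  proof -
    have meas: "(\<lambda>(x, y). ennreal (heat_kernel (x - y) t * \<bar>f y\<bar> powr r)) \<in> borel_measurable (lborel \<Otimes>\<^sub>M lborel)"
      using f unfolding case_prod_beta
      by (intro measurable_compose[OF _ measurable_ennreal] borel_measurable_times borel_measurable_heat_kernel
          borel_measurable_diff measurable_compose[OF measurable_snd, of "\<lambda>y. \<bar>f y\<bar> powr r"]) auto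
    have "(\<integral>\<^sup>+ x. ennreal (h x powr r) \<partial>lborel)
        \<le> (\<integral>\<^sup>+ x. (\<integral>\<^sup>+ y. ennreal (heat_kernel (x - y) t * \<bar>f y\<bar> powr r) \<partial>lborel) \<partial>lborel)"
      by (intro nn_integral_mono jensen)
    also have "\<dots> = (\<integral>\<^sup>+ y. (\<integral>\<^sup>+ x. ennreal (heat_kernel (x - y) t * \<bar>f y\<bar> powr r) \<partial>lborel) \<partial>lborel)"
      by (rule lborel_pair.Fubini'[OF meas, symmetric])
    also have "\<dots> = (\<integral>\<^sup>+ y. (\<integral>\<^sup>+ x. ennreal (heat_kernel (y - x) t) * ennreal (\<bar>f y\<bar> powr r) \<partial>lborel) \<partial>lborel)"
      by (intro nn_integral_cong) (simp add: heat_kernel_minus_commute ennreal_mult)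
    also have "\<dots> = (\<integral>\<^sup>+ y. ennreal (\<bar>f y\<bar> powr r) \<partial>lborel)"
      by (simp add: nn_integral_multc nn_integral_heat_kernel[OF t])
    finally show ?thesis using fI by simp
  qed
  have hp: "Lp_norm p h \<le> ennreal (c powr (1 / r - enn2real (1 / p)) * B)"
  proof -
    have "1 \<le> p" using r rp by (meson dual_order.trans ennreal_ge_1)
    then show ?thesis
    proof (cases rule: enn2real_exponent_cases)
      case 1
      then show ?thesis
        using hsup h0 B Lp_norm_top_le_iff[OF hm, of "c powr (1 / r) * B"] by simp
    next
      case (2 s)
      then have rs: "r \<le> s" using rp by simp
      define S where "S = c powr (1 / r) * B"
      have "(\<integral>\<^sup>+ x. ennreal (\<bar>h x\<bar> powr s) \<partial>lborel) \<le> (\<integral>\<^sup>+ x. ennreal (S powr (s - r)) * ennreal (h x powr r) \<partial>lborel)"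
      proof (intro nn_integral_mono)
        fix x
        have "\<bar>h x\<bar> powr s = h x powr (s - r) * h x powr r"
          using h0[of x] by (simp flip: powr_add)
        also have "\<dots> \<le> S powr (s - r) * h x powr r"
          using hsup[of x] h0[of x] rs by (intro mult_right_mono powr_mono2) (auto simp: S_def)
        finally show "ennreal (\<bar>h x\<bar> powr s) \<le> ennreal (S powr (s - r)) * ennreal (h x powr r)"
          by (simp flip: ennreal_mult)
      qed
      also have "\<dots> = ennreal (S powr (s - r)) * (\<integral>\<^sup>+ x. ennreal (h x powr r) \<partial>lborel)"
        by (rule nn_integral_cmult) simp
      also have "\<dots> \<le> ennreal (S powr (s - r)) * ennreal (B powr r)"
        by (intro mult_left_mono hI) simp
      also have "\<dots> = ennreal ((c powr (1 / r - 1 / s) * B) powr s)"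
      proof -
        have "1 / r * (s - r) = (1 / r - 1 / s) * s" using r rs by (simp add: field_simps)
        then have "S powr (s - r) * B powr r = c powr ((1 / r - 1 / s) * s) * (B powr (s - r) * B powr r)"
          by (simp only: S_def powr_mult powr_powr mult.assoc)
        also have "B powr (s - r) * B powr r = B powr s" by (simp flip: powr_add)
        finally show ?thesis by (simp only: powr_mult powr_powr ennreal_mult'[symmetric] powr_ge_zero)
      qed
      finally show ?thesis
        using 2 B Lp_norm_le_iff[of s "c powr (1 / r - 1 / s) * B" h] by simp
    qed
  qed
  have "1 \<le> p" using r rp by (meson dual_order.trans ennreal_ge_1)
  then have "Lp_norm p (heat t (distribution_of f)) \<le> ennreal (1 * (c powr (1 / r - enn2real (1 / p)) * B))"
    using abs_heat_le_heat_abs[of t f] h0 B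
    by (intro Lp_norm_le_mult[OF borel_measurable_heat_distribution_of[OF f] hm _ _ _ _ hp]) (auto simp: h_def)
  then show ?thesis
    by (simp add: c_def e_def powr_powr)
qed

text \<open>Fubini's theorem reduces the semigroup law to the convolution identity of the kernels;
  the same identity, with |f| in place of f, gives the absolute integrability.\<close>

lemma heat_heat:
  fixes f :: "real ^ 'n \<Rightarrow> real"
  assumes f[measurable]: "f \<in> borel_measurable lborel" and r: "1 \<le> r"
    and fin: "Lp_norm (ennreal r) f < \<infinity>" and s: "0 < s" and t: "0 < t"
  shows "heat s (distribution_of (heat t (distribution_of f))) x = heat (s + t) (distribution_of f) x"
proof -
  let ?H = "\<lambda>(z, y). f y * heat_kernel (z - y) t * heat_kernel (x - z) s"
  have meas: "?H \<in> borel_measurable (lborel \<Otimes>\<^sub>M lborel)"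
    using f unfolding case_prod_beta
    by (intro borel_measurable_times borel_measurable_heat_kernel
          borel_measurable_diff measurable_compose[OF measurable_snd, of f]) auto
  have conv: "(\<integral>\<^sup>+ z. ennreal (heat_kernel (z - y) t * heat_kernel (x - z) s) \<partial>lborel)
      = ennreal (heat_kernel (x - y) (s + t))" for y
    using nn_integral_heat_kernel_conv[OF s t, of x y] by (simp add: mult.commute)
  have convm: "(\<lambda>z. heat_kernel (z - y) t * heat_kernel (x - z) s) \<in> borel_measurable lborel" for y :: "real ^ 'n"
    by (intro borel_measurable_times borel_measurable_heat_kernel borel_measurable_diff) auto
  have int: "integrable (lborel \<Otimes>\<^sub>M lborel) ?H"
  proof (rule integrableI_bounded[OF meas])
    have "(\<integral>\<^sup>+ p. ennreal (norm (?H p)) \<partial>(lborel \<Otimes>\<^sub>M lborel))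
       = (\<integral>\<^sup>+ y. (\<integral>\<^sup>+ z. ennreal (norm (?H (z, y))) \<partial>lborel) \<partial>lborel)"
      using meas by (intro lborel_pair.nn_integral_snd[symmetric]) auto
    also have "\<dots> = (\<integral>\<^sup>+ y. (\<integral>\<^sup>+ z. ennreal \<bar>f y\<bar> * ennreal (heat_kernel (z - y) t * heat_kernel (x - z) s) \<partial>lborel) \<partial>lborel)"
      by (intro nn_integral_cong) (simp add: abs_mult mult.assoc flip: ennreal_mult)
    also have "\<dots> = (\<integral>\<^sup>+ y. ennreal \<bar>f y\<bar> * ennreal (heat_kernel (x - y) (s + t)) \<partial>lborel)"
      using convm by (subst nn_integral_cmult) (simp_all add: conv)
    also have "\<dots> = (\<integral>\<^sup>+ y. ennreal (norm (f y * heat_kernel (x - y) (s + t))) \<partial>lborel)"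
      by (intro nn_integral_cong) (simp add: abs_mult flip: ennreal_mult)
    also have "\<dots> < \<infinity>"
      using integrable_mult_heat_kernel[OF f r _ fin, of "s + t" x] s t by (simp add: integrable_iff_bounded)
    finally show "(\<integral>\<^sup>+ p. ennreal (norm (?H p)) \<partial>(lborel \<Otimes>\<^sub>M lborel)) < \<infinity>" .
  qed
  have "heat s (distribution_of (heat t (distribution_of f))) x
      = (\<integral>z. (\<integral>y. f y * heat_kernel (z - y) t * heat_kernel (x - z) s \<partial>lborel) \<partial>lborel)"
    by (simp add: heat_distribution_of)
  also have "\<dots> = (\<integral>y. (\<integral>z. f y * heat_kernel (z - y) t * heat_kernel (x - z) s \<partial>lborel) \<partial>lborel)"
    using lborel_pair.Fubini_integral[OF int] by simp
  also have "\<dots> = (\<integral>y. f y * heat_kernel (x - y) (s + t) \<partial>lborel)"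
  proof (intro Bochner_Integration.integral_cong refl)
    fix y
    have "(\<integral>z. heat_kernel (z - y) t * heat_kernel (x - z) s \<partial>lborel) = heat_kernel (x - y) (s + t)"
      using convm by (subst integral_eq_nn_integral) (simp_all add: conv)
    then show "(\<integral>z. f y * heat_kernel (z - y) t * heat_kernel (x - z) s \<partial>lborel) = f y * heat_kernel (x - y) (s + t)"
      by (simp add: mult.assoc)
  qed
  finally show ?thesis by (simp add: heat_distribution_of)
qed

section \<open>Gradient of the heat semigroup\<close>

lemma integrable_mult_heat_kernel_deriv:
  fixes f :: "real ^ 'n \<Rightarrow> real"
  assumes f: "integrable lborel f" and t: "0 < t"
  shows "integrable lborel (\<lambda>y. f y * heat_kernel_deriv h t (x - y))"
proof -
  have [measurable]: "f \<in> borel_measurable lborel" using f by auto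
  have "Lp_norm (ennreal 1) f < \<infinity>" using f by (simp add: Lp_norm_1_eq integrable_iff_bounded)
  then have "integrable lborel (\<lambda>y. f y * heat_kernel (x - y) (2 * t))"
    using t by (intro integrable_mult_heat_kernel[of f 1]) auto
  then have i: "integrable lborel (\<lambda>y. norm h * 2 powr (real CARD('n) / 2) * t powr (- 1 / 2) * (f y * heat_kernel (x - y) (2 * t)))"
    by (rule integrable_mult_right)
  show ?thesis
  proof (rule Bochner_Integration.integrable_bound[OF i])
    show "AE y in lborel. norm (f y * heat_kernel_deriv h t (x - y))
       \<le> norm (norm h * 2 powr (real CARD('n) / 2) * t powr (- 1 / 2) * (f y * heat_kernel (x - y) (2 * t)))"
    proof (rule AE_I2)
      fix y
      have "\<bar>f y\<bar> * \<bar>heat_kernel_deriv h t (x - y)\<bar>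
        \<le> \<bar>f y\<bar> * (norm h * 2 powr (real CARD('n) / 2) * t powr (- 1 / 2) * heat_kernel (x - y) (2 * t))"
        by (intro mult_left_mono abs_heat_kernel_deriv_le t) simp
      then show "norm (f y * heat_kernel_deriv h t (x - y))
       \<le> norm (norm h * 2 powr (real CARD('n) / 2) * t powr (- 1 / 2) * (f y * heat_kernel (x - y) (2 * t)))"
        by (simp add: abs_mult mult_ac)
    qed
  qed (intro borel_measurable_times borel_measurable_heat_kernel_deriv borel_measurable_diff, auto)
qed

lemma abs_integral_heat_kernel_deriv_le:
  fixes f :: "real ^ 'n \<Rightarrow> real"
  assumes f: "integrable lborel f" and t: "0 < t"
  shows "\<bar>\<integral>y. f y * heat_kernel_deriv h t (x - y) \<partial>lborel\<bar>
    \<le> norm h * 2 powr (real CARD('n) / 2) * t powr (- 1 / 2) * heat (2 * t) (distribution_of (\<lambda>y. \<bar>f y\<bar>)) x"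
proof -
  define C where "C = norm h * 2 powr (real CARD('n) / 2) * t powr (- 1 / 2)"
  have [measurable]: "f \<in> borel_measurable lborel" using f by auto
  have "Lp_norm (ennreal 1) (\<lambda>y. \<bar>f y\<bar>) < \<infinity>" using f by (simp add: Lp_norm_1_eq integrable_iff_bounded)
  then have i: "integrable lborel (\<lambda>y. \<bar>f y\<bar> * heat_kernel (x - y) (2 * t))"
    using t by (intro integrable_mult_heat_kernel[of _ 1]) auto
  have "\<bar>\<integral>y. f y * heat_kernel_deriv h t (x - y) \<partial>lborel\<bar> \<le> (\<integral>y. \<bar>f y * heat_kernel_deriv h t (x - y)\<bar> \<partial>lborel)"
    by (rule integral_abs_bound)
  also have "\<dots> \<le> (\<integral>y. C * (\<bar>f y\<bar> * heat_kernel (x - y) (2 * t)) \<partial>lborel)"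
  proof (rule integral_mono)
    fix y
    have "\<bar>f y\<bar> * \<bar>heat_kernel_deriv h t (x - y)\<bar> \<le> \<bar>f y\<bar> * (C * heat_kernel (x - y) (2 * t))"
      unfolding C_def by (intro mult_left_mono abs_heat_kernel_deriv_le t) simp
    then show "\<bar>f y * heat_kernel_deriv h t (x - y)\<bar> \<le> C * (\<bar>f y\<bar> * heat_kernel (x - y) (2 * t))"
      by (simp add: abs_mult mult_ac)
  qed (use i integrable_mult_heat_kernel_deriv[OF f t, of h x] in auto)
  also have "\<dots> = C * heat (2 * t) (distribution_of (\<lambda>y. \<bar>f y\<bar>)) x"
    by (simp add: heat_distribution_of)
  finally show ?thesis unfolding C_def .
qed

text \<open>The Taylor remainder of the kernel is bounded uniformly in z, so integrated against f it
  is at most a multiple of |h|^2 times the L^1 norm of f. A total derivative is sought because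
  \<open>partial\<close> is defined through \<open>frechet_derivative\<close>.\<close>

lemma heat_distribution_of_has_derivative:
  fixes f :: "real ^ 'n \<Rightarrow> real"
  assumes f: "integrable lborel f" and t: "0 < t"
  shows "(heat t (distribution_of f) has_derivative (\<lambda>h. \<integral>y. f y * heat_kernel_deriv h t (x - y) \<partial>lborel)) (at x)"
proof -
  let ?D = "\<lambda>h. \<integral>y. f y * heat_kernel_deriv h t (x - y) \<partial>lborel"
  have [measurable]: "f \<in> borel_measurable lborel" using f by auto
  note fi = integrable_mult_heat_kernel_deriv[OF f t]
  have ff: "Lp_norm (ennreal 1) f < \<infinity>" using f by (simp add: Lp_norm_1_eq integrable_iff_bounded)
  have gi: "integrable lborel (\<lambda>y. f y * heat_kernel (x - y) t)" for x
    using t ff by (intro integrable_mult_heat_kernel[of f 1]) auto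
  have lin: "bounded_linear ?D"
  proof (rule bounded_linear_intro)
    fix h k :: "real ^ 'n"
    have "heat_kernel_deriv (h + k) t z = heat_kernel_deriv h t z + heat_kernel_deriv k t z" for z :: "real ^ 'n"
      by (simp add: heat_kernel_deriv_def inner_add_right add_divide_distrib diff_divide_distrib algebra_simps)
    then show "?D (h + k) = ?D h + ?D k" using fi by (simp add: distrib_left)
  next
    fix c :: real and h :: "real ^ 'n"
    have "heat_kernel_deriv (c *\<^sub>R h) t z = c * heat_kernel_deriv h t z" for z :: "real ^ 'n"
      by (simp add: heat_kernel_deriv_def)
    then have "?D (c *\<^sub>R h) = (\<integral>y. c * (f y * heat_kernel_deriv h t (x - y)) \<partial>lborel)"
      by (simp add: mult.left_commute[of _ c])
    then show "?D (c *\<^sub>R h) = c *\<^sub>R ?D h" by simp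
  next
    fix h :: "real ^ 'n"
    show "norm (?D h) \<le> norm h * (2 powr (real CARD('n) / 2) * t powr (- 1 / 2) * heat (2 * t) (distribution_of (\<lambda>y. \<bar>f y\<bar>)) x)"
      using abs_integral_heat_kernel_deriv_le[OF f t, of h x] by (simp add: mult.assoc)
  qed
  define C where "C = (4 * pi * t) powr (- real CARD('n) / 2) * (3 / (4 * t)) * (\<integral>y. \<bar>f y\<bar> \<partial>lborel)"
  have rem: "\<bar>heat t (distribution_of f) (x + h) - heat t (distribution_of f) x - ?D h\<bar> \<le> C * (norm h)\<^sup>2" for h
  proof -
    have eq: "heat t (distribution_of f) (x + h) - heat t (distribution_of f) x - ?D h
        = (\<integral>y. f y * heat_kernel (x + h - y) t - f y * heat_kernel (x - y) t - f y * heat_kernel_deriv h t (x - y) \<partial>lborel)"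
      unfolding heat_distribution_of
      by (subst Bochner_Integration.integral_diff, intro Bochner_Integration.integrable_diff gi, rule fi,
          subst Bochner_Integration.integral_diff, rule gi, rule gi, rule refl)
    have "\<bar>heat t (distribution_of f) (x + h) - heat t (distribution_of f) x - ?D h\<bar> \<le> (\<integral>y. \<bar>f y * heat_kernel (x + h - y) t - f y * heat_kernel (x - y) t - f y * heat_kernel_deriv h t (x - y)\<bar> \<partial>lborel)"
      unfolding eq by (rule integral_abs_bound)
    also have "\<dots> \<le> (\<integral>y. (4 * pi * t) powr (- real CARD('n) / 2) * (3 / (4 * t)) * (norm h)\<^sup>2 * \<bar>f y\<bar> \<partial>lborel)"
    proof (rule integral_mono)
      fix y
      have "f y * heat_kernel (x + h - y) t - f y * heat_kernel (x - y) t - f y * heat_kernel_deriv h t (x - y)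
         = f y * (heat_kernel ((x - y) + h) t - heat_kernel (x - y) t - heat_kernel_deriv h t (x - y))"
        by (simp only: right_diff_distrib diff_add_eq)
      then have "\<bar>f y * heat_kernel (x + h - y) t - f y * heat_kernel (x - y) t - f y * heat_kernel_deriv h t (x - y)\<bar> = \<bar>f y\<bar> * \<bar>heat_kernel ((x - y) + h) t - heat_kernel (x - y) t - heat_kernel_deriv h t (x - y)\<bar>"
        by (simp only: abs_mult)
      also have "\<dots> \<le> \<bar>f y\<bar> * ((4 * pi * t) powr (- real CARD('n) / 2) * (3 / (4 * t)) * (norm h)\<^sup>2)"
        by (rule mult_left_mono[OF heat_kernel_taylor[OF t]]) simp
      finally show "\<bar>f y * heat_kernel (x + h - y) t - f y * heat_kernel (x - y) t - f y * heat_kernel_deriv h t (x - y)\<bar>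
         \<le> (4 * pi * t) powr (- real CARD('n) / 2) * (3 / (4 * t)) * (norm h)\<^sup>2 * \<bar>f y\<bar>"
        by (simp only: mult.commute)
    qed (intro integrable_abs Bochner_Integration.integrable_diff gi fi integrable_mult_right f)+
    also have "\<dots> = C * (norm h)\<^sup>2" by (simp add: C_def)
    finally show ?thesis .
  qed
  have "((\<lambda>h. norm (heat t (distribution_of f) (x + h) - heat t (distribution_of f) x - ?D h) / norm h) \<longlongrightarrow> 0) (at 0)"
  proof (rule tendsto_sandwich[of "\<lambda>_. 0" _ _ "\<lambda>h. C * norm h"])
    have "((\<lambda>h :: real ^ 'n. C * norm h) \<longlongrightarrow> C * norm (0 :: real ^ 'n)) (at 0)" by (intro tendsto_intros)
    then show "((\<lambda>h :: real ^ 'n. C * norm h) \<longlongrightarrow> 0) (at 0)" by simp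
    show "\<forall>\<^sub>F h in at 0. norm (heat t (distribution_of f) (x + h) - heat t (distribution_of f) x - ?D h) / norm h \<le> C * norm h"
      unfolding eventually_at
    proof (intro exI[of _ 1] conjI ballI impI)
      fix h :: "real ^ 'n" assume "h \<noteq> 0 \<and> dist h 0 < 1"
      then show "norm (heat t (distribution_of f) (x + h) - heat t (distribution_of f) x - ?D h) / norm h \<le> C * norm h"
        using rem[of h] by (simp add: divide_le_eq power2_eq_square mult.assoc)
    qed simp
  qed auto
  then show ?thesis using lin by (simp add: has_derivative_at)
qed

text \<open>Uniqueness of the derivative replaces the abstractly defined gradient by an integral
  that is linear in f and easy to estimate.\<close>

lemma inner_grad_heat:
  fixes f :: "real ^ 'n \<Rightarrow> real"
  assumes f: "integrable lborel f" and t: "0 < t"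
  shows "a \<bullet> grad (heat t (distribution_of f)) x = (\<integral>y. f y * heat_kernel_deriv a t (x - y) \<partial>lborel)"
proof -
  let ?D = "\<lambda>h. \<integral>y. f y * heat_kernel_deriv h t (x - y) \<partial>lborel"
  have d: "(heat t (distribution_of f) has_derivative ?D) (at x)"
    by (rule heat_distribution_of_has_derivative[OF f t])
  then have lin: "linear ?D" by (rule has_derivative_linear)
  have "grad (heat t (distribution_of f)) x = (\<chi> i. ?D (axis i 1))"
    unfolding grad_def partial_def frechet_derivative_at[OF d, symmetric] ..
  then have "a \<bullet> grad (heat t (distribution_of f)) x = (\<Sum>i\<in>UNIV. a $ i * ?D (axis i 1))"
    by (simp add: inner_vec_def)
  also have "\<dots> = ?D (\<Sum>i\<in>UNIV. a $ i *\<^sub>R axis i 1)"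
    using linear_sum[OF lin, of "\<lambda>i. a $ i *\<^sub>R axis i 1" UNIV] linear_scale[OF lin] by simp
  also have "(\<Sum>i\<in>UNIV. a $ i *\<^sub>R axis i 1) = a"
    using basis_expansion[of a] by (simp add: scalar_mult_eq_scaleR)
  finally show ?thesis .
qed

text \<open>The kernel derivative is bounded, so a multiple of |f| dominates. This continuity is one
  of the two ingredients of the joint measurability of the Duhamel integrand.\<close>

lemma continuous_inner_grad_heat:
  fixes f :: "real ^ 'n \<Rightarrow> real"
  assumes f: "integrable lborel f" and t: "0 < t"
  shows "continuous_on UNIV (\<lambda>x. a \<bullet> grad (heat t (distribution_of f)) x)"
proof -
  define C where "C = norm a * 2 powr (real CARD('n) / 2) * t powr (- 1 / 2) * (4 * pi * (2 * t)) powr (- real CARD('n) / 2)"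
  have [measurable]: "f \<in> borel_measurable lborel" using f by auto
  have Cb: "\<bar>heat_kernel_deriv a t z\<bar> \<le> C" for z
    unfolding C_def
    by (rule order_trans[OF abs_heat_kernel_deriv_le[OF t]], rule mult_left_mono[OF heat_kernel_le])
      (use t in auto)
  have "(\<lambda>k. \<integral>y. f y * heat_kernel_deriv a t (X k - y) \<partial>lborel)
     \<longlonglongrightarrow> (\<integral>y. f y * heat_kernel_deriv a t (x - y) \<partial>lborel)" if X: "X \<longlonglongrightarrow> x" for X :: "nat \<Rightarrow> real ^ 'n" and x
  proof (rule integral_dominated_convergence[where w = "\<lambda>y. C * \<bar>f y\<bar>"])
    show "AE y in lborel. (\<lambda>k. f y * heat_kernel_deriv a t (X k - y)) \<longlonglongrightarrow> f y * heat_kernel_deriv a t (x - y)"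
    proof (rule AE_I2)
      fix y :: "real ^ 'n"
      have "continuous_on UNIV (\<lambda>x. f y * heat_kernel_deriv a t (x - y))"
        unfolding heat_kernel_deriv_def divide_inverse
        by (intro continuous_on_mult continuous_on_const continuous_on_heat_kernel continuous_on_minus
            continuous_on_inner continuous_on_diff continuous_on_id)
      then have "isCont (\<lambda>x. f y * heat_kernel_deriv a t (x - y)) x"
        by (simp add: continuous_on_eq_continuous_at)
      from isCont_tendsto_compose[OF this X]
      show "(\<lambda>k. f y * heat_kernel_deriv a t (X k - y)) \<longlonglongrightarrow> f y * heat_kernel_deriv a t (x - y)" .
    qed
    show "AE y in lborel. norm (f y * heat_kernel_deriv a t (X k - y)) \<le> C * \<bar>f y\<bar>" for k
    proof (rule AE_I2)
      fix y
      have "\<bar>f y\<bar> * \<bar>heat_kernel_deriv a t (X k - y)\<bar> \<le> \<bar>f y\<bar> * C"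
        by (intro mult_left_mono Cb) simp
      then show "norm (f y * heat_kernel_deriv a t (X k - y)) \<le> C * \<bar>f y\<bar>"
        by (simp add: abs_mult mult.commute)
    qed
  qed (use f in \<open>auto intro!: borel_measurable_times borel_measurable_heat_kernel_deriv borel_measurable_diff\<close>)
  then show ?thesis
    unfolding inner_grad_heat[OF f t]
    by (simp add: continuous_on_eq_continuous_at continuous_at_sequentially comp_def)
qed

text \<open>Pointwise the gradient is at most a multiple of t^(-1/2) e^(2t\<Delta>)|f|, so the
  smoothing estimate of the semigroup carries over. Size is measured in L^r; the integrability of f
  provides the derivative formula.\<close>

lemma Lp_norm_grad_heat_le:
  fixes f :: "real ^ 'n \<Rightarrow> real"
  assumes f: "integrable lborel f" and r: "1 \<le> r" and rp: "ennreal r \<le> p"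
    and t: "0 < t" and B: "0 \<le> B" and fB: "Lp_norm (ennreal r) f \<le> ennreal B"
  shows "Lp_norm p (\<lambda>x. a \<bullet> grad (heat t (distribution_of f)) x)
    \<le> ennreal (norm a * 2 powr (real CARD('n) / 2)
        * t powr (- (1 / 2 + real CARD('n) / 2 * (1 / r - enn2real (1 / p)))) * B)"
proof -
  define e where "e = real CARD('n) / 2 * (1 / r - enn2real (1 / p))"
  have [measurable]: "f \<in> borel_measurable lborel" using f by auto
  have p1: "1 \<le> p" using r rp by (meson dual_order.trans ennreal_ge_1)
  \<comment> \<open>A consequence of r \<le> p; it lets (2t)^(-e) be replaced by t^(-e).\<close>
  have e0: "0 \<le> e"
    using p1
  proof (cases rule: enn2real_exponent_cases)
    case 1 then show ?thesis using r by (simp add: e_def)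
  next
    case (2 s)
    then have "r \<le> s" using rp by simp
    then have "1 / s \<le> 1 / r" using r by (simp add: frac_le)
    then show ?thesis using 2 by (simp add: e_def)
  qed
  have fB': "Lp_norm (ennreal r) (\<lambda>y. \<bar>f y\<bar>) \<le> ennreal B"
    using fB by (simp add: Lp_norm_def)
  have "Lp_norm p (heat (2 * t) (distribution_of (\<lambda>y. \<bar>f y\<bar>))) \<le> ennreal ((2 * t) powr (- e) * B)"
    using Lp_norm_heat_le[OF _ r rp _ B fB', of "2 * t"] t by (simp add: e_def)
  also have "\<dots> \<le> ennreal (t powr (- e) * B)"
    using t e0 B by (intro ennreal_leI mult_right_mono powr_mono2') auto
  finally have h: "Lp_norm p (heat (2 * t) (distribution_of (\<lambda>y. \<bar>f y\<bar>))) \<le> ennreal (t powr (- e) * B)" .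
  have "Lp_norm p (\<lambda>x. a \<bullet> grad (heat t (distribution_of f)) x)
      \<le> ennreal (norm a * 2 powr (real CARD('n) / 2) * t powr (- 1 / 2) * (t powr (- e) * B))"
  proof (rule Lp_norm_le_mult[OF _ _ p1 _ _ _ h])
    show "(\<lambda>x. a \<bullet> grad (heat t (distribution_of f)) x) \<in> borel_measurable lborel"
      using borel_measurable_continuous_onI[OF continuous_inner_grad_heat[OF f t]] by simp
    show "\<bar>a \<bullet> grad (heat t (distribution_of f)) x\<bar> \<le> norm a * 2 powr (real CARD('n) / 2) * t powr (- 1 / 2)
        * \<bar>heat (2 * t) (distribution_of (\<lambda>y. \<bar>f y\<bar>)) x\<bar>" for x
      unfolding inner_grad_heat[OF f t]
      by (rule order_trans[OF abs_integral_heat_kernel_deriv_le[OF f t]]) (intro mult_left_mono, auto)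
    show "heat (2 * t) (distribution_of (\<lambda>y. \<bar>f y\<bar>)) \<in> borel_measurable lborel"
      by (rule borel_measurable_heat_distribution_of) simp
  qed (use B in auto)
  also have "norm a * 2 powr (real CARD('n) / 2) * t powr (- 1 / 2) * (t powr (- e) * B)
      = norm a * 2 powr (real CARD('n) / 2) * t powr (- (1 / 2 + e)) * B"
  proof -
    have "t powr (- (1 / 2 + e)) = t powr (- 1 / 2) * t powr (- e)" by (simp flip: powr_add)
    then show ?thesis by simp
  qed
  finally show ?thesis by (simp add: e_def)
qed

lemma Lp_norm_1_le_heat:
  fixes h :: "real ^ 'n \<Rightarrow> real"
  assumes "h \<in> borel_measurable lborel" "0 < t" "0 \<le> B" "Lp_norm 1 h \<le> ennreal B"
  shows "Lp_norm 1 (heat t (distribution_of h)) \<le> ennreal B"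
  using Lp_norm_heat_le[of h 1 1 t B] assms by simp

lemma heat_distribution_of_diff:
  fixes f g :: "real ^ 'n \<Rightarrow> real"
  assumes "f \<in> borel_measurable lborel" "g \<in> borel_measurable lborel" "0 < t"
    and "1 \<le> r" "Lp_norm (ennreal r) f < \<infinity>" "1 \<le> s" "Lp_norm (ennreal s) g < \<infinity>"
  shows "heat t (distribution_of (\<lambda>y. f y - g y)) x = heat t (distribution_of f) x - heat t (distribution_of g) x"
  unfolding heat_distribution_of left_diff_distrib
  using assms by (intro Bochner_Integration.integral_diff integrable_mult_heat_kernel) auto

lemma heat_diff: "heat t (v - w) x = heat t v x - heat t w x"
  by (simp add: heat_def)

lemma besov_norm_bound:
  assumes "besov_norm \<beta> v \<le> ennreal e" "0 < s"
  shows "Lp_norm 1 (heat s v) \<le> ennreal (s powr (- (\<beta> / 2)) * e)"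
proof -
  have "ennreal (s powr (\<beta> / 2)) * Lp_norm 1 (heat s v) \<le> ennreal e"
    using assms unfolding besov_norm_def by (meson SUP_le_iff greaterThan_iff)
  then have "ennreal (s powr (- (\<beta> / 2))) * (ennreal (s powr (\<beta> / 2)) * Lp_norm 1 (heat s v))
      \<le> ennreal (s powr (- (\<beta> / 2))) * ennreal e"
    by (rule mult_left_mono) simp
  also have "ennreal (s powr (- (\<beta> / 2))) * (ennreal (s powr (\<beta> / 2)) * Lp_norm 1 (heat s v)) = Lp_norm 1 (heat s v)"
    using assms by (simp add: powr_minus flip: mult.assoc ennreal_mult)
  finally show ?thesis by (simp add: ennreal_mult')
qed

section \<open>The initial datum of a small solution\<close>

locale convection_diffusion =
  fixes a :: "real ^ 'n" and \<beta> q :: real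
  assumes beta: "0 < \<beta>" "\<beta> < 1" and q_eq: "q = 1 + 1 / (real CARD('n) + \<beta>)"
begin

definition decay :: "ennreal \<Rightarrow> real" where
  "decay p = real CARD('n) / 2 * (1 - enn2real (1 / p)) + \<beta> / 2"

lemma dim_ge_1: "1 \<le> real CARD('n)"
  using zero_less_card_finite[where 'a = 'n] by linarith

lemma q_gt_1: "1 < q"
  using beta by (simp add: q_eq add_nonneg_pos)

lemma q_scaling: "q * (real CARD('n) + \<beta>) = real CARD('n) + \<beta> + 1"
proof -
  have "real CARD('n) + \<beta> \<noteq> 0" using beta dim_ge_1 by linarith
  then show ?thesis by (simp add: q_eq distrib_right)
qed

lemma enn2real_one_div: "1 \<le> r \<Longrightarrow> enn2real (1 / ennreal r) = 1 / r"
  by (simp add: divide_ennreal flip: ennreal_1)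

lemma decay_real: "1 \<le> r \<Longrightarrow> decay (ennreal r) = real CARD('n) / 2 * (1 - 1 / r) + \<beta> / 2"
  by (simp add: decay_def enn2real_one_div)

text \<open>This is the rate at which the L^1 norm of |u|^q may blow up at time 0; it is below 1 for
  \<beta> < 1, so the early part of the Duhamel integral converges.\<close>

lemma q_decay_q: "q * decay (ennreal q) = (1 + \<beta>) / 2"
proof -
  have "q * decay (ennreal q) = real CARD('n) / 2 * (q - 1) + q * \<beta> / 2"
    using q_gt_1 by (simp add: decay_real field_simps)
  then show ?thesis using q_scaling by (simp add: field_simps)
qed

lemma small_solution_Lp_space:
  assumes "small_solution a \<beta> q \<epsilon> u0 u" "0 < t"
  shows "u t \<in> borel_measurable lborel" "Lp_norm (ennreal q) (u t) < \<infinity>"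
  using assms by (auto simp: small_solution_def in_X_def Lp_space_def)

lemma small_solution_Lq_le:
  assumes u: "small_solution a \<beta> q \<epsilon> u0 u" and t: "0 < t"
  shows "Lp_norm (ennreal q) (u t) \<le> ennreal (2 * \<epsilon> * t powr (- decay (ennreal q)))"
proof -
  have d: "decay (ennreal q) = real CARD('n) / 2 * (1 - 1 / q) + \<beta> / 2"
    using q_gt_1 by (simp add: decay_real)
  have "weighted_sup_norm \<beta> q u \<le> ennreal (2 * \<epsilon>)" using u by (simp add: small_solution_def)
  then have "ennreal (t powr decay (ennreal q)) * Lp_norm (ennreal q) (u t) \<le> ennreal (2 * \<epsilon>)"
    using t unfolding weighted_sup_norm_def d by (meson SUP_le_iff greaterThan_iff)
  then have "ennreal (t powr (- decay (ennreal q))) * (ennreal (t powr decay (ennreal q)) * Lp_norm (ennreal q) (u t))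
     \<le> ennreal (t powr (- decay (ennreal q))) * ennreal (2 * \<epsilon>)"
    by (rule mult_left_mono) simp
  also have "ennreal (t powr (- decay (ennreal q))) * (ennreal (t powr decay (ennreal q)) * Lp_norm (ennreal q) (u t))
     = Lp_norm (ennreal q) (u t)"
    using t by (simp add: powr_minus flip: mult.assoc ennreal_mult)
  finally show ?thesis by (simp add: mult.commute flip: ennreal_mult'')
qed

lemma small_solution_eps_pos:
  assumes "small_solution a \<beta> q \<epsilon> u0 u"
  shows "0 < \<epsilon>"
proof -
  have "ennreal \<epsilon> \<noteq> 0" using assms by (auto simp: small_solution_def)
  then show ?thesis using ennreal_neg[of \<epsilon>] not_less by blast
qed

lemma integrable_nonlinearity:
  assumes u: "small_solution a \<beta> q \<epsilon> u0 u" and t: "0 < t"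
  shows "integrable lborel (\<lambda>y. u t y * \<bar>u t y\<bar> powr (q - 1))"
proof -
  note [measurable] = small_solution_Lp_space(1)[OF u t]
  obtain B where B: "0 \<le> B" "Lp_norm (ennreal q) (u t) = ennreal B"
    using small_solution_Lp_space(2)[OF u t] by (cases "Lp_norm (ennreal q) (u t)") auto
  then have fI: "(\<integral>\<^sup>+ y. ennreal (\<bar>u t y\<bar> powr q) \<partial>lborel) < \<infinity>"
    using q_gt_1 Lp_norm_le_iff[of q B "u t"] by (auto simp: le_less_trans)
  have "norm (u t y * \<bar>u t y\<bar> powr (q - 1)) = \<bar>u t y\<bar> powr q" for y
    using powr_mult_base[of "\<bar>u t y\<bar>" "q - 1"] by (simp add: abs_mult)
  then show ?thesis using fI by (intro integrableI_bounded) simp_all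
qed

text \<open>For almost every x, measurability in \<tau> is contained in the integrability demanded
  by \<open>mild_solution\<close>, and for each \<tau> the heat gradient is continuous in x; these
  are the hypotheses of \<open>borel_measurable_caratheodory\<close>.\<close>

lemma borel_measurable_duhamel:
  assumes u: "small_solution a \<beta> q \<epsilon> u0 u" and t: "0 < t"
  shows "(\<lambda>(\<tau>, x). indicator {0<..<t} \<tau> *\<^sub>R duhamel_integrand a q u t \<tau> x) \<in> borel_measurable (lborel \<Otimes>\<^sub>M lborel)"
proof (rule borel_measurable_caratheodory)
  fix \<tau> :: real
  show "continuous_on UNIV (\<lambda>x. indicator {0<..<t} \<tau> *\<^sub>R duhamel_integrand a q u t \<tau> x)"
  proof (cases "0 < \<tau> \<and> \<tau> < t")
    case True
    then show ?thesis
      using continuous_inner_grad_heat[OF integrable_nonlinearity[OF u], of \<tau> "t - \<tau>"]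
      by (simp add: duhamel_integrand_def)
  next
    case False
    then have "indicator {0<..<t} \<tau> = (0 :: real)" by auto
    then show ?thesis by simp
  qed
next
  have "AE x in lborel. set_integrable lborel {0<..<t} (\<lambda>\<tau>. duhamel_integrand a q u t \<tau> x)"
    using u t unfolding small_solution_def mild_solution_def by (auto elim: eventually_mono)
  then show "AE x in lborel. (\<lambda>\<tau>. indicator {0<..<t} \<tau> *\<^sub>R duhamel_integrand a q u t \<tau> x) \<in> borel_measurable lborel"
    by (rule eventually_mono) (simp add: set_integrable_def borel_measurable_integrable)
qed

lemma borel_measurable_duhamel_integral:
  assumes u: "small_solution a \<beta> q \<epsilon> u0 u" and t: "0 < t"
  shows "(\<lambda>x. LINT \<tau>:{0<..<t}|lborel. duhamel_integrand a q u t \<tau> x) \<in> borel_measurable lborel"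
  unfolding set_lebesgue_integral_def
  using measurable_pair_swap[OF borel_measurable_duhamel[OF u t]]
  by (intro lborel.borel_measurable_lebesgue_integral) (simp add: case_prod_beta)

text \<open>For a general tempered distribution the measurability of \<open>e\<^bsup>t\<Delta>\<^esup> u\<^sub>0\<close> would require continuity
  with respect to the Schwartz seminorms; here it is read off the integral equation.\<close>

lemma heat_initial_datum_AE_measurable:
  assumes u: "small_solution a \<beta> q \<epsilon> u0 u" and t: "0 < t"
  obtains h where "h \<in> borel_measurable lborel" "AE x in lborel. heat t u0 x = h x"
proof
  show "(\<lambda>x. u t x + (LINT \<tau>:{0<..<t}|lborel. duhamel_integrand a q u t \<tau> x)) \<in> borel_measurable lborel"
    using small_solution_Lp_space(1)[OF u t] borel_measurable_duhamel_integral[OF u t] by (rule borel_measurable_add)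
  show "AE x in lborel. heat t u0 x = u t x + (LINT \<tau>:{0<..<t}|lborel. duhamel_integrand a q u t \<tau> x)"
    using u t unfolding small_solution_def mild_solution_def by (auto elim: eventually_mono)
qed

lemma small_solution_heat_L1_le:
  assumes u: "small_solution a \<beta> q \<epsilon> u0 u" and t: "0 < t"
  shows "Lp_norm 1 (heat t u0) \<le> ennreal (t powr (- (\<beta> / 2)) * \<epsilon>)"
  using u t by (intro besov_norm_bound) (auto simp: small_solution_def)

text \<open>The identity holds with \<open>u(\<sigma>)\<close> in place of \<open>u\<^sub>0\<close>, and \<open>u(\<sigma>) \<rightarrow> u\<^sub>0\<close> in the Besov norm as \<open>\<sigma> \<rightarrow> 0\<close>, hence \<open>e\<^bsup>t\<Delta>\<^esup> u(\<sigma>) \<rightarrow> e\<^bsup>t\<Delta>\<^esup> u\<^sub>0\<close> in \<open>L\<^sup>1\<close> for every \<open>t > 0\<close>.\<close>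

lemma heat_initial_datum_semigroup:
  assumes u: "small_solution a \<beta> q \<epsilon> u0 u" and s: "0 < s" and t: "0 < t"
    and h[measurable]: "h \<in> borel_measurable lborel" and hs: "AE x in lborel. heat s u0 x = h x"
  shows "AE x in lborel. heat (t + s) u0 x = heat t (distribution_of h) x"
proof -
  have ts: "0 < t + s" using s t by simp
  obtain H where H[measurable]: "H \<in> borel_measurable lborel" and HAE: "AE x in lborel. heat (t + s) u0 x = H x"
    using heat_initial_datum_AE_measurable[OF u ts] .
  have h1: "Lp_norm 1 h < \<infinity>"
    using small_solution_heat_L1_le[OF u s] Lp_norm_1_cong_AE[OF hs] by (simp add: le_less_trans)
  define P where "P = heat t (distribution_of h)"
  have P[measurable]: "P \<in> borel_measurable lborel"
    unfolding P_def by (rule borel_measurable_heat_distribution_of[OF h])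
  define c where "c = (t + s) powr (- (\<beta> / 2)) + s powr (- (\<beta> / 2))"
  have c0: "0 \<le> c" by (simp add: c_def)
  have small: "(\<integral>\<^sup>+ x. ennreal \<bar>H x - P x\<bar> \<partial>lborel) \<le> ennreal (c * e)" if e: "0 < e" for e
  proof -
    have "((\<lambda>\<sigma>. besov_norm \<beta> (trajectory u0 u \<sigma> - trajectory u0 u 0)) \<longlongrightarrow> 0) (at 0 within {0..})"
      using u by (simp add: small_solution_def in_X_def)
    then have "\<forall>\<^sub>F \<sigma> in at 0 within {0..}. besov_norm \<beta> (trajectory u0 u \<sigma> - trajectory u0 u 0) < ennreal e"
      using e ennreal_lessI[of e 0] by (intro order_tendstoD(2)[of _ 0]) simp_all
    then obtain d where d: "0 < d" "\<And>\<sigma>. 0 \<le> \<sigma> \<Longrightarrow> \<sigma> \<noteq> 0 \<Longrightarrow> dist \<sigma> 0 < d \<Longrightarrow> besov_norm \<beta> (trajectory u0 u \<sigma> - trajectory u0 u 0) < ennreal e"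
      by (auto simp: eventually_at)
    \<comment> \<open>One value of the solution close to u0 suffices. It is a genuine function in
      L^q, for which the semigroup law is available.\<close>
    define g where "g = u (d / 2)"
    have "besov_norm \<beta> (distribution_of g - u0) \<le> ennreal e"
      using d(2)[of "d / 2"] d(1) by (simp add: trajectory_def g_def less_imp_le)
    then have bb: "Lp_norm 1 (heat \<sigma> (distribution_of g - u0)) \<le> ennreal (\<sigma> powr (- (\<beta> / 2)) * e)" if "0 < \<sigma>" for \<sigma>
      using that by (rule besov_norm_bound)
    have gm[measurable]: "g \<in> borel_measurable lborel" and gq: "Lp_norm (ennreal q) g < \<infinity>"
      using small_solution_Lp_space[OF u, of "d / 2"] d(1) by (simp_all add: g_def)
    define k where "k = heat s (distribution_of g)"
    have k[measurable]: "k \<in> borel_measurable lborel"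
      unfolding k_def by (rule borel_measurable_heat_distribution_of[OF gm])
    have kq: "Lp_norm (ennreal q) k < \<infinity>"
    proof -
      obtain B where B: "0 \<le> B" "Lp_norm (ennreal q) g = ennreal B"
        using gq by (cases "Lp_norm (ennreal q) g") auto
      then have "Lp_norm (ennreal q) k \<le> ennreal (s powr (- real CARD('n) / 2 * (1 / q - enn2real (1 / ennreal q))) * B)"
        unfolding k_def using q_gt_1 s by (intro Lp_norm_heat_le[OF gm]) auto
      then show ?thesis by (simp add: le_less_trans)
    qed
    have kh: "Lp_norm 1 (\<lambda>x. k x - h x) \<le> ennreal (s powr (- (\<beta> / 2)) * e)"
    proof -
      have "AE x in lborel. heat s (distribution_of g - u0) x = k x - h x"
        using hs by eventually_elim (simp add: heat_diff k_def)
      then show ?thesis using bb[OF s] Lp_norm_1_cong_AE by metis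
    qed
    define Q where "Q = heat t (distribution_of (\<lambda>x. k x - h x))"
    have Qm[measurable]: "Q \<in> borel_measurable lborel"
      unfolding Q_def by (rule borel_measurable_heat_distribution_of) simp
    have Q1: "Lp_norm 1 Q \<le> ennreal (s powr (- (\<beta> / 2)) * e)"
      unfolding Q_def using t e kh by (intro Lp_norm_1_le_heat) auto
    have Qeq: "Q x = heat (t + s) (distribution_of g) x - P x" for x
    proof -
      have "Q x = heat t (distribution_of k) x - heat t (distribution_of h) x"
        unfolding Q_def using t kq h1 q_gt_1 by (intro heat_distribution_of_diff[of _ _ _ q 1]) auto
      also have "heat t (distribution_of k) x = heat (t + s) (distribution_of g) x"
        unfolding k_def using gq q_gt_1 s t by (intro heat_heat[OF gm]) auto
      finally show ?thesis by (simp add: P_def)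
    qed
    define R where "R = (\<lambda>x. heat (t + s) (distribution_of g) x - H x)"
    have Rm[measurable]: "R \<in> borel_measurable lborel"
      unfolding R_def by (intro borel_measurable_diff borel_measurable_heat_distribution_of[OF gm] H)
    have R1: "Lp_norm 1 R \<le> ennreal ((t + s) powr (- (\<beta> / 2)) * e)"
    proof -
      have "AE x in lborel. heat (t + s) (distribution_of g - u0) x = R x"
        using HAE by eventually_elim (simp add: heat_diff R_def)
      then show ?thesis using bb[OF ts] Lp_norm_1_cong_AE by metis
    qed
    \<comment> \<open>Both H and P are compared with e^((t+s)\<Delta>)g: H - P = Q - R, where Q is
      controlled by the Besov bound at time s and R by the one at time t + s.\<close>
    have "(\<integral>\<^sup>+ x. ennreal \<bar>H x - P x\<bar> \<partial>lborel) \<le> (\<integral>\<^sup>+ x. ennreal \<bar>R x\<bar> + ennreal \<bar>Q x\<bar> \<partial>lborel)"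
      by (intro nn_integral_mono) (auto simp: Qeq R_def simp flip: ennreal_plus intro!: ennreal_leI)
    also have "\<dots> = Lp_norm 1 R + Lp_norm 1 Q"
      by (simp add: nn_integral_add Lp_norm_1_eq)
    also have "\<dots> \<le> ennreal ((t + s) powr (- (\<beta> / 2)) * e) + ennreal (s powr (- (\<beta> / 2)) * e)"
      by (intro add_mono R1 Q1)
    also have "\<dots> = ennreal (c * e)"
      using e by (simp add: c_def distrib_right flip: ennreal_plus)
    finally show ?thesis .
  qed
  have "(\<integral>\<^sup>+ x. ennreal \<bar>H x - P x\<bar> \<partial>lborel) \<le> 0"
  proof (rule ennreal_le_epsilon)
    fix e :: real assume e: "0 < e"
    have "(\<integral>\<^sup>+ x. ennreal \<bar>H x - P x\<bar> \<partial>lborel) \<le> ennreal (c * (e / (c + 1)))"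
      using e c0 by (intro small) (simp add: divide_pos_pos)
    also have "\<dots> \<le> ennreal e"
      using e c0 by (intro ennreal_leI) (simp add: field_simps)
    finally show "(\<integral>\<^sup>+ x. ennreal \<bar>H x - P x\<bar> \<partial>lborel) \<le> 0 + ennreal e" by simp
  qed
  then have "AE x in lborel. ennreal \<bar>H x - P x\<bar> = 0"
    by (subst (asm) le_zero_eq, subst (asm) nn_integral_0_iff_AE) auto
  with HAE show ?thesis
    by eventually_elim (simp add: P_def ennreal_eq_0_iff)
qed

text \<open>The L^1 norm is measured at time \<sigma>, where the decay hypothesis on u0 - v0
  applies, and the second half of the time smooths from L^1 to L^p. The measurable h stands in for
  the difference, which is measurable only up to a null set.\<close>

lemma heat_initial_data_difference:
  assumes u: "small_solution a \<beta> q \<epsilon> u0 u" and v: "small_solution a \<beta> q \<epsilon> v0 v"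
    and s: "0 < \<sigma>" and p: "1 \<le> p" and N: "0 \<le> N" "Lp_norm 1 (heat \<sigma> (u0 - v0)) \<le> ennreal N"
  obtains h where "h \<in> borel_measurable lborel"
    "AE x in lborel. heat (2 * \<sigma>) u0 x - heat (2 * \<sigma>) v0 x = h x"
    "Lp_norm p h \<le> ennreal (\<sigma> powr (- decay p) * (\<sigma> powr (\<beta> / 2) * N))"
proof -
  obtain h1 where h1[measurable]: "h1 \<in> borel_measurable lborel" and 1: "AE x in lborel. heat \<sigma> u0 x = h1 x"
    using heat_initial_datum_AE_measurable[OF u s] .
  obtain h2 where h2[measurable]: "h2 \<in> borel_measurable lborel" and 2: "AE x in lborel. heat \<sigma> v0 x = h2 x"
    using heat_initial_datum_AE_measurable[OF v s] .
  have fin: "Lp_norm (ennreal 1) h1 < \<infinity>" "Lp_norm (ennreal 1) h2 < \<infinity>"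
    using small_solution_heat_L1_le[OF u s] Lp_norm_1_cong_AE[OF 1]
      small_solution_heat_L1_le[OF v s] Lp_norm_1_cong_AE[OF 2] by (simp_all add: le_less_trans)
  define h where "h = heat \<sigma> (distribution_of (\<lambda>x. h1 x - h2 x))"
  have "AE x in lborel. heat \<sigma> (u0 - v0) x = h1 x - h2 x"
    using 1 2 by eventually_elim (simp add: heat_diff)
  then have "Lp_norm (ennreal 1) (\<lambda>x. h1 x - h2 x) \<le> ennreal N"
    using N Lp_norm_1_cong_AE by (metis ennreal_1)
  then have "Lp_norm p h \<le> ennreal (\<sigma> powr (- real CARD('n) / 2 * (1 / 1 - enn2real (1 / p))) * N)"
    unfolding h_def using p s N by (intro Lp_norm_heat_le) auto
  also have "\<sigma> powr (- real CARD('n) / 2 * (1 / 1 - enn2real (1 / p))) * N = \<sigma> powr (- decay p) * (\<sigma> powr (\<beta> / 2) * N)"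
  proof -
    have "- real CARD('n) / 2 * (1 / 1 - enn2real (1 / p)) = - decay p + \<beta> / 2"
      by (simp add: decay_def)
    then show ?thesis by (simp only: powr_add mult.assoc)
  qed
  finally have 3: "Lp_norm p h \<le> ennreal (\<sigma> powr (- decay p) * (\<sigma> powr (\<beta> / 2) * N))" .
  have "AE x in lborel. heat (2 * \<sigma>) u0 x - heat (2 * \<sigma>) v0 x = h x"
    using heat_initial_datum_semigroup[OF u s s h1 1] heat_initial_datum_semigroup[OF v s s h2 2]
  proof eventually_elim
    case (elim x)
    then show ?case
      using heat_distribution_of_diff[OF h1 h2 s _ fin(1) _ fin(2), of x] by (simp add: h_def)
  qed
  moreover have "h \<in> borel_measurable lborel"
    unfolding h_def by (rule borel_measurable_heat_distribution_of) simp
  ultimately show ?thesis using 3 that by blast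
qed

end

section \<open>The Duhamel term\<close>

lemma nn_integral_powr_Ioc:
  fixes b T :: real
  assumes "b < 1" "0 \<le> T"
  shows "(\<integral>\<^sup>+ \<tau>. ennreal (indicator {0<..T} \<tau> * \<tau> powr (- b)) \<partial>lborel) = ennreal (T powr (1 - b) / (1 - b))"
proof -
  have "((\<lambda>\<tau>. \<tau> powr (- b)) has_integral (T powr (- b + 1) / (- b + 1))) {0..T}"
    using assms by (intro has_integral_powr_from_0) auto
  moreover have "indicator {0..T} \<tau> * \<tau> powr (- b) = (if \<tau> \<in> {0..T} then \<tau> powr (- b) else 0)" for \<tau> :: real
    by simp
  ultimately have "((\<lambda>\<tau>. indicator {0..T} \<tau> * \<tau> powr (- b)) has_integral (T powr (- b + 1) / (- b + 1))) UNIV"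
    by (simp only: has_integral_restrict_UNIV)
  then have "(\<integral>\<^sup>+ \<tau>. ennreal (indicator {0..T} \<tau> * \<tau> powr (- b)) \<partial>lborel) = ennreal (T powr (- b + 1) / (- b + 1))"
    by (intro nn_integral_has_integral_lborel) auto
  moreover have "indicator {0..T} \<tau> * \<tau> powr (- b) = indicator {0<..T} \<tau> * \<tau> powr (- b)" for \<tau> :: real
    by (cases "\<tau> = 0") (auto simp: indicator_def)
  ultimately show ?thesis by (simp only: uminus_add_conv_diff)
qed

lemma nn_integral_powr_reflected:
  fixes e \<sigma> :: real
  assumes "e < 1" "0 < \<sigma>"
  shows "(\<integral>\<^sup>+ \<tau>. ennreal (indicator {\<sigma><..<2 * \<sigma>} \<tau> * (2 * \<sigma> - \<tau>) powr (- e)) \<partial>lborel)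
    \<le> ennreal (\<sigma> powr (1 - e) / (1 - e))"
proof -
  have "(\<integral>\<^sup>+ \<tau>. ennreal (indicator {\<sigma><..<2 * \<sigma>} \<tau> * (2 * \<sigma> - \<tau>) powr (- e)) \<partial>lborel)
     = (\<integral>\<^sup>+ \<tau>. ennreal (indicator {\<sigma><..<2 * \<sigma>} (2 * \<sigma> + (-1) * \<tau>) * (2 * \<sigma> - (2 * \<sigma> + (-1) * \<tau>)) powr (- e)) \<partial>lborel)"
    by (subst nn_integral_real_affine[where c = "-1" and t = "2 * \<sigma>"]) auto
  also have "\<dots> \<le> (\<integral>\<^sup>+ \<tau>. ennreal (indicator {0<..\<sigma>} \<tau> * \<tau> powr (- e)) \<partial>lborel)"
    by (intro nn_integral_mono) (auto simp: indicator_def)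
  also have "\<dots> = ennreal (\<sigma> powr (1 - e) / (1 - e))"
    using assms by (intro nn_integral_powr_Ioc) auto
  finally show ?thesis .
qed

context convection_diffusion
begin

text \<open>The denominator stems from integrating \<tau>^(-(1+\<beta>)/2) near 0. The 8 is 4 * 2:
  the constant 4 of \<open>Lp_norm_signed_powr_diff_le\<close> times the 2 in the bound 2 \<epsilon>
  on both solutions.\<close>

definition early_const :: real where
  "early_const = norm a * 2 powr (real CARD('n) / 2) * q * 8 powr (q - 1) / ((1 - \<beta>) / 2)"

text \<open>Here the denominator stems from the singularity of the gradient estimate at \<tau> =
  2\<sigma>; it is positive exactly when that singularity is integrable.\<close>

definition late_const :: "real \<Rightarrow> ennreal \<Rightarrow> real" where
  "late_const r p = norm a * 2 powr (real CARD('n) / 2) * q * 4 powr (q - 1)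
    / (1 / 2 - real CARD('n) / 2 * (q / r - enn2real (1 / p)))"

text \<open>The heat gradient is linear in the nonlinearity, which is Lipschitz from bounded sets of
  L^r to L^(r/q). The time exponent is 1/2 for the gradient plus the smoothing from L^(r/q) to
  L^p.\<close>

lemma duhamel_difference_Lp_le:
  assumes u: "small_solution a \<beta> q \<epsilon> u0 u" and v: "small_solution a \<beta> q \<epsilon> v0 v"
    and \<tau>: "0 < \<tau>" "\<tau> < t" and r: "q \<le> r" and rp: "ennreal (r / q) \<le> p"
    and A: "0 < A" "Lp_norm (ennreal r) (u \<tau>) \<le> ennreal A" "Lp_norm (ennreal r) (v \<tau>) \<le> ennreal A"
    and D: "0 < D" "Lp_norm (ennreal r) (u \<tau> - v \<tau>) \<le> ennreal D"
  shows "Lp_norm p (\<lambda>x. duhamel_integrand a q u t \<tau> x - duhamel_integrand a q v t \<tau> x)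
    \<le> ennreal (norm a * 2 powr (real CARD('n) / 2)
        * (t - \<tau>) powr (- (1 / 2 + real CARD('n) / 2 * (q / r - enn2real (1 / p)))) * (q * (4 * A) powr (q - 1) * D))"
proof -
  let ?f = "\<lambda>y. u \<tau> y * \<bar>u \<tau> y\<bar> powr (q - 1)" and ?g = "\<lambda>y. v \<tau> y * \<bar>v \<tau> y\<bar> powr (q - 1)"
  have s: "0 < t - \<tau>" using \<tau> by simp
  have fi: "integrable lborel ?f" and gi: "integrable lborel ?g"
    using integrable_nonlinearity[OF u] integrable_nonlinearity[OF v] \<tau> by auto
  have fgi: "integrable lborel (\<lambda>y. ?f y - ?g y)"
    using fi gi by (rule Bochner_Integration.integrable_diff)
  have eq: "duhamel_integrand a q u t \<tau> x - duhamel_integrand a q v t \<tau> x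
      = a \<bullet> grad (heat (t - \<tau>) (distribution_of (\<lambda>y. ?f y - ?g y))) x" for x
    unfolding duhamel_integrand_def inner_grad_heat[OF fi s] inner_grad_heat[OF gi s] inner_grad_heat[OF fgi s]
      left_diff_distrib
    by (intro Bochner_Integration.integral_diff[symmetric] integrable_mult_heat_kernel_deriv fi gi s)
  have "Lp_norm (ennreal (r / q)) (\<lambda>y. ?f y - ?g y) \<le> ennreal (q * (4 * A) powr (q - 1) * D)"
    using small_solution_Lp_space(1)[OF u \<tau>(1)] small_solution_Lp_space(1)[OF v \<tau>(1)] q_gt_1 r A D
    by (intro Lp_norm_signed_powr_diff_le) auto
  then have "Lp_norm p (\<lambda>x. a \<bullet> grad (heat (t - \<tau>) (distribution_of (\<lambda>y. ?f y - ?g y))) x)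
    \<le> ennreal (norm a * 2 powr (real CARD('n) / 2)
        * (t - \<tau>) powr (- (1 / 2 + real CARD('n) / 2 * (1 / (r / q) - enn2real (1 / p)))) * (q * (4 * A) powr (q - 1) * D))"
    using q_gt_1 r A D by (intro Lp_norm_grad_heat_le[OF fgi _ rp s]) auto
  then show ?thesis by (simp add: eq)
qed

text \<open>The Duhamel integral is split at half time \<open>\<sigma>\<close>: on \<open>(0,\<sigma>]\<close> the nonlinearity is estimated in
  \<open>L\<^sup>1\<close>, on \<open>(\<sigma>,2\<sigma>)\<close> in \<open>L\<^bsup>r/q\<^esup>\<close>, where \<open>p > r\<close> is allowed; this gains integrability.\<close>

lemma duhamel_difference_integral_Lp_le:
  assumes u: "small_solution a \<beta> q \<epsilon> u0 u" and v: "small_solution a \<beta> q \<epsilon> v0 v"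
    and p: "1 \<le> p" and r: "q \<le> r" and rp: "ennreal (r / q) \<le> p"
    and e: "real CARD('n) / 2 * (q / r - enn2real (1 / p)) < 1 / 2"
    and M: "0 < M" "\<And>\<tau>. 0 < \<tau> \<Longrightarrow> Lp_norm (ennreal r) (u \<tau>) \<le> ennreal (M * \<tau> powr (- decay (ennreal r)))"
      "\<And>\<tau>. 0 < \<tau> \<Longrightarrow> Lp_norm (ennreal r) (v \<tau>) \<le> ennreal (M * \<tau> powr (- decay (ennreal r)))"
    and C: "0 < C" "\<And>\<tau>. 0 < \<tau> \<Longrightarrow> Lp_norm (ennreal q) (u \<tau> - v \<tau>) \<le> ennreal (C * \<tau> powr (- decay (ennreal q)))"
    and \<eta>: "0 < \<eta>"
      "\<And>\<tau>. 0 < \<tau> \<Longrightarrow> T \<le> \<tau> \<Longrightarrow> Lp_norm (ennreal q) (u \<tau> - v \<tau>) \<le> ennreal (\<eta> * \<tau> powr (- decay (ennreal q)))"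
      "\<And>\<tau>. 0 < \<tau> \<Longrightarrow> T \<le> \<tau> \<Longrightarrow> Lp_norm (ennreal r) (u \<tau> - v \<tau>) \<le> ennreal (\<eta> * \<tau> powr (- decay (ennreal r)))"
    and \<sigma>: "0 < \<sigma>" "0 \<le> T" "T \<le> \<sigma>"
  obtains I where "I \<in> borel_measurable lborel"
    "\<And>x. set_integrable lborel {0<..<2 * \<sigma>} (\<lambda>\<tau>. duhamel_integrand a q u (2 * \<sigma>) \<tau> x) \<Longrightarrow>
      set_integrable lborel {0<..<2 * \<sigma>} (\<lambda>\<tau>. duhamel_integrand a q v (2 * \<sigma>) \<tau> x) \<Longrightarrow>
      I x = (LINT \<tau>:{0<..<2 * \<sigma>}|lborel. duhamel_integrand a q u (2 * \<sigma>) \<tau> x)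
        - (LINT \<tau>:{0<..<2 * \<sigma>}|lborel. duhamel_integrand a q v (2 * \<sigma>) \<tau> x)"
    "Lp_norm p I \<le> ennreal (\<sigma> powr (- decay p) *
      (early_const * \<epsilon> powr (q - 1) * (C * (T / \<sigma>) powr ((1 - \<beta>) / 2) + \<eta>) + late_const r p * M powr (q - 1) * \<eta>))"
proof -
  define A where "A = norm a * 2 powr (real CARD('n) / 2)"
  define b where "b = (1 + \<beta>) / 2"
  define e1 where "e1 = 1 / 2 + real CARD('n) / 2 * (1 - enn2real (1 / p))"
  define e2 where "e2 = 1 / 2 + real CARD('n) / 2 * (q / r - enn2real (1 / p))"
  define F where "F \<tau> x = indicator {0<..<2 * \<sigma>} \<tau> *\<^sub>R duhamel_integrand a q u (2 * \<sigma>) \<tau> x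
    - indicator {0<..<2 * \<sigma>} \<tau> *\<^sub>R duhamel_integrand a q v (2 * \<sigma>) \<tau> x" for \<tau> x
  define c1 where "c1 = A * \<sigma> powr (- e1) * (q * (8 * \<epsilon>) powr (q - 1))"
  define c2 where "c2 = A * (q * (4 * M) powr (q - 1) * \<eta> * \<sigma> powr (- q * decay (ennreal r)))"
  \<comment> \<open>A scalar majorant of the L^p norm of F \<tau>: the global bound C before T, the
    bound \<eta> on the first half, and the late half with its singularity at 2\<sigma>. The first
    two pieces overlap, which does no harm and keeps all integrals explicit.\<close>
  define m where "m \<tau> = c1 * C * (indicator {0<..T} \<tau> * \<tau> powr (- b))
    + c1 * \<eta> * (indicator {0<..\<sigma>} \<tau> * \<tau> powr (- b))
    + c2 * (indicator {\<sigma><..<2 * \<sigma>} \<tau> * (2 * \<sigma> - \<tau>) powr (- e2))" for \<tau>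
  note \<epsilon> = small_solution_eps_pos[OF u]
  have A0: "0 \<le> A" by (simp add: A_def)
  have c1: "0 \<le> c1" and c2: "0 \<le> c2" using A0 q_gt_1 \<eta>(1) by (auto simp: c1_def c2_def)
  have b1: "b < 1" using beta by (simp add: b_def)
  have e2: "e2 < 1" using e unfolding e2_def by linarith
  have r1: "1 \<le> r" using r q_gt_1 by simp
  have e1_0: "0 \<le> e1"
  proof -
    have "enn2real (1 / p) \<le> 1"
      using p by (cases rule: enn2real_exponent_cases) auto
    then show ?thesis by (simp add: e1_def)
  qed
  have Fm: "case_prod F \<in> borel_measurable (lborel \<Otimes>\<^sub>M lborel)"
    unfolding case_prod_beta' F_def
    using borel_measurable_diff[OF borel_measurable_duhamel[OF u, of "2 * \<sigma>"] borel_measurable_duhamel[OF v, of "2 * \<sigma>"]] \<sigma>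
    by (simp add: case_prod_beta')
  have mm: "m \<in> borel_measurable lborel" unfolding m_def by measurable
  have m0: "0 \<le> m \<tau>" for \<tau>
    using c1 c2 C(1) \<eta>(1) by (simp add: m_def)
  have Lp0: "Lp_norm p (\<lambda>_ :: real ^ 'n. 0) \<le> ennreal (m \<tau>)" for \<tau>
    using p
  proof (cases rule: enn2real_exponent_cases)
    case 1
    then show ?thesis using m0 Lp_norm_top_le_iff[of "\<lambda>_ :: real ^ 'n. 0" "m \<tau>"] by simp
  next
    case (2 s)
    then show ?thesis using m0 Lp_norm_le_iff[of s "m \<tau>" "\<lambda>_ :: real ^ 'n. 0"] by simp
  qed
  have Fle: "Lp_norm p (F \<tau>) \<le> ennreal (m \<tau>)" for \<tau>
  proof -
    consider "\<tau> \<notin> {0<..<2 * \<sigma>}" | "0 < \<tau>" "\<tau> \<le> \<sigma>" | "\<sigma> < \<tau>" "\<tau> < 2 * \<sigma>" by fastforce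
    then show ?thesis
    proof cases
      case 1
      then have "F \<tau> = (\<lambda>_. 0)" by (simp add: F_def fun_eq_iff)
      then show ?thesis using Lp0 by simp
    next
      case 2
      then have Feq: "F \<tau> = (\<lambda>x. duhamel_integrand a q u (2 * \<sigma>) \<tau> x - duhamel_integrand a q v (2 * \<sigma>) \<tau> x)"
        by (simp add: F_def fun_eq_iff)
      define D where "D = (if \<tau> < T then C else \<eta>)"
      have D: "0 < D" "Lp_norm (ennreal q) (u \<tau> - v \<tau>) \<le> ennreal (D * \<tau> powr (- decay (ennreal q)))"
        using 2 C \<eta> by (auto simp: D_def)
      have "Lp_norm p (F \<tau>) \<le> ennreal (A * (2 * \<sigma> - \<tau>) powr (- (1 / 2 + real CARD('n) / 2 * (q / q - enn2real (1 / p))))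
         * (q * (4 * (2 * \<epsilon> * \<tau> powr (- decay (ennreal q)))) powr (q - 1) * (D * \<tau> powr (- decay (ennreal q)))))"
        unfolding Feq A_def
        using 2 D \<epsilon> p q_gt_1 small_solution_Lq_le[OF u, of \<tau>] small_solution_Lq_le[OF v, of \<tau>]
        by (intro duhamel_difference_Lp_le[OF u v]) auto
      also have "q / q = 1" using q_gt_1 by simp
      also have "(4 * (2 * \<epsilon> * \<tau> powr (- decay (ennreal q)))) powr (q - 1) * (D * \<tau> powr (- decay (ennreal q)))
          = (8 * \<epsilon>) powr (q - 1) * D * \<tau> powr (- b)"
      proof -
        have "- b = - decay (ennreal q) * (q - 1) + - decay (ennreal q)"
          using q_decay_q by (simp add: b_def algebra_simps)
        then have "\<tau> powr (- b) = (\<tau> powr (- decay (ennreal q))) powr (q - 1) * \<tau> powr (- decay (ennreal q))"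
          by (simp only: powr_add powr_powr)
        moreover have "(4 * (2 * \<epsilon> * \<tau> powr (- decay (ennreal q)))) powr (q - 1)
            = (8 * \<epsilon>) powr (q - 1) * (\<tau> powr (- decay (ennreal q))) powr (q - 1)"
          by (simp add: powr_mult[symmetric] mult.assoc)
        ultimately show ?thesis by simp
      qed
      then have "q * (4 * (2 * \<epsilon> * \<tau> powr (- decay (ennreal q)))) powr (q - 1) * (D * \<tau> powr (- decay (ennreal q)))
         = q * ((8 * \<epsilon>) powr (q - 1) * D * \<tau> powr (- b))" by (simp only: mult.assoc)
      also have "A * (2 * \<sigma> - \<tau>) powr (- (1 / 2 + real CARD('n) / 2 * (1 - enn2real (1 / p)))) * (q * ((8 * \<epsilon>) powr (q - 1) * D * \<tau> powr (- b)))
         \<le> A * \<sigma> powr (- e1) * (q * ((8 * \<epsilon>) powr (q - 1) * D * \<tau> powr (- b)))"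
        using 2 e1_0 A0 q_gt_1 D \<sigma> unfolding e1_def[symmetric]
        by (intro mult_right_mono mult_left_mono powr_mono2') auto
      also have "\<dots> = c1 * D * \<tau> powr (- b)" by (simp add: c1_def)
      also have "\<dots> \<le> m \<tau>"
        using 2 c1 c2 C(1) \<eta>(1) by (auto simp: m_def D_def indicator_def)
      finally show ?thesis by (simp add: ennreal_leI)
    next
      case 3
      then have Feq: "F \<tau> = (\<lambda>x. duhamel_integrand a q u (2 * \<sigma>) \<tau> x - duhamel_integrand a q v (2 * \<sigma>) \<tau> x)"
        using \<sigma> by (simp add: F_def fun_eq_iff)
      have \<tau>0: "0 < \<tau>" "T \<le> \<tau>" using 3 \<sigma> by auto
      have d0: "0 \<le> q * decay (ennreal r)"
        using q_gt_1 r1 beta by (simp add: decay_real)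
      have "Lp_norm p (F \<tau>) \<le> ennreal (A * (2 * \<sigma> - \<tau>) powr (- e2)
         * (q * (4 * (M * \<tau> powr (- decay (ennreal r)))) powr (q - 1) * (\<eta> * \<tau> powr (- decay (ennreal r)))))"
        unfolding Feq A_def e2_def
        using 3 \<tau>0 M \<eta> r rp by (intro duhamel_difference_Lp_le[OF u v]) auto
      also have "q * (4 * (M * \<tau> powr (- decay (ennreal r)))) powr (q - 1) * (\<eta> * \<tau> powr (- decay (ennreal r)))
         = q * (4 * M) powr (q - 1) * \<eta> * \<tau> powr (- q * decay (ennreal r))"
      proof -
        have "- q * decay (ennreal r) = - decay (ennreal r) * (q - 1) + - decay (ennreal r)"
          by (simp add: algebra_simps)
        then have "\<tau> powr (- q * decay (ennreal r)) = (\<tau> powr (- decay (ennreal r))) powr (q - 1) * \<tau> powr (- decay (ennreal r))"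
          by (simp only: powr_add powr_powr)
        moreover have "(4 * (M * \<tau> powr (- decay (ennreal r)))) powr (q - 1)
            = (4 * M) powr (q - 1) * (\<tau> powr (- decay (ennreal r))) powr (q - 1)"
          by (simp add: powr_mult[symmetric] mult.assoc)
        ultimately show ?thesis by simp
      qed
      also have "A * (2 * \<sigma> - \<tau>) powr (- e2) * (q * (4 * M) powr (q - 1) * \<eta> * \<tau> powr (- q * decay (ennreal r)))
         \<le> A * (2 * \<sigma> - \<tau>) powr (- e2) * (q * (4 * M) powr (q - 1) * \<eta> * \<sigma> powr (- q * decay (ennreal r)))"
        using 3 d0 A0 q_gt_1 \<eta>(1) \<sigma>
        by (intro mult_left_mono powr_mono2') auto
      also have "\<dots> = c2 * (2 * \<sigma> - \<tau>) powr (- e2)" by (simp add: c2_def)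
      also have "\<dots> \<le> m \<tau>"
        using 3 c1 c2 C(1) \<eta>(1) \<sigma> by (auto simp: m_def indicator_def)
      finally show ?thesis by (simp add: ennreal_leI)
    qed
  qed
  \<comment> \<open>Outside (0, 2\<sigma>) the integrand is cut off; inside, m vanishes only for a =
    0, and then so does the integrand.\<close>
  have Fz: "F \<tau> x = 0" if "m \<tau> = 0" for \<tau> x
  proof (cases "a = 0 \<or> \<tau> \<notin> {0<..<2 * \<sigma>}")
    case True
    then show ?thesis by (auto simp: F_def duhamel_integrand_def)
  next
    case False
    then have "0 < A" by (simp add: A_def)
    then have c: "0 < c1" "0 < c2" using q_gt_1 \<eta>(1) \<epsilon> M \<sigma> by (simp_all add: c1_def c2_def)
    have "0 < m \<tau>"
    proof (cases "\<tau> \<le> \<sigma>")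
      case True
      have "0 < c1 * \<eta> * (indicator {0<..\<sigma>} \<tau> * \<tau> powr (- b))" using c \<eta>(1) True False by simp
      then show ?thesis using c C(1) unfolding m_def by (intro add_pos_nonneg add_nonneg_pos) simp_all
    next
      case f: False
      have "0 < c2 * (indicator {\<sigma><..<2 * \<sigma>} \<tau> * (2 * \<sigma> - \<tau>) powr (- e2))" using c f False by simp
      then show ?thesis using c C(1) \<eta>(1) unfolding m_def by (intro add_nonneg_pos) simp_all
    qed
    then show ?thesis using that by simp
  qed
  define B where "B = c1 * C * (T powr (1 - b) / (1 - b)) + c1 * \<eta> * (\<sigma> powr (1 - b) / (1 - b)) + c2 * (\<sigma> powr (1 - e2) / (1 - e2))"
  have B0: "0 \<le> B" using c1 c2 C(1) \<eta>(1) b1 e2 by (simp add: B_def)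
  have mB: "(\<integral>\<^sup>+ \<tau>. ennreal (m \<tau>) \<partial>lborel) \<le> ennreal B"
  proof -
    have "(\<integral>\<^sup>+ \<tau>. ennreal (m \<tau>) \<partial>lborel) = (\<integral>\<^sup>+ \<tau>. ennreal (c1 * C) * ennreal (indicator {0<..T} \<tau> * \<tau> powr (- b))
      + ennreal (c1 * \<eta>) * ennreal (indicator {0<..\<sigma>} \<tau> * \<tau> powr (- b))
      + ennreal c2 * ennreal (indicator {\<sigma><..<2 * \<sigma>} \<tau> * (2 * \<sigma> - \<tau>) powr (- e2)) \<partial>lborel)"
      using c1 c2 C(1) \<eta>(1) by (intro nn_integral_cong) (simp add: m_def flip: ennreal_mult ennreal_plus)
    also have "\<dots> = ennreal (c1 * C) * (\<integral>\<^sup>+ \<tau>. ennreal (indicator {0<..T} \<tau> * \<tau> powr (- b)) \<partial>lborel)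
      + ennreal (c1 * \<eta>) * (\<integral>\<^sup>+ \<tau>. ennreal (indicator {0<..\<sigma>} \<tau> * \<tau> powr (- b)) \<partial>lborel)
      + ennreal c2 * (\<integral>\<^sup>+ \<tau>. ennreal (indicator {\<sigma><..<2 * \<sigma>} \<tau> * (2 * \<sigma> - \<tau>) powr (- e2)) \<partial>lborel)"
      by (simp add: nn_integral_add nn_integral_cmult)
    also have "\<dots> \<le> ennreal (c1 * C) * ennreal (T powr (1 - b) / (1 - b))
      + ennreal (c1 * \<eta>) * ennreal (\<sigma> powr (1 - b) / (1 - b))
      + ennreal c2 * ennreal (\<sigma> powr (1 - e2) / (1 - e2))"
      using b1 e2 \<sigma> nn_integral_powr_Ioc[of b T] nn_integral_powr_Ioc[of b \<sigma>]
      by (intro add_mono mult_left_mono nn_integral_powr_reflected) auto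
    also have "\<dots> = ennreal B"
      using c1 c2 C(1) \<eta>(1) b1 e2 by (simp add: B_def flip: ennreal_mult ennreal_plus)
    finally show ?thesis .
  qed
  have Lp: "Lp_norm p (\<lambda>x. \<integral>\<tau>. F \<tau> x \<partial>lborel) \<le> ennreal B"
    by (rule Lp_norm_integral_le[OF Fm mm m0 Fle Fz p mB B0])
  have Beq: "B = \<sigma> powr (- decay p) *
      (early_const * \<epsilon> powr (q - 1) * (C * (T / \<sigma>) powr ((1 - \<beta>) / 2) + \<eta>) + late_const r p * M powr (q - 1) * \<eta>)"
  proof -
    \<comment> \<open>Smoothing gives \<sigma>^(-e1) and integration \<sigma>^(1-b), together
      \<sigma>^(-decay p). So the \<eta> term carries no further power of \<sigma>, and the C term
      keeps (T/\<sigma>)^(1-b).\<close>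
    have 1: "\<sigma> powr (- e1) = \<sigma> powr (- decay p) / \<sigma> powr (1 - b)"
    proof -
      have "- e1 = - decay p - (1 - b)" by (simp add: e1_def b_def decay_def field_simps)
      then show ?thesis by (simp only: powr_diff)
    qed
    \<comment> \<open>The scaling identity turns q decay(r) into (n + \<beta> + 1 - n q/r)/2, and
      its dependence on r cancels that of e2.\<close>
    have 2: "\<sigma> powr (- q * decay (ennreal r)) * \<sigma> powr (1 - e2) = \<sigma> powr (- decay p)"
    proof -
      have "q * decay (ennreal r) = (q * (real CARD('n) + \<beta>) - real CARD('n) * (q / r)) / 2"
        using r1 by (simp add: decay_real field_simps)
      then have "- q * decay (ennreal r) + (1 - e2) = - decay p"
        using q_scaling by (simp add: e2_def decay_def field_simps)
      then show ?thesis by (simp only: powr_add[symmetric])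
    qed
    have 3: "(T / \<sigma>) powr ((1 - \<beta>) / 2) = T powr (1 - b) / \<sigma> powr (1 - b)"
      using \<sigma> by (simp add: powr_divide b_def field_simps)
    have 4: "(1 - \<beta>) / 2 = 1 - b" "1 / 2 - real CARD('n) / 2 * (q / r - enn2real (1 / p)) = 1 - e2"
      by (simp_all add: b_def e2_def field_simps)
    have 5: "c2 * (\<sigma> powr (1 - e2) / (1 - e2)) = \<sigma> powr (- decay p) * (late_const r p * M powr (q - 1) * \<eta>)"
      unfolding c2_def late_const_def 4 2[symmetric] A_def by (simp add: powr_mult)
    have 6: "c1 * C * (T powr (1 - b) / (1 - b)) + c1 * \<eta> * (\<sigma> powr (1 - b) / (1 - b))
      = \<sigma> powr (- decay p) * (early_const * \<epsilon> powr (q - 1) * (C * (T / \<sigma>) powr ((1 - \<beta>) / 2) + \<eta>))"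
      unfolding 3 c1_def early_const_def A_def 1 using \<sigma> by (simp add: powr_mult field_simps 4(1), simp add: add_divide_distrib)
    show ?thesis unfolding B_def 5 6 by (simp add: distrib_left)
  qed
  show ?thesis
  proof (rule that[of "\<lambda>x. \<integral>\<tau>. F \<tau> x \<partial>lborel"])
    show "(\<lambda>x. \<integral>\<tau>. F \<tau> x \<partial>lborel) \<in> borel_measurable lborel"
      using measurable_pair_swap[OF Fm]
      by (intro lborel.borel_measurable_lebesgue_integral) (simp add: case_prod_beta)
    show "(\<integral>\<tau>. F \<tau> x \<partial>lborel) = (LINT \<tau>:{0<..<2 * \<sigma>}|lborel. duhamel_integrand a q u (2 * \<sigma>) \<tau> x)
        - (LINT \<tau>:{0<..<2 * \<sigma>}|lborel. duhamel_integrand a q v (2 * \<sigma>) \<tau> x)"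
      if "set_integrable lborel {0<..<2 * \<sigma>} (\<lambda>\<tau>. duhamel_integrand a q u (2 * \<sigma>) \<tau> x)"
        "set_integrable lborel {0<..<2 * \<sigma>} (\<lambda>\<tau>. duhamel_integrand a q v (2 * \<sigma>) \<tau> x)" for x
      using that unfolding F_def set_integrable_def set_lebesgue_integral_def
      by (rule Bochner_Integration.integral_diff)
    show "Lp_norm p (\<lambda>x. \<integral>\<tau>. F \<tau> x \<partial>lborel) \<le> ennreal (\<sigma> powr (- decay p) *
      (early_const * \<epsilon> powr (q - 1) * (C * (T / \<sigma>) powr ((1 - \<beta>) / 2) + \<eta>) + late_const r p * M powr (q - 1) * \<eta>))"
      using Lp by (simp add: Beq)
  qed
qed

section \<open>Decay of solutions and of differences\<close>

lemma early_const_nonneg: "0 \<le> early_const"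
  using q_gt_1 beta by (simp add: early_const_def)

lemma late_const_nonneg:
  "real CARD('n) / 2 * (q / r - enn2real (1 / p)) < 1 / 2 \<Longrightarrow> 0 \<le> late_const r p"
  unfolding late_const_def using q_gt_1 by (intro divide_nonneg_nonneg mult_nonneg_nonneg) auto

text \<open>The integral equations are subtracted at time 2\<sigma>; the outer 2 is the constant of
  \<open>Lp_norm_add_le\<close>. Two regimes are intended: T fixed and \<sigma> large, where the C
  term decays, and T = 0, where it is absent because \<open>0 powr x\<close> is 0.\<close>

lemma difference_Lp_le:
  assumes u: "small_solution a \<beta> q \<epsilon> u0 u" and v: "small_solution a \<beta> q \<epsilon> v0 v"
    and p: "1 \<le> p" and r: "q \<le> r" and rp: "ennreal (r / q) \<le> p"
    and e: "real CARD('n) / 2 * (q / r - enn2real (1 / p)) < 1 / 2"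
    and M: "0 < M" "\<And>\<tau>. 0 < \<tau> \<Longrightarrow> Lp_norm (ennreal r) (u \<tau>) \<le> ennreal (M * \<tau> powr (- decay (ennreal r)))"
      "\<And>\<tau>. 0 < \<tau> \<Longrightarrow> Lp_norm (ennreal r) (v \<tau>) \<le> ennreal (M * \<tau> powr (- decay (ennreal r)))"
    and C: "0 < C" "\<And>\<tau>. 0 < \<tau> \<Longrightarrow> Lp_norm (ennreal q) (u \<tau> - v \<tau>) \<le> ennreal (C * \<tau> powr (- decay (ennreal q)))"
    and \<eta>: "0 < \<eta>"
      "\<And>\<tau>. 0 < \<tau> \<Longrightarrow> T \<le> \<tau> \<Longrightarrow> Lp_norm (ennreal q) (u \<tau> - v \<tau>) \<le> ennreal (\<eta> * \<tau> powr (- decay (ennreal q)))"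
      "\<And>\<tau>. 0 < \<tau> \<Longrightarrow> T \<le> \<tau> \<Longrightarrow> Lp_norm (ennreal r) (u \<tau> - v \<tau>) \<le> ennreal (\<eta> * \<tau> powr (- decay (ennreal r)))"
    and \<sigma>: "0 < \<sigma>" "0 \<le> T" "T \<le> \<sigma>"
    and N: "0 \<le> N" "Lp_norm 1 (heat \<sigma> (u0 - v0)) \<le> ennreal N"
  shows "Lp_norm p (u (2 * \<sigma>) - v (2 * \<sigma>)) \<le> ennreal (2 * \<sigma> powr (- decay p) * (\<sigma> powr (\<beta> / 2) * N
      + (early_const * \<epsilon> powr (q - 1) * (C * (T / \<sigma>) powr ((1 - \<beta>) / 2) + \<eta>) + late_const r p * M powr (q - 1) * \<eta>)))"
proof -
  obtain h where h: "h \<in> borel_measurable lborel"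
    "AE x in lborel. heat (2 * \<sigma>) u0 x - heat (2 * \<sigma>) v0 x = h x"
    "Lp_norm p h \<le> ennreal (\<sigma> powr (- decay p) * (\<sigma> powr (\<beta> / 2) * N))"
    using heat_initial_data_difference[OF u v \<sigma>(1) p N] .
  obtain I where I: "I \<in> borel_measurable lborel"
    "\<And>x. set_integrable lborel {0<..<2 * \<sigma>} (\<lambda>\<tau>. duhamel_integrand a q u (2 * \<sigma>) \<tau> x) \<Longrightarrow>
      set_integrable lborel {0<..<2 * \<sigma>} (\<lambda>\<tau>. duhamel_integrand a q v (2 * \<sigma>) \<tau> x) \<Longrightarrow>
      I x = (LINT \<tau>:{0<..<2 * \<sigma>}|lborel. duhamel_integrand a q u (2 * \<sigma>) \<tau> x)
        - (LINT \<tau>:{0<..<2 * \<sigma>}|lborel. duhamel_integrand a q v (2 * \<sigma>) \<tau> x)"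
    "Lp_norm p I \<le> ennreal (\<sigma> powr (- decay p) *
      (early_const * \<epsilon> powr (q - 1) * (C * (T / \<sigma>) powr ((1 - \<beta>) / 2) + \<eta>) + late_const r p * M powr (q - 1) * \<eta>))"
    using duhamel_difference_integral_Lp_le[OF u v p r rp e M C \<eta> \<sigma>] by blast
  have mild: "AE x in lborel. set_integrable lborel {0<..<2 * \<sigma>} (\<lambda>\<tau>. duhamel_integrand a q w (2 * \<sigma>) \<tau> x) \<and>
      w (2 * \<sigma>) x = heat (2 * \<sigma>) w0 x - (LINT \<tau>:{0<..<2 * \<sigma>}|lborel. duhamel_integrand a q w (2 * \<sigma>) \<tau> x)"
    if "small_solution a \<beta> q \<epsilon> w0 w" for w0 w
    using that \<sigma>(1) unfolding small_solution_def mild_solution_def by auto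
  have AE: "AE x in lborel. (u (2 * \<sigma>) - v (2 * \<sigma>)) x = h x - I x"
    using mild[OF u] mild[OF v] h(2)
  proof eventually_elim
    case (elim x)
    then show ?case using I(2)[of x] by simp
  qed
  have um: "u (2 * \<sigma>) \<in> borel_measurable lborel" "v (2 * \<sigma>) \<in> borel_measurable lborel"
    using small_solution_Lp_space(1)[OF u, of "2 * \<sigma>"] small_solution_Lp_space(1)[OF v, of "2 * \<sigma>"] \<sigma> by auto
  have nn: "0 \<le> \<sigma> powr (- decay p) * (\<sigma> powr (\<beta> / 2) * N)"
    "0 \<le> \<sigma> powr (- decay p) *
      (early_const * \<epsilon> powr (q - 1) * (C * (T / \<sigma>) powr ((1 - \<beta>) / 2) + \<eta>) + late_const r p * M powr (q - 1) * \<eta>)"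
    using N C(1) \<eta>(1) early_const_nonneg late_const_nonneg[OF e]
    by (auto intro!: mult_nonneg_nonneg add_nonneg_nonneg)
  have "Lp_norm p (u (2 * \<sigma>) - v (2 * \<sigma>)) = Lp_norm p (\<lambda>x. h x - I x)"
    using um h(1) I(1) AE by (intro Lp_norm_cong_AE) (auto simp: fun_diff_def)
  also have "\<dots> \<le> ennreal (2 * (\<sigma> powr (- decay p) * (\<sigma> powr (\<beta> / 2) * N) + \<sigma> powr (- decay p) *
      (early_const * \<epsilon> powr (q - 1) * (C * (T / \<sigma>) powr ((1 - \<beta>) / 2) + \<eta>) + late_const r p * M powr (q - 1) * \<eta>)))"
    using h(1) I(1) nn by (intro Lp_norm_add_le[OF _ _ p h(3) I(3)]) auto
  finally show ?thesis by (simp only: distrib_left mult.assoc)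
qed

text \<open>Subtracting the zero solution changes nothing, so every estimate for differences is also
  an estimate for a single solution.\<close>

lemma small_solution_zero:
  assumes "0 < \<epsilon>"
  shows "small_solution a \<beta> q \<epsilon> (\<lambda>_. 0) (\<lambda>_ _. 0)"
proof -
  have d: "distribution_of (\<lambda>_. 0) = (\<lambda>_ :: real ^ 'n \<Rightarrow> real. 0)"
    by (simp add: distribution_of_def fun_eq_iff)
  have hz: "heat t (\<lambda>_. 0) = (\<lambda>_ :: real ^ 'n. 0)" for t
    by (simp add: heat_def fun_eq_iff)
  have L1: "Lp_norm 1 (\<lambda>_ :: real ^ 'n. 0) = 0"
    by (simp add: Lp_norm_1_eq)
  have Lq: "Lp_norm (ennreal q) (\<lambda>_ :: real ^ 'n. 0) = 0"
    using Lp_norm_le_iff[of q 0 "\<lambda>_ :: real ^ 'n. 0"] q_gt_1 by simp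
  have b: "besov_norm \<beta> (\<lambda>_ :: real ^ 'n \<Rightarrow> real. 0) = 0"
    by (simp add: besov_norm_def hz L1)
  have tr: "trajectory (\<lambda>_. 0) (\<lambda>_ _. 0) t = (\<lambda>_ :: real ^ 'n \<Rightarrow> real. 0)" for t
    by (simp add: trajectory_def d)
  have te: "(\<lambda>_ :: real ^ 'n \<Rightarrow> real. 0) \<in> tempered"
    unfolding tempered_def by (auto intro: exI[of _ 0])
  have gz: "grad (\<lambda>_. 0) x = (0 :: real ^ 'n)" for x :: "real ^ 'n"
    by (simp add: grad_def partial_def frechet_derivative_const vec_eq_iff)
  have X: "in_X \<beta> q (\<lambda>_. 0) (\<lambda>_ _ :: real ^ 'n. 0)"
    unfolding in_X_def weighted_sup_norm_def Lp_space_def besov_def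
    by (simp add: tr te b fun_diff_def Lq)
  have m: "mild_solution a q (\<lambda>_. 0) (\<lambda>_ _ :: real ^ 'n. 0)"
    unfolding mild_solution_def duhamel_integrand_def
    by (simp add: d hz gz set_integrable_def set_lebesgue_integral_def)
  show ?thesis
    unfolding small_solution_def weighted_sup_norm_def besov_def
    using X m te b Lq assms by (simp add: ennreal_lessI)
qed

section \<open>Decay of a single solution in higher Lebesgue norms\<close>

text \<open>Half of the gap between 1/n and q - 1 = 1/(n+\<beta>); the other half keeps the late
  singularity strictly integrable.\<close>

definition exponent_gain :: real where
  "exponent_gain = (1 / real CARD('n) - 1 / (real CARD('n) + \<beta>)) / 2"

lemma exponent_gain_pos: "0 < exponent_gain"
  using beta dim_ge_1 by (simp add: exponent_gain_def frac_less2)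

text \<open>Since \<open>q - 1 < 1/n\<close>, one passage through the integral equation lowers \<open>1/p\<close> by the fixed
  amount \<open>exponent_gain\<close>, so finitely many passages lead from \<open>q\<close> to any exponent, including \<open>\<infinity>\<close>.\<close>

lemma source_exponent:
  assumes p: "1 \<le> p"
  obtains r where "q \<le> r" "ennreal (r / q) \<le> p"
    "real CARD('n) / 2 * (q / r - enn2real (1 / p)) < 1 / 2"
    "1 / r = min (1 / q) (enn2real (1 / p) + exponent_gain)"
proof -
  define x where "x = enn2real (1 / p)"
  \<comment> \<open>This is 1/r: raised above 1/p by the gain, but capped at 1/q so that r \<ge>
    q.\<close>
  define y where "y = min (1 / q) (x + exponent_gain)"
  have x0: "0 \<le> x" by (simp add: x_def)
  have y0: "0 < y" using x0 exponent_gain_pos q_gt_1 by (simp add: y_def)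
  have yq: "y \<le> 1 / q" by (simp add: y_def)
  have y1: "y \<le> 1" using yq q_gt_1 by (smt (verit) divide_le_eq_1_pos)
  have n: "0 < real CARD('n)" using dim_ge_1 by linarith
  have 1: "q \<le> 1 / y" using yq y0 q_gt_1 by (simp add: field_simps)
  have 2: "ennreal (1 / y / q) \<le> p"
    using p
  proof (cases rule: enn2real_exponent_cases)
    case (2 s)
    have "1 / s \<le> q * y"
    proof (cases "y = 1 / q")
      case True
      then show ?thesis using 2 q_gt_1 by simp
    next
      case False
      then have "y = x + exponent_gain" by (auto simp: y_def min_def split: if_splits)
      then have "1 / s \<le> y" using 2 exponent_gain_pos by (simp add: x_def)
      also have "\<dots> \<le> q * y" using y0 q_gt_1 by simp
      finally show ?thesis .
    qed
    then have "1 / y / q \<le> s" using 2 y0 q_gt_1 by (simp add: field_simps)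
    then show ?thesis using 2 by (simp add: ennreal_leI)
  qed simp
  have 3: "real CARD('n) / 2 * (q / (1 / y) - x) < 1 / 2"
  proof -
    \<comment> \<open>The nonlinearity costs at most q - 1 and the passage gains at most
      \<open>exponent_gain\<close>; the sum is 1/n minus the gain, below the critical 1/n.\<close>
    have "q * y - x = (q - 1) * y + (y - x)" by (simp add: algebra_simps)
    also have "\<dots> \<le> (q - 1) * 1 + exponent_gain"
      using y1 q_gt_1 by (intro add_mono mult_left_mono) (auto simp: y_def)
    also have "\<dots> = 1 / real CARD('n) - exponent_gain"
      by (simp add: q_eq exponent_gain_def field_simps)
    also have "\<dots> < 1 / real CARD('n)" using exponent_gain_pos by simp
    finally have "real CARD('n) * (q * y - x) < real CARD('n) * (1 / real CARD('n))"
      using n by (intro mult_strict_left_mono) auto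
    then show ?thesis using n by simp
  qed
  show ?thesis
    using that[of "1 / y"] 1 2 3 by (simp add: x_def y_def)
qed

text \<open>Comparison with the zero solution turns an L^s bound into an L^r bound with 1/r lower by
  up to \<open>exponent_gain\<close>, and no constant has to be small for this; k counts such
  passages starting from q. The resulting bounds are the M of the difference estimates.\<close>

lemma small_solution_decay_aux:
  assumes u: "small_solution a \<beta> q \<epsilon> u0 u"
  shows "q \<le> r \<Longrightarrow> 1 / q - real k * exponent_gain \<le> 1 / r \<Longrightarrow>
    \<exists>M>0. \<forall>t>0. Lp_norm (ennreal r) (u t) \<le> ennreal (M * t powr (- decay (ennreal r)))"
proof (induction k arbitrary: r)
  case 0
  then have "r = q" using q_gt_1 by (simp add: field_simps)
  then show ?case
    using small_solution_Lq_le[OF u] small_solution_eps_pos[OF u] by (intro exI[of _ "2 * \<epsilon>"]) auto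
next
  case (Suc k)
  have r1: "1 \<le> r" using Suc.prems q_gt_1 by simp
  then have p: "1 \<le> ennreal r" by simp
  note \<epsilon> = small_solution_eps_pos[OF u]
  obtain s where s: "q \<le> s" "ennreal (s / q) \<le> ennreal r"
    "real CARD('n) / 2 * (q / s - enn2real (1 / ennreal r)) < 1 / 2"
    "1 / s = min (1 / q) (enn2real (1 / ennreal r) + exponent_gain)"
    using source_exponent[OF p] .
  have "1 / q - real k * exponent_gain \<le> 1 / s"
    using Suc.prems(2) exponent_gain_pos r1 unfolding s(4) by (simp add: enn2real_one_div algebra_simps)
  then obtain M where M: "0 < M" "\<And>t. 0 < t \<Longrightarrow> Lp_norm (ennreal s) (u t) \<le> ennreal (M * t powr (- decay (ennreal s)))"
    using Suc.IH[OF s(1)] by auto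
  define \<eta> where "\<eta> = max (2 * \<epsilon>) M"
  have \<eta>: "0 < \<eta>" "2 * \<epsilon> \<le> \<eta>" "M \<le> \<eta>" using M by (auto simp: \<eta>_def)
  have qz: "Lp_norm (ennreal p) (\<lambda>_ :: real ^ 'n. 0) \<le> ennreal B" if "1 \<le> p" "0 \<le> B" for p B
    using Lp_norm_le_iff[of p B "\<lambda>_ :: real ^ 'n. 0"] that by simp
  define c where "c = \<epsilon> + (early_const * \<epsilon> powr (q - 1) * \<eta> + late_const s (ennreal r) * M powr (q - 1) * \<eta>)"
  have c: "0 < c"
    using \<epsilon> \<eta>(1) early_const_nonneg late_const_nonneg[OF s(3)]
    by (auto simp: c_def intro!: add_pos_nonneg)
  have zero: "w - (\<lambda>_. 0) = w" for w :: "'c \<Rightarrow> real" by (simp add: fun_eq_iff)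
  show ?case
  proof (intro exI conjI allI impI)
    show "0 < 2 * 2 powr decay (ennreal r) * c" using c by simp
    fix t :: real assume t: "0 < t"
    define \<sigma> where "\<sigma> = t / 2"
    have \<sigma>: "0 < \<sigma>" "t = 2 * \<sigma>" using t by (auto simp: \<sigma>_def)
    have mono: "ennreal (x * \<tau> powr y) \<le> ennreal (\<eta> * \<tau> powr y)" if "x \<le> \<eta>" for x y \<tau> :: real
      using that by (intro ennreal_leI mult_right_mono) auto
    \<comment> \<open>With T = 0 the bound \<eta> is asked for at all positive times, where the
      global bounds supply it, and the constant C = 2 \<epsilon> gets the factor 0.\<close>
    have "Lp_norm (ennreal r) (u (2 * \<sigma>) - (\<lambda>_. 0)) \<le> ennreal (2 * \<sigma> powr (- decay (ennreal r)) *
      (\<sigma> powr (\<beta> / 2) * (\<sigma> powr (- (\<beta> / 2)) * \<epsilon>)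
      + (early_const * \<epsilon> powr (q - 1) * (2 * \<epsilon> * (0 / \<sigma>) powr ((1 - \<beta>) / 2) + \<eta>) + late_const s (ennreal r) * M powr (q - 1) * \<eta>)))"
      using \<sigma> s M \<eta> \<epsilon> p q_gt_1 small_solution_Lq_le[OF u] small_solution_heat_L1_le[OF u]
        order_trans[OF small_solution_Lq_le[OF u] mono[OF \<eta>(2)]] order_trans[OF M(2) mono[OF \<eta>(3)]]
      by (intro difference_Lp_le[OF u small_solution_zero[OF \<epsilon>] p s(1-3), of M]) (auto simp: zero intro!: qz)
    also have "\<sigma> powr (\<beta> / 2) * (\<sigma> powr (- (\<beta> / 2)) * \<epsilon>) = \<epsilon>"
      using \<sigma> by (simp add: powr_minus)
    also have "2 * \<epsilon> * (0 / \<sigma>) powr ((1 - \<beta>) / 2) + \<eta> = \<eta>" by simp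
    also have "\<sigma> powr (- decay (ennreal r)) = 2 powr decay (ennreal r) * t powr (- decay (ennreal r))"
      using t by (simp add: \<sigma>_def powr_divide powr_minus field_simps)
    finally show "Lp_norm (ennreal r) (u t) \<le> ennreal (2 * 2 powr decay (ennreal r) * c * t powr (- decay (ennreal r)))"
      by (simp add: zero \<sigma>(2) c_def mult_ac)
  qed
qed

lemma small_solution_decay:
  assumes u: "small_solution a \<beta> q \<epsilon> u0 u" and r: "q \<le> r"
  obtains M where "0 < M" "\<And>t. 0 < t \<Longrightarrow> Lp_norm (ennreal r) (u t) \<le> ennreal (M * t powr (- decay (ennreal r)))"
proof -
  obtain k :: nat where "(1 / q) / exponent_gain \<le> real k" using real_arch_simple by blast
  then have "1 / q - real k * exponent_gain \<le> 0"
    using pos_divide_le_eq[OF exponent_gain_pos, of "1 / q" "real k"] by linarith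
  also have "0 \<le> 1 / r" using r q_gt_1 by simp
  finally show ?thesis using small_solution_decay_aux[OF u r] that by blast
qed

lemma small_solutions_decay:
  assumes "small_solution a \<beta> q \<epsilon> u0 u" "small_solution a \<beta> q \<epsilon> v0 v" "q \<le> r"
  obtains M where "0 < M" "\<And>t. 0 < t \<Longrightarrow> Lp_norm (ennreal r) (u t) \<le> ennreal (M * t powr (- decay (ennreal r)))"
    "\<And>t. 0 < t \<Longrightarrow> Lp_norm (ennreal r) (v t) \<le> ennreal (M * t powr (- decay (ennreal r)))"
proof -
  obtain M1 where M1: "0 < M1" "\<And>t. 0 < t \<Longrightarrow> Lp_norm (ennreal r) (u t) \<le> ennreal (M1 * t powr (- decay (ennreal r)))"
    using small_solution_decay[OF assms(1,3)] by blast
  obtain M2 where M2: "0 < M2" "\<And>t. 0 < t \<Longrightarrow> Lp_norm (ennreal r) (v t) \<le> ennreal (M2 * t powr (- decay (ennreal r)))"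
    using small_solution_decay[OF assms(2,3)] by blast
  have mono: "ennreal (x * t powr y) \<le> ennreal (max M1 M2 * t powr y)" if "x \<le> max M1 M2" for x y t :: real
    using that by (intro ennreal_leI mult_right_mono) auto
  show ?thesis
  proof (rule that[of "max M1 M2"])
    show "Lp_norm (ennreal r) (u t) \<le> ennreal (max M1 M2 * t powr (- decay (ennreal r)))" if "0 < t" for t
      using order_trans[OF M1(2)[OF that] mono] by simp
    show "Lp_norm (ennreal r) (v t) \<le> ennreal (max M1 M2 * t powr (- decay (ennreal r)))" if "0 < t" for t
      using order_trans[OF M2(2)[OF that] mono] by simp
  qed (use M1 in simp)
qed

section \<open>Asymptotic vanishing of the difference\<close>

lemma difference_Lq_le:
  assumes u: "small_solution a \<beta> q \<epsilon> u0 u" and v: "small_solution a \<beta> q \<epsilon> v0 v" and t: "0 < t"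
  shows "Lp_norm (ennreal q) (u t - v t) \<le> ennreal (8 * \<epsilon> * t powr (- decay (ennreal q)))"
proof -
  have "Lp_norm (ennreal q) (u t - v t)
      \<le> ennreal (2 * (2 * \<epsilon> * t powr (- decay (ennreal q)) + 2 * \<epsilon> * t powr (- decay (ennreal q))))"
    using small_solution_Lp_space(1)[OF u t] small_solution_Lp_space(1)[OF v t] q_gt_1 small_solution_eps_pos[OF u]
    by (intro Lp_norm_add_le[OF _ _ _ small_solution_Lq_le[OF u t] small_solution_Lq_le[OF v t]])
      (auto simp: fun_diff_def)
  then show ?thesis by (simp add: algebra_simps)
qed

definition vanishing :: "(real \<Rightarrow> real ^ 'n \<Rightarrow> real) \<Rightarrow> ennreal \<Rightarrow> bool" where
  "vanishing w p \<longleftrightarrow> (\<forall>e>0. \<exists>T>0. \<forall>t\<ge>T. Lp_norm p (w t) \<le> ennreal (e * t powr (- decay p)))"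

context
  fixes \<epsilon> :: real and u0 v0 :: "(real ^ 'n \<Rightarrow> real) \<Rightarrow> real" and u v :: "real \<Rightarrow> real ^ 'n \<Rightarrow> real"
  assumes u: "small_solution a \<beta> q \<epsilon> u0 u" and v: "small_solution a \<beta> q \<epsilon> v0 v"
    and lim: "((\<lambda>t. ennreal (t powr (\<beta> / 2)) * Lp_norm 1 (heat t (u0 - v0))) \<longlongrightarrow> 0) at_top"
begin

lemma heat_difference_vanishes:
  assumes "0 < e"
  obtains S where "0 < S" "\<And>\<sigma>. S \<le> \<sigma> \<Longrightarrow> Lp_norm 1 (heat \<sigma> (u0 - v0)) \<le> ennreal (e * \<sigma> powr (- (\<beta> / 2)))"
proof -
  have "\<forall>\<^sub>F t in at_top. ennreal (t powr (\<beta> / 2)) * Lp_norm 1 (heat t (u0 - v0)) < ennreal e"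
    using lim assms ennreal_lessI[of e 0] by (intro order_tendstoD(2)[of _ 0]) simp_all
  then obtain S where S: "\<And>t. S \<le> t \<Longrightarrow> ennreal (t powr (\<beta> / 2)) * Lp_norm 1 (heat t (u0 - v0)) < ennreal e"
    by (auto simp: eventually_at_top_linorder)
  show ?thesis
  proof (rule that[of "max S 1"])
    fix \<sigma> :: real assume \<sigma>: "max S 1 \<le> \<sigma>"
    have "ennreal (\<sigma> powr (- (\<beta> / 2))) * (ennreal (\<sigma> powr (\<beta> / 2)) * Lp_norm 1 (heat \<sigma> (u0 - v0)))
       \<le> ennreal (\<sigma> powr (- (\<beta> / 2))) * ennreal e"
      using S[of \<sigma>] \<sigma> by (intro mult_left_mono) auto
    also have "ennreal (\<sigma> powr (- (\<beta> / 2))) * (ennreal (\<sigma> powr (\<beta> / 2)) * Lp_norm 1 (heat \<sigma> (u0 - v0))) = Lp_norm 1 (heat \<sigma> (u0 - v0))"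
      using \<sigma> by (simp add: powr_minus flip: mult.assoc ennreal_mult)
    finally show "Lp_norm 1 (heat \<sigma> (u0 - v0)) \<le> ennreal (e * \<sigma> powr (- (\<beta> / 2)))"
      by (simp add: mult.commute flip: ennreal_mult'')
  qed simp
qed

text \<open>The contributions without \<eta> drop below any e: the datum term by the hypothesis on
  u0 - v0, that of times before T because (T/\<sigma>)^((1-\<beta>)/2) tends to 0. What remains is a
  fixed multiple of \<eta>.\<close>

lemma difference_eventually_le:
  assumes p: "1 \<le> p" and r: "q \<le> r" and rp: "ennreal (r / q) \<le> p"
    and ex: "real CARD('n) / 2 * (q / r - enn2real (1 / p)) < 1 / 2"
    and M: "0 < M" "\<And>\<tau>. 0 < \<tau> \<Longrightarrow> Lp_norm (ennreal r) (u \<tau>) \<le> ennreal (M * \<tau> powr (- decay (ennreal r)))"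
      "\<And>\<tau>. 0 < \<tau> \<Longrightarrow> Lp_norm (ennreal r) (v \<tau>) \<le> ennreal (M * \<tau> powr (- decay (ennreal r)))"
    and \<eta>: "0 < \<eta>" and T: "0 < T"
      "\<And>\<tau>. T \<le> \<tau> \<Longrightarrow> Lp_norm (ennreal q) (u \<tau> - v \<tau>) \<le> ennreal (\<eta> * \<tau> powr (- decay (ennreal q)))"
      "\<And>\<tau>. T \<le> \<tau> \<Longrightarrow> Lp_norm (ennreal r) (u \<tau> - v \<tau>) \<le> ennreal (\<eta> * \<tau> powr (- decay (ennreal r)))"
    and e: "0 < e"
  obtains T' where "0 < T'" "\<And>t. T' \<le> t \<Longrightarrow> Lp_norm p (u t - v t)
    \<le> ennreal ((e + 2 * 2 powr decay p * (early_const * \<epsilon> powr (q - 1) + late_const r p * M powr (q - 1)) * \<eta>)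
        * t powr (- decay p))"
proof -
  note \<epsilon> = small_solution_eps_pos[OF u]
  define k where "k = early_const * \<epsilon> powr (q - 1)"
  have k: "0 \<le> k" using early_const_nonneg by (simp add: k_def)
  \<comment> \<open>The datum term will be at most e' and the early term k e'; 2^(decay p) arises
    when \<sigma> = t/2 is replaced by t. The scaling makes the total exactly e.\<close>
  define e' where "e' = e / (2 * 2 powr decay p * (1 + k))"
  have e': "0 < e'" using e k by (simp add: e'_def)
  have ee: "2 * 2 powr decay p * (e' + k * e') = e"
  proof -
    have "2 * 2 powr decay p * (1 + k) \<noteq> 0" using k by auto
    then have "2 * 2 powr decay p * (1 + k) * e' = e" 
      unfolding e'_def by (metis nonzero_mult_div_cancel_left times_divide_eq_right)
    then show ?thesis by (simp add: algebra_simps)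
  qed
  obtain S where S: "0 < S" "\<And>\<sigma>. S \<le> \<sigma> \<Longrightarrow> Lp_norm 1 (heat \<sigma> (u0 - v0)) \<le> ennreal (e' * \<sigma> powr (- (\<beta> / 2)))"
    using heat_difference_vanishes[OF e'] by blast
  have nn: "\<forall>\<^sub>F \<sigma> in at_top. 0 \<le> T / \<sigma>"
    using T(1) by (intro eventually_mono[OF eventually_gt_at_top[of "0 :: real"]]) simp
  have "((\<lambda>\<sigma>. 8 * \<epsilon> * (T / \<sigma>) powr ((1 - \<beta>) / 2)) \<longlongrightarrow> 8 * \<epsilon> * 0 powr ((1 - \<beta>) / 2)) at_top"
    using nn beta
    by (intro tendsto_intros tendsto_powr' real_tendsto_divide_at_top[of _ T] tendsto_const filterlim_ident) auto
  then have "\<forall>\<^sub>F \<sigma> in at_top. 8 * \<epsilon> * (T / \<sigma>) powr ((1 - \<beta>) / 2) < e'"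
    using e' by (intro order_tendstoD(2)) auto
  then obtain S2 where S2: "\<And>\<sigma>. S2 \<le> \<sigma> \<Longrightarrow> 8 * \<epsilon> * (T / \<sigma>) powr ((1 - \<beta>) / 2) < e'"
    by (auto simp: eventually_at_top_linorder)
  define T' where "T' = 2 * Max {S, S2, T}"
  show ?thesis
  proof (rule that[of T'])
    show "0 < T'" using S(1) by (simp add: T'_def less_max_iff_disj)
    fix t assume t: "T' \<le> t"
    define \<sigma> where "\<sigma> = t / 2"
    have \<sigma>: "S \<le> \<sigma>" "S2 \<le> \<sigma>" "T \<le> \<sigma>" "0 < \<sigma>" "t = 2 * \<sigma>" "0 < t"
      using t S(1) by (auto simp: T'_def \<sigma>_def)
    have "Lp_norm p (u (2 * \<sigma>) - v (2 * \<sigma>)) \<le> ennreal (2 * \<sigma> powr (- decay p) * (\<sigma> powr (\<beta> / 2) * (e' * \<sigma> powr (- (\<beta> / 2)))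
      + (early_const * \<epsilon> powr (q - 1) * (8 * \<epsilon> * (T / \<sigma>) powr ((1 - \<beta>) / 2) + \<eta>) + late_const r p * M powr (q - 1) * \<eta>)))"
      using \<sigma> S e' \<epsilon> T(1) \<eta>
      by (intro difference_Lp_le[OF u v p r rp ex M _ difference_Lq_le[OF u v] \<eta> T(2,3)]) auto
    also have "\<dots> \<le> ennreal (2 * \<sigma> powr (- decay p) * (e' + (k * (e' + \<eta>) + late_const r p * M powr (q - 1) * \<eta>)))"
    proof -
      have 1: "\<sigma> powr (\<beta> / 2) * (e' * \<sigma> powr (- (\<beta> / 2))) \<le> e'"
        using \<sigma>(4) by (simp add: powr_minus field_simps)
      have 2: "k * (8 * \<epsilon> * (T / \<sigma>) powr ((1 - \<beta>) / 2) + \<eta>) \<le> k * (e' + \<eta>)"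
        using S2[OF \<sigma>(2)] k by (intro mult_left_mono) auto
      show ?thesis
        unfolding k_def[symmetric] by (intro ennreal_leI mult_left_mono add_mono 1 2 order_refl) auto
    qed
    also have "2 * \<sigma> powr (- decay p) * (e' + (k * (e' + \<eta>) + late_const r p * M powr (q - 1) * \<eta>))
      = (2 * 2 powr decay p * (e' + k * e') + 2 * 2 powr decay p * (k + late_const r p * M powr (q - 1)) * \<eta>) * t powr (- decay p)"
    proof -
      have "\<sigma> powr (- decay p) = 2 powr decay p * t powr (- decay p)"
        using \<sigma>(6) by (simp add: \<sigma>_def powr_divide powr_minus field_simps)
      then show ?thesis by (simp add: algebra_simps)
    qed
    finally show "Lp_norm p (u t - v t)
      \<le> ennreal ((e + 2 * 2 powr decay p * (early_const * \<epsilon> powr (q - 1) + late_const r p * M powr (q - 1)) * \<eta>)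
          * t powr (- decay p))"
      unfolding k_def[symmetric] ee \<sigma>(5)[symmetric] .
  qed
qed

text \<open>No contraction is involved: vanishing at q and r lets \<eta> be chosen after the factor
  K, however large K is.\<close>

lemma vanishing_step:
  assumes p: "1 \<le> p" and r: "q \<le> r" and rp: "ennreal (r / q) \<le> p"
    and ex: "real CARD('n) / 2 * (q / r - enn2real (1 / p)) < 1 / 2"
    and vq: "vanishing (\<lambda>t. u t - v t) (ennreal q)" and vr: "vanishing (\<lambda>t. u t - v t) (ennreal r)"
  shows "vanishing (\<lambda>t. u t - v t) p"
  unfolding vanishing_def
proof (intro allI impI)
  fix e :: real assume e: "0 < e"
  obtain M where M: "0 < M" "\<And>t. 0 < t \<Longrightarrow> Lp_norm (ennreal r) (u t) \<le> ennreal (M * t powr (- decay (ennreal r)))"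
    "\<And>t. 0 < t \<Longrightarrow> Lp_norm (ennreal r) (v t) \<le> ennreal (M * t powr (- decay (ennreal r)))"
    using small_solutions_decay[OF u v r] by blast
  define K where "K = 2 * 2 powr decay p * (early_const * \<epsilon> powr (q - 1) + late_const r p * M powr (q - 1))"
  have K: "0 \<le> K" using early_const_nonneg late_const_nonneg[OF ex] by (simp add: K_def)
  define \<eta> where "\<eta> = e / (2 * (K + 1))"
  have \<eta>: "0 < \<eta>" using e K by (simp add: \<eta>_def)
  obtain T1 where T1: "0 < T1" "\<And>t. T1 \<le> t \<Longrightarrow> Lp_norm (ennreal q) (u t - v t) \<le> ennreal (\<eta> * t powr (- decay (ennreal q)))"
    using vq \<eta> unfolding vanishing_def by blast
  obtain T2 where T2: "0 < T2" "\<And>t. T2 \<le> t \<Longrightarrow> Lp_norm (ennreal r) (u t - v t) \<le> ennreal (\<eta> * t powr (- decay (ennreal r)))"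
    using vr \<eta> unfolding vanishing_def by blast
  have e2: "0 < e / 2" using e by simp
  have T0: "0 < max T1 T2" using T1 by simp
  obtain T' where T': "0 < T'" "\<And>t. T' \<le> t \<Longrightarrow> Lp_norm p (u t - v t) \<le> ennreal ((e / 2 + K * \<eta>) * t powr (- decay p))"
    unfolding K_def
    by (rule difference_eventually_le[OF p r rp ex M \<eta> T0 _ _ e2]) (use T1 T2 in auto)
  have "K * \<eta> \<le> e / 2" using K e by (simp add: \<eta>_def field_simps)
  then have "ennreal ((e / 2 + K * \<eta>) * t powr (- decay p)) \<le> ennreal (e * t powr (- decay p))" for t
    by (intro ennreal_leI mult_right_mono) auto
  then show "\<exists>T>0. \<forall>t\<ge>T. Lp_norm p (u t - v t) \<le> ennreal (e * t powr (- decay p))"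
    using T' order_trans by blast
qed

text \<open>With r = p = q the estimate bounds a norm by itself. Since M = 2 \<epsilon> is
  admissible there, its factor is of order \<epsilon>^(q-1); a factor 1/4 and a slack of \<eta>/4
  turn an eventual bound \<eta> into \<eta>/2.\<close>

lemma vanishing_q:
  assumes small: "2 * 2 powr decay (ennreal q) * (early_const * \<epsilon> powr (q - 1) + late_const q (ennreal q) * (2 * \<epsilon>) powr (q - 1)) \<le> 1 / 4"
    (is "?K \<le> _")
  shows "vanishing (\<lambda>t. u t - v t) (ennreal q)"
proof -
  note \<epsilon> = small_solution_eps_pos[OF u]
  \<comment> \<open>This says n (q - 1) < q; since q - 1 = 1/(n+\<beta>), even n (q - 1) <
    1.\<close>
  have ex: "real CARD('n) / 2 * (q / q - enn2real (1 / ennreal q)) < 1 / 2"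
  proof -
    have "real CARD('n) * (q - 1) < q" using q_scaling q_gt_1 beta
      by (simp add: algebra_simps) (smt (verit) mult_less_cancel_left2 mult_pos_pos)
    then show ?thesis using q_gt_1 by (simp add: enn2real_one_div field_simps)
  qed
  define w where "w t = u t - v t" for t
  have halving: "\<exists>T>0. \<forall>t\<ge>T. Lp_norm (ennreal q) (w t) \<le> ennreal (8 * \<epsilon> / 2 ^ k * t powr (- decay (ennreal q)))" for k
  proof (induction k)
    case 0
    have "Lp_norm (ennreal q) (w t) \<le> ennreal (8 * \<epsilon> / 2 ^ 0 * t powr (- decay (ennreal q)))" if "1 \<le> t" for t
      unfolding w_def power_0 div_by_1 using that by (intro difference_Lq_le[OF u v]) simp
    then show ?case using zero_less_one by blast
  next
    case (Suc k)
    define \<eta> where "\<eta> = 8 * \<epsilon> / 2 ^ k"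
    have \<eta>: "0 < \<eta>" "0 < \<eta> / 4" using \<epsilon> by (auto simp: \<eta>_def)
    obtain T where T: "0 < T" "\<And>t. T \<le> t \<Longrightarrow> Lp_norm (ennreal q) (w t) \<le> ennreal (\<eta> * t powr (- decay (ennreal q)))"
      using Suc unfolding \<eta>_def by auto
    have q1: "1 \<le> ennreal q" "ennreal (q / q) \<le> ennreal q" "0 < 2 * \<epsilon>" using q_gt_1 \<epsilon> by simp_all
    obtain T' where T': "0 < T'" "\<And>t. T' \<le> t \<Longrightarrow> Lp_norm (ennreal q) (w t) \<le> ennreal ((\<eta> / 4 + ?K * \<eta>) * t powr (- decay (ennreal q)))"
      using difference_eventually_le[OF q1(1) order_refl q1(2) ex q1(3) small_solution_Lq_le[OF u] small_solution_Lq_le[OF v],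
          folded w_def, OF _ _ \<eta>(1) T(1) T(2) T(2) \<eta>(2)] by blast
    have "?K * \<eta> \<le> 1 / 4 * \<eta>" using small \<eta> by (intro mult_right_mono) auto
    then have "\<eta> / 4 + ?K * \<eta> \<le> 8 * \<epsilon> / 2 ^ Suc k" by (simp add: \<eta>_def)
    then have "ennreal ((\<eta> / 4 + ?K * \<eta>) * t powr (- decay (ennreal q))) \<le> ennreal (8 * \<epsilon> / 2 ^ Suc k * t powr (- decay (ennreal q)))" for t
      by (intro ennreal_leI mult_right_mono) auto
    then show ?case using T' order_trans by blast
  qed
  show ?thesis
    unfolding vanishing_def w_def[symmetric]
  proof (intro allI impI)
    fix e :: real assume e: "0 < e"
    obtain k where "(1 / 2) ^ k < e / (8 * \<epsilon>)"
      using real_arch_pow_inv[of "e / (8 * \<epsilon>)" "1 / 2"] e \<epsilon> by auto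
    then have "8 * \<epsilon> / 2 ^ k \<le> e" using \<epsilon> by (simp add: power_one_over field_simps)
    then have "ennreal (8 * \<epsilon> / 2 ^ k * t powr (- decay (ennreal q))) \<le> ennreal (e * t powr (- decay (ennreal q)))" for t
      by (intro ennreal_leI mult_right_mono) auto
    then show "\<exists>T>0. \<forall>t\<ge>T. Lp_norm (ennreal q) (w t) \<le> ennreal (e * t powr (- decay (ennreal q)))"
      using halving[of k] order_trans by blast
  qed
qed

lemma vanishing_aux:
  assumes w: "w = (\<lambda>t. u t - v t)" and vq: "vanishing w (ennreal q)"
  shows "q \<le> r \<Longrightarrow> 1 / q - real k * exponent_gain \<le> 1 / r \<Longrightarrow> vanishing w (ennreal r)"
proof (induction k arbitrary: r)
  case 0
  then have "r = q" using q_gt_1 by (simp add: field_simps)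
  then show ?case using vq by simp
next
  case (Suc k)
  have r1: "1 \<le> r" using Suc.prems q_gt_1 by simp
  then have p: "1 \<le> ennreal r" by simp
  obtain s where s: "q \<le> s" "ennreal (s / q) \<le> ennreal r"
    "real CARD('n) / 2 * (q / s - enn2real (1 / ennreal r)) < 1 / 2"
    "1 / s = min (1 / q) (enn2real (1 / ennreal r) + exponent_gain)"
    using source_exponent[OF p] .
  have "1 / q - real k * exponent_gain \<le> 1 / s"
    using Suc.prems(2) exponent_gain_pos r1 unfolding s(4) by (simp add: enn2real_one_div algebra_simps)
  then have "vanishing w (ennreal s)" by (rule Suc.IH[OF s(1)])
  then show ?case by (rule vanishing_step[OF p s(1-3), folded w, OF vq])
qed

text \<open>All intermediate exponents are finite, so the induction runs over real r; the exponent
  \<infinity> occurs only as the target of one last step.\<close>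

lemma vanishing_all:
  assumes vq: "vanishing (\<lambda>t. u t - v t) (ennreal q)" and p: "1 \<le> p"
  shows "vanishing (\<lambda>t. u t - v t) p"
proof -
  obtain r where r: "q \<le> r" "ennreal (r / q) \<le> p"
    "real CARD('n) / 2 * (q / r - enn2real (1 / p)) < 1 / 2"
    using source_exponent[OF p] by blast
  obtain k :: nat where "(1 / q) / exponent_gain \<le> real k" using real_arch_simple by blast
  then have "1 / q - real k * exponent_gain \<le> 0"
    using pos_divide_le_eq[OF exponent_gain_pos, of "1 / q" "real k"] by linarith
  also have "0 \<le> 1 / r" using r q_gt_1 by simp
  finally have "vanishing (\<lambda>t. u t - v t) (ennreal r)" by (rule vanishing_aux[OF refl vq r(1)])
  then show ?thesis using vanishing_step[OF p r vq] by simp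
qed

end

lemma vanishing_tendsto:
  assumes "vanishing w p"
  shows "((\<lambda>t. ennreal (t powr decay p) * Lp_norm p (w t)) \<longlongrightarrow> 0) at_top"
proof (rule order_tendstoI)
  fix b :: ennreal assume "0 < b"
  then obtain e where e: "0 < e" "ennreal e < b"
  proof (cases b)
    case (real c)
    then have "0 < c" using \<open>0 < b\<close> by auto
    then show ?thesis using that[of "c / 2"] real by (simp add: ennreal_lessI)
  next
    case top
    then show ?thesis using that[of 1] by simp
  qed
  obtain T where T: "0 < T" "\<And>t. T \<le> t \<Longrightarrow> Lp_norm p (w t) \<le> ennreal (e * t powr (- decay p))"
    using assms e(1) unfolding vanishing_def by blast
  show "\<forall>\<^sub>F t in at_top. ennreal (t powr decay p) * Lp_norm p (w t) < b"
    unfolding eventually_at_top_linorder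
  proof (intro exI[of _ T] allI impI)
    fix t assume t: "T \<le> t"
    have "ennreal (t powr decay p) * Lp_norm p (w t) \<le> ennreal (t powr decay p) * ennreal (e * t powr (- decay p))"
      by (intro mult_left_mono T(2) t) simp
    also have "\<dots> = ennreal e"
      using t T(1) e(1) by (simp add: powr_minus flip: ennreal_mult)
    finally show "ennreal (t powr decay p) * Lp_norm p (w t) < b" using e(2) by (rule le_less_trans)
  qed
qed simp

text \<open>The expression is a constant times \<epsilon>^(q-1) with q > 1, and the constant depends
  on a, n and \<beta> alone, hence neither on p nor on the data.\<close>

lemma contraction_threshold:
  obtains \<epsilon>0 where "0 < \<epsilon>0" "\<And>\<epsilon>. 0 < \<epsilon> \<Longrightarrow> \<epsilon> \<le> \<epsilon>0 \<Longrightarrow>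
    2 * 2 powr decay (ennreal q) * (early_const * \<epsilon> powr (q - 1) + late_const q (ennreal q) * (2 * \<epsilon>) powr (q - 1)) \<le> 1 / 4"
proof -
  \<comment> \<open>The absolute value makes L nonnegative without a discussion of signs; L + 1
    keeps the threshold meaningful when L = 0, as for a = 0.\<close>
  define L where "L = \<bar>2 * 2 powr decay (ennreal q) * (early_const + late_const q (ennreal q) * 2 powr (q - 1))\<bar>"
  define \<epsilon>0 where "\<epsilon>0 = (1 / (4 * (L + 1))) powr (1 / (q - 1))"
  have L: "0 \<le> L" by (simp add: L_def)
  show ?thesis
  proof (rule that[of \<epsilon>0])
    show "0 < \<epsilon>0" using L by (simp add: \<epsilon>0_def)
    fix \<epsilon> assume \<epsilon>: "0 < \<epsilon>" "\<epsilon> \<le> \<epsilon>0"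
    have "\<epsilon> powr (q - 1) \<le> \<epsilon>0 powr (q - 1)" using \<epsilon> q_gt_1 by (intro powr_mono2) auto
    also have "\<dots> = 1 / (4 * (L + 1))" using L q_gt_1 by (simp add: \<epsilon>0_def powr_powr)
    finally have "L * \<epsilon> powr (q - 1) \<le> L * (1 / (4 * (L + 1)))" using L by (rule mult_left_mono)
    also have "\<dots> \<le> 1 / 4" using L by (simp add: field_simps)
    finally have "L * \<epsilon> powr (q - 1) \<le> 1 / 4" .
    moreover have "2 * 2 powr decay (ennreal q) * (early_const * \<epsilon> powr (q - 1) + late_const q (ennreal q) * (2 * \<epsilon>) powr (q - 1))
      = 2 * 2 powr decay (ennreal q) * (early_const + late_const q (ennreal q) * 2 powr (q - 1)) * \<epsilon> powr (q - 1)"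
      by (simp add: powr_mult algebra_simps)
    moreover have "\<dots> \<le> L * \<epsilon> powr (q - 1)"
      unfolding L_def by (intro mult_right_mono abs_ge_self) simp
    ultimately show "2 * 2 powr decay (ennreal q) * (early_const * \<epsilon> powr (q - 1) + late_const q (ennreal q) * (2 * \<epsilon>) powr (q - 1)) \<le> 1 / 4"
      by linarith
  qed
qed

end

theorem theorem2p3:
  fixes a :: "real ^ 'n" and \<beta> q :: real
  assumes "0 < \<beta>" and "\<beta> < 1" and "q = 1 + 1 / (real CARD('n) + \<beta>)"
  shows "\<exists>\<epsilon>\<^sub>0>0. \<forall>\<epsilon>. 0 < \<epsilon> \<and> \<epsilon> \<le> \<epsilon>\<^sub>0 \<longrightarrow>
    (\<forall>u0 v0 u v.
       small_solution a \<beta> q \<epsilon> u0 u \<and> small_solution a \<beta> q \<epsilon> v0 v \<and>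
       ((\<lambda>t. ennreal (t powr (\<beta> / 2)) * Lp_norm 1 (heat t (u0 - v0))) \<longlongrightarrow> 0) at_top \<longrightarrow>
       (\<forall>p::ennreal. 1 \<le> p \<longrightarrow>
          ((\<lambda>t. ennreal (t powr (real CARD('n) / 2 * (1 - enn2real (1 / p)) + \<beta> / 2)) *
              Lp_norm p (u t - v t)) \<longlongrightarrow> 0) at_top))"
proof -
  interpret convection_diffusion a \<beta> q
    using assms by unfold_locales
  obtain \<epsilon>0 where \<epsilon>0: "0 < \<epsilon>0" "\<And>\<epsilon>. 0 < \<epsilon> \<Longrightarrow> \<epsilon> \<le> \<epsilon>0 \<Longrightarrow>
    2 * 2 powr decay (ennreal q) * (early_const * \<epsilon> powr (q - 1) + late_const q (ennreal q) * (2 * \<epsilon>) powr (q - 1)) \<le> 1 / 4"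
    using contraction_threshold by blast
  show ?thesis
  proof (intro exI[of _ \<epsilon>0] conjI allI impI)
    fix \<epsilon> u0 v0 u v and p :: ennreal
    assume \<epsilon>: "0 < \<epsilon> \<and> \<epsilon> \<le> \<epsilon>0"
      and *: "small_solution a \<beta> q \<epsilon> u0 u \<and> small_solution a \<beta> q \<epsilon> v0 v \<and>
        ((\<lambda>t. ennreal (t powr (\<beta> / 2)) * Lp_norm 1 (heat t (u0 - v0))) \<longlongrightarrow> 0) at_top"
      and p: "1 \<le> p"
    then have u: "small_solution a \<beta> q \<epsilon> u0 u" and v: "small_solution a \<beta> q \<epsilon> v0 v"
      and lim: "((\<lambda>t. ennreal (t powr (\<beta> / 2)) * Lp_norm 1 (heat t (u0 - v0))) \<longlongrightarrow> 0) at_top"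
      by blast+
    have "vanishing (\<lambda>t. u t - v t) (ennreal q)"
      using vanishing_q[OF u v lim] \<epsilon>0(2) \<epsilon> by blast
    then have "vanishing (\<lambda>t. u t - v t) p"
      using p by (rule vanishing_all[OF u v lim])
    from vanishing_tendsto[OF this]
    show "((\<lambda>t. ennreal (t powr (real CARD('n) / 2 * (1 - enn2real (1 / p)) + \<beta> / 2)) *
              Lp_norm p (u t - v t)) \<longlongrightarrow> 0) at_top"
      unfolding decay_def .
  qed (rule \<epsilon>0(1))
qed

end
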